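(* Let $G\subset \mathrm{Diff}^3_+(\mathbf{S}^1)$ be a finitely generated subgroup such that the action of $G$ on $\mathbf{S}^1$ is minimal, satisfies property $(\star)$ and has a non-expandable point $x_0\in\mathbf{S}^1$. Then the Schreier graph of the orbit of $x_0$ has infinitely many ends.
   Context: $\mathrm{Diff}^r_+(\mathbf{S}^1)$ is the group of orientation-preserving $C^r$ diffeomorphisms of the circle $\mathbf{S}^1=\mathbb{R}/\mathbb{Z}$. The action is minimal if every orbit is dense. Non-expandable points: $x\in\mathbf{S}^1$ is non-expandable if $g'(x)\le 1$ for every $g\in G$; the set of these is $\mathrm{NE}$. Property $(\star)$ ($C^2$ case): let $G\subset\mathrm{Diff}^2_+(\mathbf{S}^1)$ have no finite orbit and let $\Lambda$ be its minimal invariant closed set (here $\Lambda=\mathbf{S}^1$ as the action is minimal). $G$ has property $(\star)$ if for every $x\in\mathrm{NE}\cap\Lambda$ there are $g_+,g_-\in G$ such that $x$ is an isolated fixed point in $\Lambda$ from the right for $g_+|_\Lambda$ and from the left for $g_-|_\Lambda$; i.e. $g_\pm(x)=x$ and, for some $\varepsilon>0$, $g_+$ has no fixed point in $\Lambda\cap(x,x+\varepsilon)$ and $g_-$ has no fixed point in $\Lambda\cap(x-\varepsilon,x)$. Schreier graph: if $\mathcal{G}$ is a finite generating set of $G$ and $X$ is an orbit, the Schreier graph has vertex set $X$, and $x,y\in X$ are joined by an edge if $s(x)=y$ for some $s\in\mathcal{G}$. The number of ends of a connected graph is the supremum, over compact subsets $K$, of the number of unbounded connected components of the complement of $K$; for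 the Schreier graph it does not depend on the finite generating set. *)

theory Defs
  imports
    "HOL-Analysis.Analysis"
    "HOL-Library.Extended_Nat"
    "HOL-Algebra.Bij"
    "HOL-Algebra.Generated_Groups"
begin

section \<open>The circle as the quotient of the reals by the integers\<close>

definition circle_rel :: "real \<Rightarrow> real \<Rightarrow> bool" where
  "circle_rel s t \<longleftrightarrow> s - t \<in> \<int>"

lemma equivp_circle_rel: "equivp circle_rel"
proof (rule equivpI)
  show "reflp circle_rel"
    by (simp add: reflp_def circle_rel_def)
  show "symp circle_rel"
    unfolding symp_def circle_rel_def by (auto dest: Ints_minus)
  show "transp circle_rel"
    unfolding transp_def circle_rel_def
  proof (intro allI impI)
    fix r s t :: real
    assume "r - s \<in> \<int>" "s - t \<in> \<int>"
    then have "(r - s) + (s - t) \<in> \<int>" by (rule Ints_add)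
    then show "r - t \<in> \<int>" by simp
  qed
qed

quotient_type circle = real / circle_rel
  by (rule equivp_circle_rel)

abbreviation circle_of :: "real \<Rightarrow> circle" where
  "circle_of \<equiv> abs_circle"

lemma circle_of_eq_iff: "circle_of s = circle_of t \<longleftrightarrow> s - t \<in> \<int>"
  by (simp add: circle.abs_eq_iff circle_rel_def)

lemma circle_of_surj: "\<exists>t. circle_of t = x"
  using Quotient_abs_rep[OF Quotient_circle] by blast

text \<open>The quotient topology.\<close>

instantiation circle :: topological_space
begin

definition open_circle :: "circle set \<Rightarrow> bool" where
  "open_circle U \<longleftrightarrow> open (circle_of -` U)"

instance
  by standard (auto simp: open_circle_def vimage_Union vimage_Int)

end

lemma continuous_on_circle_of: "continuous_on UNIV circle_of"
  by (simp add: continuous_on_open_vimage open_circle_def)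

text \<open>The arcs \<open>(x, x + \<epsilon>)\<close> and \<open>(x - \<epsilon>, x)\<close>. They are the expected
  ones for \<open>\<epsilon> \<le> 1\<close>; for larger \<open>\<epsilon>\<close> they are the whole circle.\<close>

definition right_arc :: "circle \<Rightarrow> real \<Rightarrow> circle set" where
  "right_arc x \<epsilon> = {circle_of (t + s) | t s. circle_of t = x \<and> 0 < s \<and> s < \<epsilon>}"

definition left_arc :: "circle \<Rightarrow> real \<Rightarrow> circle set" where
  "left_arc x \<epsilon> = {circle_of (t - s) | t s. circle_of t = x \<and> 0 < s \<and> s < \<epsilon>}"


section \<open>Diffeomorphisms of the circle\<close>

definition Cr_real :: "nat \<Rightarrow> (real \<Rightarrow> real) \<Rightarrow> bool" where
  "Cr_real r f \<longleftrightarrow>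
     (\<forall>k<r. \<forall>t. (deriv ^^ k) f field_differentiable (at t)) \<and>
     continuous_on UNIV ((deriv ^^ r) f)"

definition is_lift :: "(real \<Rightarrow> real) \<Rightarrow> (circle \<Rightarrow> circle) \<Rightarrow> bool" where
  "is_lift F g \<longleftrightarrow> continuous_on UNIV F \<and> (\<forall>t. circle_of (F t) = g (circle_of t))"

definition Cr_circle :: "nat \<Rightarrow> (circle \<Rightarrow> circle) \<Rightarrow> bool" where
  "Cr_circle r g \<longleftrightarrow> (\<exists>F. is_lift F g \<and> Cr_real r F)"

definition orientation_preserving :: "(circle \<Rightarrow> circle) \<Rightarrow> bool" where
  "orientation_preserving g \<longleftrightarrow> (\<exists>F. is_lift F g \<and> strict_mono F)"

definition Diff_plus :: "nat \<Rightarrow> (circle \<Rightarrow> circle) set" where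
  "Diff_plus r = {g. bij g \<and> Cr_circle r g \<and> Cr_circle r (inv_into UNIV g) \<and> orientation_preserving g}"

text \<open>The derivative of a circle map is that of any of its lifts at any representative of
  the point; \<open>circle_deriv_eq\<close> below shows that the choices do not matter.\<close>

definition circle_deriv :: "(circle \<Rightarrow> circle) \<Rightarrow> circle \<Rightarrow> real" where
  "circle_deriv g x =
     (THE d. \<forall>F t. is_lift F g \<longrightarrow> circle_of t = x \<longrightarrow> (F has_real_derivative d) (at t))"

lemma continuous_Ints_constant:
  fixes f :: "real \<Rightarrow> real"
  assumes "continuous_on UNIV f" "\<And>t. f t \<in> \<int>"
  shows "f s = f t"
proof -
  have "f constant_on UNIV"
  proof (rule continuous_discrete_range_constant[OF connected_UNIV assms(1)])
    fix s :: real
    show "\<exists>e>0. \<forall>t. t \<in> UNIV \<and> f t \<noteq> f s \<longrightarrow> e \<le> norm (f t - f s)"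
    proof (intro exI[of _ 1] conjI allI impI)
      fix t assume "t \<in> UNIV \<and> f t \<noteq> f s"
      then have "f t - f s \<noteq> 0" "f t - f s \<in> \<int>" using assms(2) by auto
      then show "1 \<le> norm (f t - f s)" by (simp add: Ints_nonzero_abs_ge1)
    qed simp
  qed
  then show ?thesis by (auto simp: constant_on_def)
qed

lemma circle_deriv_eq:
  assumes F: "is_lift F g" and d: "(F has_real_derivative d) (at t)"
  shows "circle_deriv g (circle_of t) = d"
proof -
  have main: "(H has_real_derivative d) (at s)"
    if H: "is_lift H g" and s: "circle_of s = circle_of t" for H s
  proof -
    define n where "n = s - t"
    have n: "n \<in> \<int>" using s by (simp add: n_def circle_of_eq_iff)
    have "circle_of (u - n) = circle_of u" for u
      using n by (simp add: circle_of_eq_iff)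
    then have "circle_of (H u) = circle_of (F (u - n))" for u
      using F H by (simp add: is_lift_def)
    then have int: "H u - F (u - n) \<in> \<int>" for u by (simp add: circle_of_eq_iff)
    have "continuous_on UNIV F" "continuous_on UNIV H" using F H by (simp_all add: is_lift_def)
    moreover have "continuous_on UNIV (\<lambda>u. u - n)" by (intro continuous_intros)
    ultimately have "continuous_on UNIV (\<lambda>u. H u - F (u - n))"
      using continuous_on_compose2[of UNIV F UNIV "\<lambda>u. u - n"]
      by (simp add: continuous_on_diff)
    note const = continuous_Ints_constant[OF this int]
    define c where "c = H 0 - F (0 - n)"
    have "H u = F (u - n) + c" for u
      using const[of u 0] unfolding c_def by linarith
    then have H_eq: "H = (\<lambda>u. F (u + - n) + c)" by auto
    have "(F has_real_derivative d) (at (s + - n))" using d by (simp add: n_def)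
    then have "((\<lambda>u. F (u + - n)) has_real_derivative d) (at s)"
      using DERIV_shift[of F d s "- n"] by blast
    then have "((\<lambda>u. F (u + - n) + c) has_real_derivative d + 0) (at s)"
      by (rule DERIV_add[OF _ DERIV_const])
    then show ?thesis unfolding H_eq by (simp only: add_0_right)
  qed
  show ?thesis
    unfolding circle_deriv_def
  proof (rule the_equality)
    show "\<forall>H s. is_lift H g \<longrightarrow> circle_of s = circle_of t \<longrightarrow> (H has_real_derivative d) (at s)"
      using main by blast
  next
    fix d' assume "\<forall>H s. is_lift H g \<longrightarrow> circle_of s = circle_of t \<longrightarrow> (H has_real_derivative d') (at s)"
    then have "(F has_real_derivative d') (at t)" using F by blast
    then show "d' = d" using d by (rule DERIV_unique)
  qed
qed


section \<open>Group actions on the circle\<close>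

definition orbit :: "('a \<Rightarrow> 'a) set \<Rightarrow> 'a \<Rightarrow> 'a set" where
  "orbit G x = {g x | g. g \<in> G}"

definition minimal_action :: "('a::topological_space \<Rightarrow> 'a) set \<Rightarrow> bool" where
  "minimal_action G \<longleftrightarrow> (\<forall>x. closure (orbit G x) = UNIV)"

definition closed_invariant :: "('a::topological_space \<Rightarrow> 'a) set \<Rightarrow> 'a set \<Rightarrow> bool" where
  "closed_invariant G A \<longleftrightarrow> A \<noteq> {} \<and> closed A \<and> (\<forall>g\<in>G. g ` A \<subseteq> A)"

text \<open>The minimal set is unique, and so this is the intended set, whenever a group of circle
  homeomorphisms has no finite orbit.\<close>

definition minimal_set :: "('a::topological_space \<Rightarrow> 'a) set \<Rightarrow> 'a set" where
  "minimal_set G =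
     (THE A. closed_invariant G A \<and> (\<forall>B. closed_invariant G B \<longrightarrow> B \<subseteq> A \<longrightarrow> B = A))"

lemma minimal_set_minimal_action:
  fixes G :: "('a::topological_space \<Rightarrow> 'a) set"
  assumes "minimal_action G"
  shows "minimal_set G = UNIV"
proof -
  have inv: "A = UNIV" if A: "closed_invariant G A" for A
  proof -
    obtain x where "x \<in> A" using A by (auto simp: closed_invariant_def)
    then have "orbit G x \<subseteq> A" using A by (auto simp: closed_invariant_def orbit_def)
    then have "closure (orbit G x) \<subseteq> A"
      using A by (simp add: closed_invariant_def closure_minimal)
    then show ?thesis using assms by (auto simp: minimal_action_def)
  qed
  have "closed_invariant G UNIV" by (simp add: closed_invariant_def)
  then show ?thesis
    unfolding minimal_set_def by (intro the_equality) (use inv in blast)+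
qed

definition NE :: "(circle \<Rightarrow> circle) set \<Rightarrow> circle set" where
  "NE G = {x. \<forall>g\<in>G. circle_deriv g x \<le> 1}"

definition property_star :: "(circle \<Rightarrow> circle) set \<Rightarrow> bool" where
  "property_star G \<longleftrightarrow>
     (\<forall>x \<in> NE G \<inter> minimal_set G.
        (\<exists>g\<in>G. g x = x \<and> (\<exists>\<epsilon>>0. \<forall>y \<in> minimal_set G \<inter> right_arc x \<epsilon>. g y \<noteq> y)) \<and>
        (\<exists>g\<in>G. g x = x \<and> (\<exists>\<epsilon>>0. \<forall>y \<in> minimal_set G \<inter> left_arc x \<epsilon>. g y \<noteq> y)))"


section \<open>Ends of graphs and Schreier graphs\<close>

text \<open>A graph is given by a vertex set \<open>V\<close> and a symmetric set \<open>E\<close> of pairs of vertices. Its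
  geometric realization is described by barycentric coordinates, with the topology of
  pointwise convergence; on a locally finite graph this is the usual topology. A loop is
  identified with its vertex, which does not affect the ends.\<close>

definition realization :: "'a set \<Rightarrow> ('a \<times> 'a) set \<Rightarrow> ('a \<Rightarrow> real) set" where
  "realization V E =
     {(\<lambda>v. (1 - t) * indicator {x} v + t * indicator {y} v) | x y t.
        x \<in> V \<and> y \<in> V \<and> (x = y \<or> (x, y) \<in> E) \<and> 0 \<le> t \<and> t \<le> 1}"

text \<open>Boundedness for the path metric: the vertices of the edges met by \<open>C\<close> are at uniformly
  bounded distance in the graph.\<close>

definition graph_bounded :: "('a \<times> 'a) set \<Rightarrow> ('a \<Rightarrow> real) set \<Rightarrow> bool" where
  "graph_bounded E C \<longleftrightarrow>
     (\<exists>n. \<forall>p\<in>C. \<forall>q\<in>C. \<forall>v w. p v \<noteq> 0 \<longrightarrow> q w \<noteq> 0 \<longrightarrow> (\<exists>k\<le>n. (v, w) \<in> E ^^ k))"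

definition ecount :: "'a set \<Rightarrow> enat" where
  "ecount A = (if finite A then enat (card A) else \<infinity>)"

definition number_of_ends :: "'a set \<Rightarrow> ('a \<times> 'a) set \<Rightarrow> enat" where
  "number_of_ends V E =
     (SUP K \<in> {K. K \<subseteq> realization V E \<and> compact K}.
        ecount {C \<in> components (realization V E - K). \<not> graph_bounded E C})"

definition schreier_edges :: "('a \<Rightarrow> 'a) set \<Rightarrow> 'a set \<Rightarrow> ('a \<times> 'a) set" where
  "schreier_edges S X = {(x, y). x \<in> X \<and> y \<in> X \<and> (\<exists>s\<in>S. s x = y \<or> s y = x)}"

end

theory Submission
  imports Defs
begin

text \<open>Pass to lifts to the real line. Elements fixing the non-expandable point have derivative 1 there,
  so \<open>D (F t0) = F' t0\<close> is a well-defined function on the orbit with values in \<open>(0, 1]\<close>. Distinct orbit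
  points \<open>u\<close>, \<open>v\<close> satisfy \<open>\<bar>u - v\<bar> \<ge> c * min (D u) (D v)\<close>: otherwise expand the pair with bounded
  distortion to macroscopic size, using the isolated fixed points near non-expandable points. Hence only
  finitely many orbit points have \<open>D \<ge> \<epsilon>\<close>, and the sum of \<open>D u * D w\<close> over the pairs with
  \<open>Qf u w = (u - w)\<^sup>2 / (D u * D w)\<close> bounded converges. As \<open>Qf\<close> is a Moebius invariant, a \<open>C\<^sup>3\<close> map changes
  \<open>ln (Qf u w)\<close> by at most \<open>C * (u - w)\<^sup>2\<close>; so along a simple path in the Schreier graph that stays in
  \<open>D < \<epsilon>\<close> the values of \<open>Qf\<close> are preserved up to a factor 2. Now let \<open>h\<close> fix the base point and contract
  to it from the right. If a path in \<open>D < \<epsilon>\<close> joined \<open>h ^^ n p\<close> to \<open>h ^^ n' p'\<close> with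
  \<open>D p'\<close> much smaller than \<open>D p\<close>, it would carry the left neighbours of the first point (in the sense of \<open>Qf\<close>)
  to left neighbours of the second one, too many of which would crowd into a short interval,
  against the separation estimate. So points \<open>p\<close> with rapidly decreasing \<open>D p\<close> give
  sequences going to different ends.\<close>

section \<open>Groups of lifts with a non-expandable base point\<close>

text \<open>The obstacle is distortion along Schreier paths of unbounded length. First-order control
  through \<open>ln_deriv_lipschitz\<close> would need \<open>D\<close> itself to be summable over
  the orbit modulo integers. Separation does not give this: it bounds the number of orbit points
  with \<open>D\<close> about 2^-k only by a multiple of 2^k, so each dyadic shell may contribute a
  constant. Second-order errors are affordable, because the products \<open>D u * D w\<close> over
  neighbouring pairs sum geometrically. Hence lengths are replaced by \<open>Qf\<close>, and
  \<open>projective_distortion\<close> is where the third derivative enters. A contradiction then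
  needs points whose neighbours are known explicitly. Since \<open>deriv h t0 = 1\<close>, the
  displacement of \<open>h\<close> is almost constant over many iterates, so near \<open>t0\<close>
  the points \<open>(h ^^ m) y\<close> resemble an arithmetic progression of step
  \<open>l = y - h y\<close>, with \<open>D\<close> of order \<open>l\<close> up to a fixed factor.
  For \<open>y = (h ^^ n) p\<close> the neighbour of index \<open>m\<close> has \<open>Qf\<close> at
  most of order \<open>m^2 / D p\<close>, whatever \<open>n\<close> is. So the supply of left
  neighbours below a given value of \<open>Qf\<close> depends on \<open>D p\<close>, and this tells
  the sequences apart.\<close>

locale circle_lifts =
  fixes \<Gamma> :: "(real \<Rightarrow> real) set" and t0 :: real
  assumes comp_mem: "F \<in> \<Gamma> \<Longrightarrow> H \<in> \<Gamma> \<Longrightarrow> F \<circ> H \<in> \<Gamma>"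
    and inverse_ex: "F \<in> \<Gamma> \<Longrightarrow> \<exists>H\<in>\<Gamma>. (\<forall>t. H (F t) = t) \<and> (\<forall>t. F (H t) = t)"
    and shift_mem: "(\<lambda>t. t + of_int k) \<in> \<Gamma>"
    and commutes_one: "F \<in> \<Gamma> \<Longrightarrow> F (t + 1) = F t + 1"
    and has_deriv: "F \<in> \<Gamma> \<Longrightarrow> (F has_real_derivative deriv F t) (at t)"
    and deriv_pos: "F \<in> \<Gamma> \<Longrightarrow> 0 < deriv F t"
    and ln_deriv_lipschitz:
      "F \<in> \<Gamma> \<Longrightarrow> \<exists>B\<ge>0. \<forall>s t. \<bar>ln (deriv F s) - ln (deriv F t)\<bar> \<le> B * \<bar>s - t\<bar>"
    and projective_distortion:
      "F \<in> \<Gamma> \<Longrightarrow> \<exists>C\<ge>0. \<forall>s t. s \<noteq> t \<longrightarrow> \<bar>s - t\<bar> \<le> 1 \<longrightarrow>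
         \<bar>ln (deriv F s * deriv F t * (s - t)^2 / (F s - F t)^2)\<bar> \<le> C * (s - t)^2"
    and nonexpandable: "F \<in> \<Gamma> \<Longrightarrow> deriv F t0 \<le> 1"
    and isolated_right: "(\<And>F. F \<in> \<Gamma> \<Longrightarrow> deriv F z \<le> 1) \<Longrightarrow>
      \<exists>h\<in>\<Gamma>. h z = z \<and> (\<exists>\<epsilon>>0. \<forall>y. z < y \<and> y < z + \<epsilon> \<longrightarrow> h y \<noteq> y)"
    and isolated_left: "(\<And>F. F \<in> \<Gamma> \<Longrightarrow> deriv F z \<le> 1) \<Longrightarrow>
      \<exists>h\<in>\<Gamma>. h z = z \<and> (\<exists>\<epsilon>>0. \<forall>y. z - \<epsilon> < y \<and> y < z \<longrightarrow> h y \<noteq> y)"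
    and dense_orbit: "a < b \<Longrightarrow> \<exists>F\<in>\<Gamma>. a < F t0 \<and> F t0 < b"
begin

lemma id_mem: "id \<in> \<Gamma>"
  using shift_mem[of 0] by (simp add: id_def)

lemma deriv_id: "deriv id t = (1::real)"
  by (simp add: id_def)

lemma deriv_comp:
  assumes "F \<in> \<Gamma>" "H \<in> \<Gamma>" shows "deriv (F \<circ> H) t = deriv F (H t) * deriv H t"
  by (intro DERIV_imp_deriv DERIV_chain has_deriv assms)

lemma mono_lift: assumes "F \<in> \<Gamma>" shows "strict_mono F"
proof (rule strict_monoI)
  fix x y :: real assume "x < y"
  then show "F x < F y"
    using DERIV_pos_imp_increasing[of x y F] has_deriv[OF assms] deriv_pos[OF assms] by blast
qed

lemma lift_less_iff: "F \<in> \<Gamma> \<Longrightarrow> F x < F y \<longleftrightarrow> x < y"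
  and lift_le_iff: "F \<in> \<Gamma> \<Longrightarrow> F x \<le> F y \<longleftrightarrow> x \<le> y"
  and lift_eq_iff: "F \<in> \<Gamma> \<Longrightarrow> F x = F y \<longleftrightarrow> x = y"
  using mono_lift strict_mono_less strict_mono_less_eq strict_mono_eq by blast+

lemma continuous_lift: "F \<in> \<Gamma> \<Longrightarrow> continuous_on A F"
  using has_deriv by (metis DERIV_continuous continuous_at_imp_continuous_on)

lemma continuous_deriv: assumes "F \<in> \<Gamma>" shows "continuous_on A (deriv F)"
proof -
  obtain B where B: "B \<ge> 0" "\<And>s t. \<bar>ln (deriv F s) - ln (deriv F t)\<bar> \<le> B * \<bar>s - t\<bar>"
    using ln_deriv_lipschitz[OF assms] by blast
  have "B-lipschitz_on A (\<lambda>t. ln (deriv F t))"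
    by (rule lipschitz_onI) (use B in \<open>auto simp: dist_real_def\<close>)
  then have "continuous_on A (\<lambda>t. ln (deriv F t))"
    by (rule lipschitz_on_continuous_on)
  then have "continuous_on A (\<lambda>t. exp (ln (deriv F t)))"
    by (rule continuous_on_exp)
  then show ?thesis using deriv_pos[OF assms] by simp
qed

lemma lift_mvt:
  assumes "F \<in> \<Gamma>" "a < b" obtains \<xi> where "a < \<xi>" "\<xi> < b" "F b - F a = (b - a) * deriv F \<xi>"
  using MVT2[of a b F "deriv F"] has_deriv[OF assms(1)] assms(2) by blast

lemma commutes_int: assumes "F \<in> \<Gamma>" shows "F (t + of_int k) = F t + of_int k"
proof (induction k rule: int_induct[of _ 0])
  case base then show ?case by simp
next
  case (step1 i)
  then show ?case using commutes_one[OF assms, of "t + of_int i"] by (simp add: algebra_simps)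
next
  case (step2 i)
  then show ?case using commutes_one[OF assms, of "t + of_int i - 1"] by (simp add: algebra_simps)
qed

lemma deriv_shift: "deriv (\<lambda>t. t + of_int k) t = (1::real)"
  by (intro DERIV_imp_deriv) (auto intro!: derivative_eq_intros)

lemma inverseE:
  assumes "F \<in> \<Gamma>"
  obtains H where "H \<in> \<Gamma>" "\<And>t. H (F t) = t" "\<And>t. F (H t) = t" "\<And>t. deriv H (F t) = inverse (deriv F t)"
proof -
  obtain H where H: "H \<in> \<Gamma>" "\<And>t. H (F t) = t" "\<And>t. F (H t) = t"
    using inverse_ex[OF assms] by blast
  have "deriv H (F t) * deriv F t = 1" for t
  proof -
    have "H \<circ> F = id" using H by auto
    then show ?thesis using deriv_comp[OF H(1) assms, of t] by (simp add: deriv_id)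
  qed
  then have "deriv H (F t) = inverse (deriv F t)" for t
    by (metis inverse_unique mult.commute)
  then show thesis using that H by blast
qed

lemma funpow_mem: "F \<in> \<Gamma> \<Longrightarrow> F ^^ n \<in> \<Gamma>"
  by (induction n) (auto simp: comp_mem id_mem[unfolded id_def] id_def)

section \<open>The orbit on the line and the derivative along it\<close>

definition X :: "real set" where "X = {F t0 | F. F \<in> \<Gamma>}"

text \<open>By \<open>stabilizer_deriv\<close> below the choice does not matter on \<open>X\<close>; off \<open>X\<close> the value is junk.\<close>

definition D :: "real \<Rightarrow> real" where "D t = deriv (SOME F. F \<in> \<Gamma> \<and> F t0 = t) t0"

text \<open>The inverse fixes \<open>t0\<close> too, so two mutually inverse derivatives are both at
  most 1.\<close>

lemma stabilizer_deriv:
  assumes "F \<in> \<Gamma>" "F t0 = t0" shows "deriv F t0 = 1"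
proof -
  obtain H where H: "H \<in> \<Gamma>" "\<And>t. deriv H (F t) = inverse (deriv F t)"
    using inverseE[OF assms(1)] by metis
  have "inverse (deriv F t0) \<le> 1" using nonexpandable[OF H(1)] H(2)[of t0] assms(2) by simp
  then have "1 \<le> deriv F t0" using deriv_pos[OF assms(1), of t0]
    by (simp add: field_simps)
  then show ?thesis using nonexpandable[OF assms(1)] by simp
qed

lemma D_lift: assumes "F \<in> \<Gamma>" shows "D (F t0) = deriv F t0"
proof -
  define K where "K = (SOME K. K \<in> \<Gamma> \<and> K t0 = F t0)"
  have K: "K \<in> \<Gamma>" "K t0 = F t0"
    unfolding K_def using someI[of "\<lambda>K. K \<in> \<Gamma> \<and> K t0 = F t0" F] assms by auto
  obtain H where H: "H \<in> \<Gamma>" "\<And>t. H (F t) = t" "\<And>t. deriv H (F t) = inverse (deriv F t)"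
    using inverseE[OF assms] by metis
  have "deriv (H \<circ> K) t0 = 1"
    by (rule stabilizer_deriv) (use H K comp_mem in auto)
  then have "inverse (deriv F t0) * deriv K t0 = 1"
    using deriv_comp[OF H(1) K(1), of t0] H(3)[of t0] K(2) by simp
  then have "deriv K t0 = deriv F t0" using deriv_pos[OF assms, of t0] by (simp add: field_simps)
  then show ?thesis by (simp add: D_def K_def)
qed

lemma X_lift: "t \<in> X \<Longrightarrow> F \<in> \<Gamma> \<Longrightarrow> F t \<in> X"
  unfolding X_def by (smt (verit) comp_apply comp_mem mem_Collect_eq)

lemma D_comp: assumes "t \<in> X" "F \<in> \<Gamma>" shows "D (F t) = deriv F t * D t"
proof -
  obtain H where H: "H \<in> \<Gamma>" "t = H t0" using assms(1) by (auto simp: X_def)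
  show ?thesis
    using D_lift[OF comp_mem[OF assms(2) H(1)]] D_lift[OF H(1)] deriv_comp[OF assms(2) H(1), of t0] H(2)
    by simp
qed

lemma D_pos: "t \<in> X \<Longrightarrow> 0 < D t" and D_le_1: "t \<in> X \<Longrightarrow> D t \<le> 1"
  using D_lift deriv_pos nonexpandable by (auto simp: X_def)

lemma t0_mem: "t0 \<in> X" and D_t0: "D t0 = 1"
  using id_mem D_lift[OF id_mem] by (auto simp: X_def deriv_id intro: exI[of _ id])

lemma X_shift: "t \<in> X \<Longrightarrow> t + of_int k \<in> X"
  using X_lift[OF _ shift_mem[of k]] by simp

lemma D_shift: "t \<in> X \<Longrightarrow> D (t + of_int k) = D t"
  using D_comp[OF _ shift_mem[of k]] deriv_shift by simp

lemma dense_X: "a < b \<Longrightarrow> \<exists>t\<in>X. a < t \<and> t < b"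
  using dense_orbit unfolding X_def by blast

text \<open>Reflecting the line exchanges the two sides of a point, and with them
  \<open>isolated_left\<close> and \<open>isolated_right\<close>; estimates to the left of a point
  then follow from those to the right.\<close>

lemma circle_lifts_mirror:
  "circle_lifts ((\<lambda>F t. - F (- t)) ` \<Gamma>) (- t0)"
proof -
  have hd: "((\<lambda>t. - F (- t)) has_real_derivative deriv F (- t)) (at t)" if "F \<in> \<Gamma>" for F t
    using has_deriv[OF that, of "- t"]
    by (auto intro!: derivative_eq_intros DERIV_chain2[of F _ "uminus"])
  have d: "deriv (\<lambda>t. - F (- t)) t = deriv F (- t)" if "F \<in> \<Gamma>" for F t
    using DERIV_imp_deriv[OF hd[OF that]] .
  show ?thesis
  proof
    fix F H assume "F \<in> (\<lambda>F t. - F (- t)) ` \<Gamma>" "H \<in> (\<lambda>F t. - F (- t)) ` \<Gamma>"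
    then obtain F' H' where "F' \<in> \<Gamma>" "H' \<in> \<Gamma>" "F = (\<lambda>t. - F' (- t))" "H = (\<lambda>t. - H' (- t))" by blast
    then have "F \<circ> H = (\<lambda>t. - (F' \<circ> H') (- t))" "F' \<circ> H' \<in> \<Gamma>" by (auto simp: comp_mem)
    then show "F \<circ> H \<in> (\<lambda>F t. - F (- t)) ` \<Gamma>" by blast
  next
    fix F assume "F \<in> (\<lambda>F t. - F (- t)) ` \<Gamma>"
    then obtain F' where F: "F' \<in> \<Gamma>" "F = (\<lambda>t. - F' (- t))" by blast
    obtain H where H: "H \<in> \<Gamma>" "\<And>t. H (F' t) = t" "\<And>t. F' (H t) = t" using inverseE[OF F(1)] by metis
    show "\<exists>H\<in>(\<lambda>F t. - F (- t)) ` \<Gamma>. (\<forall>t. H (F t) = t) \<and> (\<forall>t. F (H t) = t)"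
      by (intro bexI[of _ "\<lambda>t. - H (- t)"]) (use F H in auto)
    show "(F has_real_derivative deriv F t) (at t)" for t using F d[OF F(1)] hd[OF F(1)] by simp
    show "0 < deriv F t" for t using F d[OF F(1)] deriv_pos[OF F(1)] by simp
    show "deriv F (- t0) \<le> 1" using F d[OF F(1)] nonexpandable[OF F(1)] by simp
    show "F (t + 1) = F t + 1" for t using commutes_int[OF F(1), of "- t" "-1"] F(2) by simp
    obtain B where B: "B\<ge>0" "\<And>s t. \<bar>ln (deriv F' s) - ln (deriv F' t)\<bar> \<le> B * \<bar>s - t\<bar>"
      using ln_deriv_lipschitz[OF F(1)] by blast
    show "\<exists>B\<ge>0. \<forall>s t. \<bar>ln (deriv F s) - ln (deriv F t)\<bar> \<le> B * \<bar>s - t\<bar>"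
      using B(1) B(2)[of "- _" "- _"] unfolding F(2) d[OF F(1)]
      by (intro exI[of _ B]) (auto simp: abs_minus_commute)
    obtain C where C: "C\<ge>0" "\<And>s t. s \<noteq> t \<Longrightarrow> \<bar>s - t\<bar> \<le> 1 \<Longrightarrow>
         \<bar>ln (deriv F' s * deriv F' t * (s - t)^2 / (F' s - F' t)^2)\<bar> \<le> C * (s - t)^2"
      using projective_distortion[OF F(1)] by blast
    have eq: "(- s - - t)^2 = (s - t)^2" for s t :: real by (simp add: power2_eq_square algebra_simps)
    show "\<exists>C\<ge>0. \<forall>s t. s \<noteq> t \<longrightarrow> \<bar>s - t\<bar> \<le> 1 \<longrightarrow>
         \<bar>ln (deriv F s * deriv F t * (s - t)^2 / (F s - F t)^2)\<bar> \<le> C * (s - t)^2"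
      unfolding F(2) d[OF F(1)]
    proof (intro exI[of _ C] conjI C(1) allI impI)
      fix s t :: real assume "s \<noteq> t" "\<bar>s - t\<bar> \<le> 1"
      then show "\<bar>ln (deriv F' (- s) * deriv F' (- t) * (s - t)^2 / (- F' (- s) - - F' (- t))^2)\<bar> \<le> C * (s - t)^2"
        using C(2)[of "-s" "-t"] unfolding eq by simp
    qed
  next
    fix k
    have "(\<lambda>t::real. t + of_int k) = (\<lambda>t. - (- t + of_int (- k)))" by auto
    then show "(\<lambda>t. t + of_int k) \<in> (\<lambda>F t. - F (- t)) ` \<Gamma>" using shift_mem[of "- k"] by (rule image_eqI)
  next
    fix z assume "\<And>F. F \<in> (\<lambda>F t. - F (- t)) ` \<Gamma> \<Longrightarrow> deriv F z \<le> 1"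
    then have *: "\<And>F. F \<in> \<Gamma> \<Longrightarrow> deriv F (- z) \<le> 1" using d by force
    obtain h e where h: "h \<in> \<Gamma>" "h (- z) = - z" "e > 0" "\<And>y. - z - e < y \<Longrightarrow> y < - z \<Longrightarrow> h y \<noteq> y"
      using isolated_left[OF *] by auto
    show "\<exists>h\<in>(\<lambda>F t. - F (- t)) ` \<Gamma>. h z = z \<and> (\<exists>\<epsilon>>0. \<forall>y. z < y \<and> y < z + \<epsilon> \<longrightarrow> h y \<noteq> y)"
    proof (intro bexI[of _ "\<lambda>t. - h (- t)"] conjI exI[of _ e] allI impI)
      fix y assume "z < y \<and> y < z + e"
      then show "- h (- y) \<noteq> y" using h(4)[of "- y"] by auto
    qed (use h in auto)
    obtain h e where h: "h \<in> \<Gamma>" "h (- z) = - z" "e > 0" "\<And>y. - z < y \<Longrightarrow> y < - z + e \<Longrightarrow> h y \<noteq> y"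
      using isolated_right[OF *] by auto
    show "\<exists>h\<in>(\<lambda>F t. - F (- t)) ` \<Gamma>. h z = z \<and> (\<exists>\<epsilon>>0. \<forall>y. z - \<epsilon> < y \<and> y < z \<longrightarrow> h y \<noteq> y)"
    proof (intro bexI[of _ "\<lambda>t. - h (- t)"] conjI exI[of _ e] allI impI)
      fix y assume "z - e < y \<and> y < z"
      then show "- h (- y) \<noteq> y" using h(4)[of "- y"] by auto
    qed (use h in auto)
  next
    fix a b :: real assume "a < b"
    then obtain F where "F \<in> \<Gamma>" "- b < F t0" "F t0 < - a" using dense_orbit[of "- b" "- a"] by auto
    then show "\<exists>F\<in>(\<lambda>F t. - F (- t)) ` \<Gamma>. a < F (- t0) \<and> F (- t0) < b"
      by (intro bexI[of _ "\<lambda>t. - F (- t)"]) auto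
  qed
qed

end

section \<open>Iterates near an isolated fixed point\<close>

context circle_lifts begin

text \<open>Either the estimate of the separation theorem already holds for the pair, or some element expands
  the pair with distortion controlled by the length of the image.\<close>

definition expandable :: "real \<Rightarrow> real \<Rightarrow> real \<Rightarrow> bool" where
  "expandable R u v \<longleftrightarrow> min (D u) (D v) \<le> R * (v - u) \<or>
     (\<exists>F\<in>\<Gamma>. (1 + 1 / R) * (v - u) \<le> F v - F u \<and>
        exp (- R * (F v - F u)) * (min (D u) (D v) / (v - u))
          \<le> min (D (F u)) (D (F v)) / (F v - F u))"

text \<open>The single number \<open>R\<close> occurs in all three bounds of
  \<open>expandable\<close>, and increasing it weakens each of them. Finitely many local constants
  can thus be merged into their maximum.\<close>

lemma expandable_mono:
  assumes "expandable R u v" "0 < R" "R \<le> R'" "u < v" "u \<in> X" "v \<in> X"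
  shows "expandable R' u v"
proof -
  from assms(1) consider "min (D u) (D v) \<le> R * (v - u)"
    | F where "F \<in> \<Gamma>" "(1 + 1 / R) * (v - u) \<le> F v - F u"
      "exp (- R * (F v - F u)) * (min (D u) (D v) / (v - u)) \<le> min (D (F u)) (D (F v)) / (F v - F u)"
    unfolding expandable_def by blast
  then show ?thesis
  proof cases
    case 1
    also have "R * (v - u) \<le> R' * (v - u)" using assms by simp
    finally show ?thesis by (simp add: expandable_def)
  next
    case (2 F)
    have pos: "0 < F v - F u" using lift_less_iff[OF 2(1)] assms by simp
    have "(1 + 1 / R') * (v - u) \<le> (1 + 1 / R) * (v - u)"
      using assms by (intro mult_right_mono add_left_mono divide_left_mono) auto
    moreover have "exp (- R' * (F v - F u)) \<le> exp (- R * (F v - F u))" using assms pos by simp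
    moreover have "0 \<le> min (D u) (D v) / (v - u)" using D_pos assms by (simp add: less_imp_le)
    ultimately show ?thesis unfolding expandable_def using 2 by (meson mult_right_mono order_trans)
  qed
qed

text \<open>\<open>F\<close> multiplies \<open>D\<close> at the endpoints by the derivatives there
  and the length by a derivative at an intermediate point; these factors differ at most by
  \<open>exp \<delta>\<close>.\<close>

lemma min_D_distortion:
  assumes F: "F \<in> \<Gamma>" and uv: "u < v" "u \<in> X" "v \<in> X"
    and \<delta>: "\<And>x y. x \<in> {u..v} \<Longrightarrow> y \<in> {u..v} \<Longrightarrow> \<bar>ln (deriv F x) - ln (deriv F y)\<bar> \<le> \<delta>"
  shows "exp (- \<delta>) * (min (D u) (D v) / (v - u)) \<le> min (D (F u)) (D (F v)) / (F v - F u)"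
proof -
  obtain \<xi> where \<xi>: "u < \<xi>" "\<xi> < v" "F v - F u = (v - u) * deriv F \<xi>"
    using lift_mvt[OF F uv(1)] .
  have *: "exp (- \<delta>) * deriv F \<xi> \<le> deriv F x" if "x \<in> {u..v}" for x
  proof -
    have "- \<delta> + ln (deriv F \<xi>) \<le> ln (deriv F x)" using \<delta>[OF that, of \<xi>] \<xi> by auto
    then have "exp (- \<delta>) * exp (ln (deriv F \<xi>)) \<le> exp (ln (deriv F x))"
      unfolding mult_exp_exp by (simp only: exp_le_cancel_iff)
    then show ?thesis using deriv_pos[OF F] by simp
  qed
  have pos: "0 < deriv F \<xi>" "0 < v - u" using deriv_pos[OF F] uv by auto
  have m: "0 \<le> min (D u) (D v)" using D_pos uv by (simp add: less_imp_le)
  have "exp (- \<delta>) * deriv F \<xi> * min (D u) (D v) \<le> D (F x)" if "x = u \<or> x = v" for x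
  proof -
    have "x \<in> {u..v}" "x \<in> X" "min (D u) (D v) \<le> D x" using that uv by auto
    then show ?thesis unfolding D_comp[OF \<open>x \<in> X\<close> F]
      using * m deriv_pos[OF F, of x] by (intro mult_mono) (auto simp: less_imp_le)
  qed
  then have "exp (- \<delta>) * deriv F \<xi> * min (D u) (D v) \<le> min (D (F u)) (D (F v))" by simp
  then have "exp (- \<delta>) * deriv F \<xi> * min (D u) (D v) / ((v - u) * deriv F \<xi>)
      \<le> min (D (F u)) (D (F v)) / ((v - u) * deriv F \<xi>)"
    using pos by (intro divide_right_mono) auto
  then show ?thesis unfolding \<xi>(3) using pos by simp
qed

end

text \<open>Nothing is assumed about \<open>deriv h z\<close>: the estimates rest only on
  \<open>h\<close> moving the points of \<open>(z, b]\<close> down, with the intervals from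
  \<open>(h ^^ Suc n) b\<close> to \<open>(h ^^ n) b\<close> as fundamental domains.\<close>

locale cusp = circle_lifts +
  fixes h :: "real \<Rightarrow> real" and z b :: real
  assumes h_mem: "h \<in> \<Gamma>" and h_fix: "h z = z" and z_less_b: "z < b"
    and h_less: "\<And>x. z < x \<Longrightarrow> x \<le> b \<Longrightarrow> h x < x"
begin

lemma it_mem: "h ^^ n \<in> \<Gamma>" by (rule funpow_mem[OF h_mem])

lemma it_fix: "(h ^^ n) z = z" by (induction n) (auto simp: h_fix)

lemma it_gt: "z < x \<Longrightarrow> z < (h ^^ n) x"
  using lift_less_iff[OF it_mem, of n z x] it_fix by simp

lemma it_le: "z < x \<Longrightarrow> x \<le> b \<Longrightarrow> (h ^^ n) x \<le> x"
proof (induction n)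
  case (Suc n)
  then have "h ((h ^^ n) x) < (h ^^ n) x" by (intro h_less it_gt) auto
  then show ?case using Suc by simp
qed simp

lemma it_b_Suc_less: "(h ^^ Suc n) b < (h ^^ n) b"
  using h_less[OF it_gt[OF z_less_b] it_le[OF z_less_b order_refl]] by simp

lemma it_b_antimono: "m \<le> n \<Longrightarrow> (h ^^ n) b \<le> (h ^^ m) b"
  by (rule lift_Suc_antimono_le[of "\<lambda>n. (h ^^ n) b"]) (use it_b_Suc_less in \<open>auto simp: less_imp_le\<close>)

text \<open>The limit of the decreasing sequence is a fixed point of \<open>h\<close> in
  \<open>[z, b]\<close>, and \<open>z\<close> is the only one.\<close>

lemma it_b_tendsto: "(\<lambda>n. (h ^^ n) b) \<longlonglongrightarrow> z"
proof -
  have dec: "decseq (\<lambda>n. (h ^^ n) b)" using it_b_antimono by (auto simp: decseq_def)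
  obtain L where L: "(\<lambda>n. (h ^^ n) b) \<longlonglongrightarrow> L" "\<And>n. L \<le> (h ^^ n) b"
    using decseq_convergent[OF dec, of z] it_gt[OF z_less_b] less_imp_le by metis
  have zL: "z \<le> L" using L(1) it_gt[OF z_less_b] by (meson LIMSEQ_le_const less_imp_le)
  have cont: "isCont h L" using has_deriv[OF h_mem] DERIV_continuous by blast
  have "(\<lambda>n. h ((h ^^ n) b)) \<longlonglongrightarrow> h L" by (rule isCont_tendsto_compose[OF cont L(1)])
  then have "(\<lambda>n. (h ^^ n) b) \<longlonglongrightarrow> h L" using filterlim_sequentially_Suc[of "\<lambda>n. (h ^^ n) b"] by simp
  then have "h L = L" using L(1) LIMSEQ_unique by blast
  moreover have "L \<le> b" using L(2)[of 0] by simp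
  ultimately have "\<not> z < L" using h_less by force
  then show ?thesis using zL L(1) by simp
qed

text \<open>The fundamental domains exhaust \<open>(z, b]\<close>; \<open>n\<close> is one less than
  the first index at which the iterates of \<open>b\<close> fall below \<open>v\<close>.\<close>

lemma it_exhaust:
  assumes "z < v" "v \<le> b"
  obtains n x where "h b < x" "x \<le> b" "v = (h ^^ n) x"
proof -
  have "\<exists>n. (h ^^ n) b < v"
    using order_tendstoD(2)[OF it_b_tendsto assms(1)] by (auto simp: eventually_sequentially)
  then obtain m where m: "(h ^^ m) b < v" "\<And>k. k < m \<Longrightarrow> \<not> (h ^^ k) b < v"
    using exists_least_iff[of "\<lambda>n. (h ^^ n) b < v"] by blast
  then obtain n where n: "m = Suc n" using assms(2) by (cases m) auto
  obtain H where H: "\<And>t. (h ^^ n) (H t) = t" using inverseE[OF it_mem[of n]] by metis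
  have "(h ^^ n) (h b) < (h ^^ n) (H v)" "(h ^^ n) (H v) \<le> (h ^^ n) b"
    using m n H by (auto simp: funpow_swap1 not_less)
  then show thesis
    using that[of "H v" n] H lift_less_iff[OF it_mem] lift_le_iff[OF it_mem] by metis
qed

lemma ln_deriv_it:
  assumes "\<And>s t. \<bar>ln (deriv h s) - ln (deriv h t)\<bar> \<le> B * \<bar>s - t\<bar>"
  shows "\<bar>ln (deriv (h ^^ n) x) - ln (deriv (h ^^ n) y)\<bar> \<le> B * (\<Sum>j<n. \<bar>(h ^^ j) x - (h ^^ j) y\<bar>)"
proof (induction n)
  case 0
  then show ?case by (simp add: deriv_id[unfolded id_def] id_def)
next
  case (Suc n)
  have *: "ln (deriv (h ^^ Suc n) t) = ln (deriv h ((h ^^ n) t)) + ln (deriv (h ^^ n) t)" for t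
    using deriv_comp[OF h_mem it_mem, of n t] deriv_pos[OF h_mem] deriv_pos[OF it_mem]
    by (simp add: ln_mult_pos)
  show ?case using Suc assms[of "(h ^^ n) x" "(h ^^ n) y"]
    unfolding * sum.lessThan_Suc distrib_left by linarith
qed

lemma it_b_gap_sum: "(\<Sum>j<n. (h ^^ j) b - (h ^^ Suc j) b) \<le> b - z"
proof -
  have "(\<Sum>j<n. (h ^^ j) b - (h ^^ Suc j) b) = b - (h ^^ n) b" by (induction n) auto
  then show ?thesis using it_gt[OF z_less_b, of n] by simp
qed

text \<open>Denjoy's argument: the distortion of \<open>h ^^ n\<close> is at most \<open>B\<close>
  times the total length of the successive images, and these images overlap at most twice inside
  \<open>[z, b]\<close>.\<close>

lemma it_distortion_bounded:
  "\<exists>T\<ge>0. \<forall>n. \<forall>x\<in>{h (h b)..b}. \<forall>y\<in>{h (h b)..b}. \<bar>ln (deriv (h ^^ n) x) - ln (deriv (h ^^ n) y)\<bar> \<le> T"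
proof -
  obtain B where B: "B \<ge> 0" "\<And>s t. \<bar>ln (deriv h s) - ln (deriv h t)\<bar> \<le> B * \<bar>s - t\<bar>"
    using ln_deriv_lipschitz[OF h_mem] by blast
  show ?thesis
  proof (intro exI[of _ "B * (2 * (b - z))"] conjI allI ballI)
    show "0 \<le> B * (2 * (b - z))" using B z_less_b by simp
    fix n x y assume xy: "x \<in> {h (h b)..b}" "y \<in> {h (h b)..b}"
    have in_b: "(h ^^ Suc (Suc j)) b \<le> (h ^^ j) t \<and> (h ^^ j) t \<le> (h ^^ j) b"
      if "t \<in> {h (h b)..b}" for t j
      using that lift_le_iff[OF it_mem, of j "h (h b)" t] lift_le_iff[OF it_mem, of j t b]
      by (simp add: funpow_swap1)
    \<comment> \<open>The image of \<open>{h (h b)..b}\<close> under \<open>h ^^ j\<close> consists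
      of two consecutive fundamental domains, whence two telescoping sums.\<close>
    have "(\<Sum>j<n. \<bar>(h ^^ j) x - (h ^^ j) y\<bar>)
        \<le> (\<Sum>j<n. ((h ^^ j) b - (h ^^ Suc j) b) + ((h ^^ Suc j) b - (h ^^ Suc (Suc j)) b))"
      using in_b[OF xy(1)] in_b[OF xy(2)] by (intro sum_mono) (smt (verit))
    also have "\<dots> = (\<Sum>j<n. (h ^^ j) b - (h ^^ Suc j) b) + (\<Sum>j<n. (h ^^ Suc j) b - (h ^^ Suc (Suc j)) b)"
      by (rule sum.distrib)
    also have "(\<Sum>j<n. (h ^^ Suc j) b - (h ^^ Suc (Suc j)) b) \<le> (\<Sum>j<Suc n. (h ^^ j) b - (h ^^ Suc j) b)"
      unfolding sum.lessThan_Suc_shift[of "\<lambda>j. (h ^^ j) b - (h ^^ Suc j) b"]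
      using it_b_Suc_less[of 0] by simp
    also have "(\<Sum>j<n. (h ^^ j) b - (h ^^ Suc j) b) + \<dots> \<le> 2 * (b - z)"
      using it_b_gap_sum[of n] it_b_gap_sum[of "Suc n"] by simp
    finally have "(\<Sum>j<n. \<bar>(h ^^ j) x - (h ^^ j) y\<bar>) \<le> 2 * (b - z)" by simp
    then show "\<bar>ln (deriv (h ^^ n) x) - ln (deriv (h ^^ n) y)\<bar> \<le> B * (2 * (b - z))"
      using ln_deriv_it[OF B(2), of n x y] B(1) mult_left_mono order_trans by blast
  qed
qed

text \<open>By the mean value theorem the length of a fundamental domain is \<open>b - h b\<close>
  times some derivative of \<open>h ^^ n\<close>, and bounded distortion makes all its derivatives
  comparable.\<close>

lemma it_deriv_bounds:
  "\<exists>C\<ge>1. \<forall>n. \<forall>x\<in>{h (h b)..b}. deriv (h ^^ n) x \<le> C * ((h ^^ n) b - (h ^^ Suc n) b)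
     \<and> (h ^^ n) b - (h ^^ Suc n) b \<le> C * deriv (h ^^ n) x"
proof -
  obtain T where T: "T \<ge> 0" "\<And>n x y. x\<in>{h (h b)..b} \<Longrightarrow> y\<in>{h (h b)..b} \<Longrightarrow>
      \<bar>ln (deriv (h ^^ n) x) - ln (deriv (h ^^ n) y)\<bar> \<le> T"
    using it_distortion_bounded by blast
  define C where "C = max 1 (max (exp T / (b - h b)) (exp T * (b - h b)))"
  have hb: "0 < b - h b" using h_less[OF z_less_b] by simp
  have hhb: "h (h b) < h b" using it_b_Suc_less[of 1] by simp
  show ?thesis
  proof (intro exI[of _ C] conjI allI ballI)
    show "1 \<le> C" by (simp add: C_def)
    fix n x assume x: "x \<in> {h (h b)..b}"
    obtain \<xi> where \<xi>: "h b < \<xi>" "\<xi> < b" "(h ^^ n) b - (h ^^ n) (h b) = (b - h b) * deriv (h ^^ n) \<xi>"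
      using lift_mvt[OF it_mem, of "h b" b n] hb by auto
    have gap: "(h ^^ n) b - (h ^^ Suc n) b = (b - h b) * deriv (h ^^ n) \<xi>"
      using \<xi>(3) by (simp add: funpow_swap1)
    have comp: "deriv (h ^^ n) s \<le> exp T * deriv (h ^^ n) t" if "s \<in> {h (h b)..b}" "t \<in> {h (h b)..b}" for s t
    proof -
      have "ln (deriv (h ^^ n) s) \<le> T + ln (deriv (h ^^ n) t)" using T(2)[OF that, of n] by auto
      then have "exp (ln (deriv (h ^^ n) s)) \<le> exp (T + ln (deriv (h ^^ n) t))" by simp
      then show ?thesis using deriv_pos[OF it_mem] by (simp add: exp_add)
    qed
    have \<xi>': "\<xi> \<in> {h (h b)..b}" using \<xi> hhb by auto
    have "deriv (h ^^ n) x \<le> exp T * deriv (h ^^ n) \<xi>" by (rule comp[OF x \<xi>'])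
    also have "\<dots> = exp T / (b - h b) * ((b - h b) * deriv (h ^^ n) \<xi>)" using hb by simp
    also have "\<dots> \<le> C * ((b - h b) * deriv (h ^^ n) \<xi>)"
      using hb deriv_pos[OF it_mem, of n \<xi>] by (intro mult_right_mono) (auto simp: C_def)
    finally show "deriv (h ^^ n) x \<le> C * ((h ^^ n) b - (h ^^ Suc n) b)" unfolding gap .
    have "(b - h b) * deriv (h ^^ n) \<xi> \<le> (b - h b) * (exp T * deriv (h ^^ n) x)"
      using comp[OF \<xi>' x] hb by (intro mult_left_mono) auto
    also have "\<dots> = exp T * (b - h b) * deriv (h ^^ n) x" by simp
    also have "\<dots> \<le> C * deriv (h ^^ n) x"
      using deriv_pos[OF it_mem, of n x] by (intro mult_right_mono) (auto simp: C_def)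
    finally show "(h ^^ n) b - (h ^^ Suc n) b \<le> C * deriv (h ^^ n) x" unfolding gap .
  qed
qed

text \<open>A bootstrap: the derivative bounds just obtained show that \<open>(h ^^ j) x\<close> and
  \<open>(h ^^ j) y\<close> are at distance at most \<open>C * \<bar>x - y\<bar>\<close> times the
  length of the domain. Summing these lengths turns the bounded distortion into one proportional to
  \<open>\<bar>x - y\<bar>\<close>, the form needed in \<open>expandable\<close>.\<close>

lemma it_distortion:
  "\<exists>T\<ge>0. \<forall>n. \<forall>x\<in>{h (h b)..b}. \<forall>y\<in>{h (h b)..b}.
     \<bar>ln (deriv (h ^^ n) x) - ln (deriv (h ^^ n) y)\<bar> \<le> T * \<bar>x - y\<bar>"
proof -
  obtain B where B: "B \<ge> 0" "\<And>s t. \<bar>ln (deriv h s) - ln (deriv h t)\<bar> \<le> B * \<bar>s - t\<bar>"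
    using ln_deriv_lipschitz[OF h_mem] by blast
  obtain C where C: "C \<ge> 1" "\<And>n x. x\<in>{h (h b)..b} \<Longrightarrow>
     deriv (h ^^ n) x \<le> C * ((h ^^ n) b - (h ^^ Suc n) b)"
    using it_deriv_bounds by blast
  have step: "\<bar>(h ^^ j) x - (h ^^ j) y\<bar> \<le> C * ((h ^^ j) b - (h ^^ Suc j) b) * \<bar>x - y\<bar>"
    if "x \<in> {h (h b)..b}" "y \<in> {h (h b)..b}" for j x y
  proof -
    have *: "(h ^^ j) y - (h ^^ j) x \<le> C * ((h ^^ j) b - (h ^^ Suc j) b) * (y - x)"
      if le: "x < y" "x \<in> {h (h b)..b}" "y \<in> {h (h b)..b}" for x y
    proof -
      obtain \<xi> where \<xi>: "x < \<xi>" "\<xi> < y" "(h ^^ j) y - (h ^^ j) x = (y - x) * deriv (h ^^ j) \<xi>"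
        using lift_mvt[OF it_mem le(1)] .
      have "\<xi> \<in> {h (h b)..b}" using \<xi> le by auto
      then have "(y - x) * deriv (h ^^ j) \<xi> \<le> (y - x) * (C * ((h ^^ j) b - (h ^^ Suc j) b))"
        using C(2) le by (intro mult_left_mono) auto
      then show ?thesis using \<xi> by (simp add: mult.commute)
    qed
    show ?thesis
    proof (cases x y rule: linorder_cases)
      case less
      then show ?thesis using *[OF less that] lift_less_iff[OF it_mem, of j x y] by simp
    next
      case greater
      then show ?thesis using *[OF greater that(2,1)] lift_less_iff[OF it_mem, of j y x] by simp
    qed simp
  qed
  show ?thesis
  proof (intro exI[of _ "B * (C * (b - z))"] conjI allI ballI)
    show "0 \<le> B * (C * (b - z))" using B C z_less_b by simp
    fix n x y assume xy: "x \<in> {h (h b)..b}" "y \<in> {h (h b)..b}"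
    have "(\<Sum>j<n. \<bar>(h ^^ j) x - (h ^^ j) y\<bar>) \<le> (\<Sum>j<n. C * ((h ^^ j) b - (h ^^ Suc j) b) * \<bar>x - y\<bar>)"
      by (intro sum_mono step xy)
    also have "\<dots> = C * \<bar>x - y\<bar> * (\<Sum>j<n. (h ^^ j) b - (h ^^ Suc j) b)"
      by (simp add: sum_distrib_left algebra_simps)
    also have "\<dots> \<le> C * \<bar>x - y\<bar> * (b - z)"
      using C by (intro mult_left_mono it_b_gap_sum) auto
    finally have "(\<Sum>j<n. \<bar>(h ^^ j) x - (h ^^ j) y\<bar>) \<le> C * \<bar>x - y\<bar> * (b - z)" .
    then have "B * (\<Sum>j<n. \<bar>(h ^^ j) x - (h ^^ j) y\<bar>) \<le> B * (C * \<bar>x - y\<bar> * (b - z))"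
      using B(1) by (intro mult_left_mono)
    then show "\<bar>ln (deriv (h ^^ n) x) - ln (deriv (h ^^ n) y)\<bar> \<le> B * (C * (b - z)) * \<bar>x - y\<bar>"
      using ln_deriv_it[OF B(2), of n x y] by (simp add: algebra_simps)
  qed
qed

text \<open>The displacement at \<open>(h ^^ n) x\<close> is the length of the image of
  \<open>[h x, x]\<close>, and on the compact fundamental domain \<open>{h b..b}\<close> the
  displacement \<open>x - h x\<close> has a positive minimum.\<close>

lemma it_deriv_displacement:
  "\<exists>C\<ge>1. \<forall>n. \<forall>x\<in>{h b..b}. deriv (h ^^ n) x \<le> C * ((h ^^ n) x - h ((h ^^ n) x))
     \<and> (h ^^ n) x - h ((h ^^ n) x) \<le> C * deriv (h ^^ n) x"
proof -
  obtain C0 where C0: "C0 \<ge> 1" "\<And>n x. x\<in>{h (h b)..b} \<Longrightarrow>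
     deriv (h ^^ n) x \<le> C0 * ((h ^^ n) b - (h ^^ Suc n) b)"
     "\<And>n x. x\<in>{h (h b)..b} \<Longrightarrow> (h ^^ n) b - (h ^^ Suc n) b \<le> C0 * deriv (h ^^ n) x"
    using it_deriv_bounds by blast
  have hb: "h b < b" "z < h b" using h_less[OF z_less_b] it_gt[OF z_less_b, of 1] by auto
  have "\<exists>x0\<in>{h b..b}. \<forall>x\<in>{h b..b}. x0 - h x0 \<le> x - h x"
    by (rule continuous_attains_inf) (use hb in \<open>auto intro!: continuous_intros continuous_lift[OF h_mem]\<close>)
  then obtain x0 where x0: "x0 \<in> {h b..b}" "\<And>x. x\<in>{h b..b} \<Longrightarrow> x0 - h x0 \<le> x - h x" by blast
  define i where "i = x0 - h x0"
  have i: "0 < i" using h_less[of x0] x0 hb by (simp add: i_def)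
  define C where "C = max 1 (max (C0 * C0 / i) (C0 * C0 * (b - z)))"
  show ?thesis
  proof (intro exI[of _ C] conjI allI ballI)
    show "1 \<le> C" by (simp add: C_def)
    fix n x assume x: "x \<in> {h b..b}"
    have hx: "h x < x" "h (h b) \<le> h x" "z < h x"
      using h_less[of x] x hb lift_le_iff[OF h_mem, of "h b" x] it_gt[of x 1] by auto
    obtain \<xi> where \<xi>: "h x < \<xi>" "\<xi> < x" "(h ^^ n) x - (h ^^ n) (h x) = (x - h x) * deriv (h ^^ n) \<xi>"
      using lift_mvt[OF it_mem hx(1)] .
    have eq: "(h ^^ n) x - h ((h ^^ n) x) = (x - h x) * deriv (h ^^ n) \<xi>"
      using \<xi>(3) by (simp add: funpow_swap1)
    have in2: "\<xi> \<in> {h (h b)..b}" "x \<in> {h (h b)..b}" using \<xi> x hx by auto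
    have c: "deriv (h ^^ n) s \<le> C0 * C0 * deriv (h ^^ n) t" if "s \<in> {h (h b)..b}" "t \<in> {h (h b)..b}" for s t
    proof -
      have "deriv (h ^^ n) s \<le> C0 * ((h ^^ n) b - (h ^^ Suc n) b)" using C0(2)[OF that(1)] .
      also have "\<dots> \<le> C0 * (C0 * deriv (h ^^ n) t)" using C0(1) C0(3)[OF that(2)] by (intro mult_left_mono) auto
      finally show ?thesis by simp
    qed
    have p\<xi>: "0 < deriv (h ^^ n) \<xi>" "0 < deriv (h ^^ n) x" by (rule deriv_pos[OF it_mem])+
    have "deriv (h ^^ n) x \<le> C0 * C0 / i * (i * deriv (h ^^ n) \<xi>)" using c[OF in2(2,1)] i by simp
    also have "\<dots> \<le> C * ((x - h x) * deriv (h ^^ n) \<xi>)"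
      using x0(2)[OF x] p\<xi> i C0(1) by (intro mult_mono mult_right_mono) (auto simp: C_def i_def)
    finally show "deriv (h ^^ n) x \<le> C * ((h ^^ n) x - h ((h ^^ n) x))" unfolding eq .
    have "(x - h x) * deriv (h ^^ n) \<xi> \<le> (b - z) * (C0 * C0 * deriv (h ^^ n) x)"
      using c[OF in2] hx x p\<xi> by (intro mult_mono) auto
    also have "\<dots> = C0 * C0 * (b - z) * deriv (h ^^ n) x" by simp
    also have "\<dots> \<le> C * deriv (h ^^ n) x" using p\<xi> by (intro mult_right_mono) (auto simp: C_def)
    finally show "(h ^^ n) x - h ((h ^^ n) x) \<le> C * deriv (h ^^ n) x" unfolding eq .
  qed
qed

text \<open>Each such \<open>w\<close> is \<open>(h ^^ n) x\<close> with \<open>x\<close> in the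
  fundamental domain, and \<open>D x \<le> 1\<close> by non-expandability of \<open>t0\<close>; so
  \<open>D w\<close> is at most the derivative of \<open>h ^^ n\<close> at \<open>x\<close>.\<close>

lemma D_le_displacement: "\<exists>C\<ge>1. \<forall>w\<in>X. z < w \<longrightarrow> w \<le> b \<longrightarrow> D w \<le> C * (w - h w)"
proof -
  obtain C where C: "C \<ge> 1" "\<And>n x. x\<in>{h b..b} \<Longrightarrow> deriv (h ^^ n) x \<le> C * ((h ^^ n) x - h ((h ^^ n) x))"
    using it_deriv_displacement by blast
  have "D w \<le> C * (w - h w)" if w: "w \<in> X" "z < w" "w \<le> b" for w
  proof -
    obtain n x where x: "h b < x" "x \<le> b" "w = (h ^^ n) x" using it_exhaust[OF w(2,3)] .
    obtain H where H: "H \<in> \<Gamma>" "\<And>t. H ((h ^^ n) t) = t" using inverseE[OF it_mem[of n]] by metis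
    have xX: "x \<in> X" using X_lift[OF w(1) H(1)] H(2) x(3) by simp
    have "D w = deriv (h ^^ n) x * D x" using D_comp[OF xX it_mem] x(3) by simp
    also have "\<dots> \<le> deriv (h ^^ n) x * 1"
      using D_le_1[OF xX] deriv_pos[OF it_mem] by (intro mult_left_mono) (auto simp: less_imp_le)
    also have "\<dots> \<le> C * (w - h w)" using C(2)[of x n] x by simp
    finally show ?thesis .
  qed
  then show ?thesis using C(1) by blast
qed

text \<open>If \<open>u \<le> h v\<close>, the gap contains a whole displacement, which already
  dominates \<open>D v\<close>. Otherwise the inverse of an iterate of \<open>h\<close> blows the
  pair up to the scale of the fundamental domain.\<close>

lemma cusp_expandable:
  "\<exists>r>0. \<exists>R>0. \<forall>u\<in>X. \<forall>v\<in>X. z < u \<longrightarrow> u < v \<longrightarrow> v < z + r \<longrightarrow> expandable R u v"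
proof -
  obtain T where T: "T \<ge> 0" "\<And>n x y. x\<in>{h (h b)..b} \<Longrightarrow> y\<in>{h (h b)..b} \<Longrightarrow>
      \<bar>ln (deriv (h ^^ n) x) - ln (deriv (h ^^ n) y)\<bar> \<le> T * \<bar>x - y\<bar>"
    using it_distortion by blast
  obtain C where C: "C \<ge> 1" "\<And>n x. x\<in>{h (h b)..b} \<Longrightarrow>
     deriv (h ^^ n) x \<le> C * ((h ^^ n) b - (h ^^ Suc n) b)"
    using it_deriv_bounds by blast
  obtain C1 where C1: "C1 \<ge> 1" "\<And>w. w\<in>X \<Longrightarrow> z < w \<Longrightarrow> w \<le> b \<Longrightarrow> D w \<le> C1 * (w - h w)"
    using D_le_displacement by blast
  \<comment> \<open>From \<open>n0\<close> on the iterates contract \<open>{h (h b)..b}\<close> by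
    at least one half, so their inverses expand by 2, which is at least \<open>1 + 1 / R\<close>
    since \<open>R \<ge> 1\<close>.\<close>
  have "(\<lambda>n. C * ((h ^^ n) b - (h ^^ Suc n) b)) \<longlonglongrightarrow> C * (z - z)"
    by (intro tendsto_intros it_b_tendsto LIMSEQ_Suc[OF it_b_tendsto])
  then have "\<forall>\<^sub>F n in sequentially. C * ((h ^^ n) b - (h ^^ Suc n) b) < 1 / 2"
    by (rule order_tendstoD(2)) auto
  then obtain n0 where n0: "\<And>n. n \<ge> n0 \<Longrightarrow> C * ((h ^^ n) b - (h ^^ Suc n) b) < 1 / 2"
    unfolding eventually_sequentially by blast
  define R where "R = max 1 (max T C1)"
  have R: "R \<ge> 1" "R \<ge> T" "R \<ge> C1" by (auto simp: R_def)
  define r where "r = (h ^^ n0) b - z"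
  have r: "0 < r" using it_gt[OF z_less_b, of n0] by (simp add: r_def)
  have "expandable R u v" if uv: "u \<in> X" "v \<in> X" "z < u" "u < v" "v < z + r" for u v
  proof -
    have vb: "v \<le> b" using uv(5) it_le[OF z_less_b order_refl, of n0] by (simp add: r_def)
    have zv: "z < v" using uv by simp
    show "expandable R u v"
    proof (cases "u \<le> h v")
      case True
      have "min (D u) (D v) \<le> C1 * (v - h v)" using C1(2)[OF uv(2) zv vb] by simp
      also have "\<dots> \<le> R * (v - u)" using True R C1(1) uv h_less[OF zv vb] by (intro mult_mono) auto
      finally show ?thesis by (simp add: expandable_def)
    next
      case False
      obtain n x where x: "h b < x" "x \<le> b" "v = (h ^^ n) x" using it_exhaust[OF zv vb] .
      have "(h ^^ n) (h b) < (h ^^ n) x" using x(1) lift_less_iff[OF it_mem] by blast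
      then have "(h ^^ Suc n) b < (h ^^ n0) b" using x(3) uv(5) by (simp add: funpow_swap1 r_def)
      then have "n \<ge> n0" using it_b_antimono[of "Suc n" n0] by (meson leD not_less_eq_eq)
      obtain F where F: "F \<in> \<Gamma>" "\<And>t. F ((h ^^ n) t) = t" "\<And>t. (h ^^ n) (F t) = t"
          "\<And>t. deriv F ((h ^^ n) t) = inverse (deriv (h ^^ n) t)"
        using inverseE[OF it_mem[of n]] by metis
      define x' where "x' = F u"
      have Fv: "F v = x" using F x by simp
      have x': "(h ^^ n) x' = u" "x' < x" using F(3) lift_less_iff[OF F(1)] uv(4) Fv by (auto simp: x'_def)
      have "(h ^^ n) (h x) < (h ^^ n) x'"
        using False x' x(3) by (simp add: funpow_swap1)
      then have "h x < x'" using lift_less_iff[OF it_mem] by blast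
      moreover have "h (h b) < h x" using lift_less_iff[OF h_mem] x(1) by blast
      \<comment> \<open>The preimage of \<open>u\<close> may lie one fundamental domain below that
        of \<open>v\<close>, which is why the distortion estimates cover
        \<open>{h (h b)..b}\<close>.\<close>
      ultimately have in2: "{x'..x} \<subseteq> {h (h b)..b}" using x by auto
      have "\<bar>ln (deriv F s) - ln (deriv F t)\<bar> \<le> R * (F v - F u)" if "s \<in> {u..v}" "t \<in> {u..v}" for s t
      proof -
        have st: "F s \<in> {x'..x}" "F t \<in> {x'..x}" using that lift_le_iff[OF F(1)] Fv by (auto simp: x'_def)
        have eq: "ln (deriv F r) = - ln (deriv (h ^^ n) (F r))" for r
          using F(4)[of "F r"] deriv_pos[OF it_mem, of n "F r"] by (simp add: F(3) ln_inverse)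
        have "\<bar>ln (deriv F s) - ln (deriv F t)\<bar> \<le> T * \<bar>F s - F t\<bar>"
          using T(2)[of "F s" "F t" n] st in2 unfolding eq by (auto simp: abs_minus_commute)
        also have "\<dots> \<le> R * (F v - F u)" using st R T(1) Fv by (intro mult_mono) (auto simp: x'_def)
        finally show ?thesis .
      qed
      from min_D_distortion[OF F(1) uv(4,1,2) this]
      have 1: "exp (- R * (F v - F u)) * (min (D u) (D v) / (v - u)) \<le> min (D (F u)) (D (F v)) / (F v - F u)"
        by simp
      obtain \<xi> where \<xi>: "x' < \<xi>" "\<xi> < x" "(h ^^ n) x - (h ^^ n) x' = (x - x') * deriv (h ^^ n) \<xi>"
        using lift_mvt[OF it_mem x'(2)] .
      have "deriv (h ^^ n) \<xi> \<le> 1 / 2" using C(2)[of \<xi> n] n0[OF \<open>n \<ge> n0\<close>] in2 \<xi> by force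
      then have "v - u \<le> (x - x') * (1 / 2)" using \<xi>(3) x' x(3) mult_left_mono[of _ "1/2" "x - x'"] by simp
      moreover have "(1 + 1 / R) * (v - u) \<le> 2 * (v - u)" using R uv by (intro mult_right_mono) auto
      ultimately have "(1 + 1 / R) * (v - u) \<le> F v - F u" using Fv by (simp add: x'_def)
      then show ?thesis using 1 F(1) unfolding expandable_def by blast
    qed
  qed
  then have "\<forall>u\<in>X. \<forall>v\<in>X. z < u \<longrightarrow> u < v \<longrightarrow> v < z + r \<longrightarrow> expandable R u v" by blast
  moreover have "0 < R" using R by simp
  ultimately show ?thesis using r by blast
qed

end

section \<open>Separation of orbit points\<close>

context circle_lifts begin

lemma X_mirror: "circle_lifts.X ((\<lambda>F t. - F (- t)) ` \<Gamma>) (- t0) = uminus ` X"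
  unfolding circle_lifts.X_def[OF circle_lifts_mirror] X_def
  by (simp add: setcompr_eq_image image_image)

lemma D_mirror: assumes "t \<in> X"
  shows "circle_lifts.D ((\<lambda>F t. - F (- t)) ` \<Gamma>) (- t0) (- t) = D t"
proof -
  interpret M: circle_lifts "(\<lambda>F t. - F (- t)) ` \<Gamma>" "- t0" by (rule circle_lifts_mirror)
  obtain F where F: "F \<in> \<Gamma>" "t = F t0" using assms by (auto simp: X_def)
  have "((\<lambda>t. - F (- t)) has_real_derivative deriv F t0) (at (- t0))"
    using has_deriv[OF F(1), of t0]
    by (auto intro!: derivative_eq_intros DERIV_chain2[of F _ "uminus"])
  then have "deriv (\<lambda>t. - F (- t)) (- t0) = deriv F t0" by (rule DERIV_imp_deriv)
  then show ?thesis using M.D_lift[of "\<lambda>t. - F (- t)"] F D_lift[OF F(1)] by simp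
qed

lemma expandable_mirror:
  assumes "circle_lifts.expandable ((\<lambda>F t. - F (- t)) ` \<Gamma>) (- t0) R (- v) (- u)" "u \<in> X" "v \<in> X"
  shows "expandable R u v"
proof -
  interpret M: circle_lifts "(\<lambda>F t. - F (- t)) ` \<Gamma>" "- t0" by (rule circle_lifts_mirror)
  from assms(1) consider "min (D v) (D u) \<le> R * (v - u)"
    | F where "F \<in> \<Gamma>" "(1 + 1 / R) * (v - u) \<le> F v - F u"
        "exp (- R * (F v - F u)) * (min (D v) (D u) / (v - u))
          \<le> min (M.D (- F v)) (M.D (- F u)) / (F v - F u)"
    unfolding M.expandable_def D_mirror[OF assms(2)] D_mirror[OF assms(3)] by auto
  then show ?thesis
  proof cases
    case 1
    then show ?thesis by (simp add: expandable_def min.commute)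
  next
    case (2 F)
    then show ?thesis
      using D_mirror[OF X_lift[OF assms(2) 2(1)]] D_mirror[OF X_lift[OF assms(3) 2(1)]]
      unfolding expandable_def by (intro disjI2 bexI[of _ F]) (auto simp: min.commute)
  qed
qed

text \<open>Without fixed points to the right of \<open>z\<close> the sign of \<open>k x - x\<close>
  is constant there by the intermediate value theorem. If \<open>h\<close> pushes points away from
  \<open>z\<close>, its inverse is taken instead.\<close>

lemma right_cusp:
  assumes "\<And>F. F \<in> \<Gamma> \<Longrightarrow> deriv F z \<le> 1"
  obtains h b where "cusp \<Gamma> t0 h z b"
proof -
  obtain h e where h: "h \<in> \<Gamma>" "h z = z" "e > 0" "\<And>y. z < y \<Longrightarrow> y < z + e \<Longrightarrow> h y \<noteq> y"
    using isolated_right[OF assms] by auto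
  define b where "b = z + e / 2"
  have b: "z < b" "b < z + e" using h by (auto simp: b_def)
  have one_side: "cusp \<Gamma> t0 k z b" if k: "k \<in> \<Gamma>" "k z = z" "\<And>y. z < y \<Longrightarrow> y < z + e \<Longrightarrow> k y \<noteq> y" "k b < b" for k
  proof
    fix x assume x: "z < x" "x \<le> b"
    show "k x < x"
    proof (rule ccontr)
      assume "\<not> k x < x"
      then have "0 \<le> k x - x" "k b - b \<le> 0" using k by auto
      moreover have "\<forall>s. x \<le> s \<and> s \<le> b \<longrightarrow> isCont (\<lambda>s. k s - s) s"
        using DERIV_isCont[OF has_deriv[OF k(1)]] by (auto intro!: continuous_intros)
      ultimately have "\<exists>s\<ge>x. s \<le> b \<and> k s - s = 0"
        using x IVT2[of "\<lambda>s. k s - s" b 0 x] by blast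
      then obtain s where "x \<le> s" "s \<le> b" "k s = s" by auto
      then show False using k(3)[of s] x b by auto
    qed
  qed (use k b in auto)
  show thesis
  proof (cases "h b < b")
    case True
    then show thesis using that one_side h by blast
  next
    case False
    obtain k where k: "k \<in> \<Gamma>" "\<And>t. k (h t) = t" "\<And>t. h (k t) = t" using inverseE[OF h(1)] by metis
    have "b < h b" using False h(4)[of b] b by auto
    then have "k b < b" using lift_less_iff[OF k(1)] k(2) by metis
    moreover have "k z = z" using k(2)[of z] h(2) by simp
    moreover have "k y \<noteq> y" if "z < y" "y < z + e" for y using h(4)[OF that] k(3) by metis
    ultimately show thesis using that one_side[OF k(1)] by blast
  qed
qed

text \<open>The bound on \<open>D v\<close> serves pairs with \<open>u \<le> z < v\<close>: then
  \<open>v - z \<le> v - u\<close>, so the first alternative of \<open>expandable\<close>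
  holds.\<close>

lemma right_of_nonexpandable:
  assumes "\<And>F. F \<in> \<Gamma> \<Longrightarrow> deriv F z \<le> 1"
  shows "\<exists>R\<ge>1. \<forall>v\<in>X. z < v \<longrightarrow> v < z + 1 / R \<longrightarrow> D v \<le> R * (v - z) \<and>
    (\<forall>u\<in>X. z < u \<longrightarrow> u < v \<longrightarrow> expandable R u v)"
proof -
  obtain h b where "cusp \<Gamma> t0 h z b" using right_cusp[OF assms] .
  then interpret cusp \<Gamma> t0 h z b .
  obtain C where C: "C \<ge> 1" "\<And>w. w\<in>X \<Longrightarrow> z < w \<Longrightarrow> w \<le> b \<Longrightarrow> D w \<le> C * (w - h w)"
    using D_le_displacement by blast
  obtain r R where R: "r > 0" "R > 0"
    "\<And>u v. u \<in> X \<Longrightarrow> v \<in> X \<Longrightarrow> z < u \<Longrightarrow> u < v \<Longrightarrow> v < z + r \<Longrightarrow> expandable R u v"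
    using cusp_expandable by blast
  define Q where "Q = Max {1, C, R, 1 / r, 1 / (b - z)}"
  have Q: "Q \<ge> 1" "Q \<ge> C" "Q \<ge> R" "Q \<ge> 1 / r" "Q \<ge> 1 / (b - z)" by (auto simp: Q_def)
  have small: "1 / Q \<le> r" "1 / Q \<le> b - z"
    using Q R z_less_b by (auto simp: field_simps)
  show ?thesis
  proof (intro exI[of _ Q] conjI ballI impI Q(1))
    fix v assume v: "v \<in> X" "z < v" "v < z + 1 / Q"
    have "z < h v" using it_gt[OF v(2), of 1] by simp
    have "D v \<le> C * (v - h v)" using C v small by auto
    also have "\<dots> \<le> Q * (v - z)"
      using Q C \<open>z < h v\<close> h_less[of v] v small by (intro mult_mono) auto
    finally show "D v \<le> Q * (v - z)" .
    fix u assume u: "u \<in> X" "z < u" "u < v"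
    show "expandable Q u v"
      by (rule expandable_mono[OF R(3)]) (use u v small R Q in auto)
  qed
qed

lemma left_of_nonexpandable:
  assumes "\<And>F. F \<in> \<Gamma> \<Longrightarrow> deriv F z \<le> 1"
  shows "\<exists>R\<ge>1. \<forall>u\<in>X. z - 1 / R < u \<longrightarrow> u < z \<longrightarrow> D u \<le> R * (z - u) \<and>
    (\<forall>v\<in>X. v < z \<longrightarrow> u < v \<longrightarrow> expandable R u v)"
proof -
  interpret M: circle_lifts "(\<lambda>F t. - F (- t)) ` \<Gamma>" "- t0" by (rule circle_lifts_mirror)
  have "deriv F (- z) \<le> 1" if F: "F \<in> (\<lambda>F t. - F (- t)) ` \<Gamma>" for F
  proof -
    obtain F' where F': "F' \<in> \<Gamma>" "F = (\<lambda>t. - F' (- t))" using F by blast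
    have "(F has_real_derivative deriv F' z) (at (- z))" unfolding F'(2)
      using has_deriv[OF F'(1), of z]
      by (auto intro!: derivative_eq_intros DERIV_chain2[of F' _ "uminus"])
    then show ?thesis using assms[OF F'(1)] DERIV_imp_deriv by metis
  qed
  then obtain R where R: "R \<ge> 1" "\<And>v. v\<in>M.X \<Longrightarrow> - z < v \<Longrightarrow> v < - z + 1 / R \<Longrightarrow> M.D v \<le> R * (v + z) \<and>
    (\<forall>u\<in>M.X. - z < u \<longrightarrow> u < v \<longrightarrow> M.expandable R u v)"
    using M.right_of_nonexpandable[of "- z"] by auto
  show ?thesis
  proof (intro exI[of _ R] conjI ballI impI R(1))
    fix u assume u: "u \<in> X" "z - 1 / R < u" "u < z"
    then have *: "- u \<in> M.X" "- z < - u" "- u < - z + 1 / R" by (auto simp: X_mirror)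
    show "D u \<le> R * (z - u)" using R(2)[OF *] D_mirror[OF u(1)] by simp
    fix v assume v: "v \<in> X" "v < z" "u < v"
    have "M.expandable R (- v) (- u)" using R(2)[OF *] v by (auto simp: X_mirror)
    then show "expandable R u v" by (rule expandable_mirror) (use u v in auto)
  qed
qed

text \<open>Near a non-expandable \<open>z\<close> the two one-sided results apply; near any other
  \<open>z\<close> a single element has derivative above 1 on a neighbourhood. As \<open>z\<close>
  is arbitrary, \<open>isolated_right\<close> and \<open>isolated_left\<close> are assumed at all
  non-expandable points, not only on the orbit of \<open>t0\<close>.\<close>

lemma locally_expandable:
  "\<exists>R\<ge>1. \<forall>u\<in>X. \<forall>v\<in>X. z - 1 / R < u \<longrightarrow> u < v \<longrightarrow> v < z + 1 / R \<longrightarrow> expandable R u v"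
proof (cases "\<forall>F\<in>\<Gamma>. deriv F z \<le> 1")
  case True
  then obtain R1 where R1: "R1 \<ge> 1" "\<And>v. v\<in>X \<Longrightarrow> z < v \<Longrightarrow> v < z + 1 / R1 \<Longrightarrow> D v \<le> R1 * (v - z)"
     "\<And>u v. v\<in>X \<Longrightarrow> z < v \<Longrightarrow> v < z + 1 / R1 \<Longrightarrow> u\<in>X \<Longrightarrow> z < u \<Longrightarrow> u < v \<Longrightarrow> expandable R1 u v"
    using right_of_nonexpandable[of z] by blast
  obtain R2 where R2: "R2 \<ge> 1" "\<And>u. u\<in>X \<Longrightarrow> z - 1 / R2 < u \<Longrightarrow> u < z \<Longrightarrow> D u \<le> R2 * (z - u)"
     "\<And>u v. u\<in>X \<Longrightarrow> z - 1 / R2 < u \<Longrightarrow> u < z \<Longrightarrow> v\<in>X \<Longrightarrow> v < z \<Longrightarrow> u < v \<Longrightarrow> expandable R2 u v"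
    using left_of_nonexpandable[of z] True by blast
  define R where "R = max R1 R2"
  have R: "R \<ge> 1" "R \<ge> R1" "R \<ge> R2" using R1 by (auto simp: R_def)
  have small: "1 / R \<le> 1 / R1" "1 / R \<le> 1 / R2" using R R1(1) R2(1) by (auto intro!: divide_left_mono)
  have "expandable R u v" if uv: "u \<in> X" "v \<in> X" "z - 1 / R < u" "u < v" "v < z + 1 / R" for u v
  proof -
    \<comment> \<open>\<open>z\<close> may itself be an orbit point, so pairs with \<open>z\<close>
      as an endpoint are covered by the last two cases.\<close>
    consider "z < u" | "v < z" | "u \<le> z" "z < v" | "u < z" "v = z" using uv by linarith
    then show ?thesis
    proof cases
      case 1
      then show ?thesis using uv R R1(1) small by (intro expandable_mono[OF R1(3)]) auto
    next
      case 2
      then show ?thesis using uv R R2(1) small by (intro expandable_mono[OF R2(3)]) auto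
    next
      case 3
      have "min (D u) (D v) \<le> R1 * (v - z)" using R1(2)[of v] 3 uv small by auto
      also have "\<dots> \<le> R * (v - u)" using R R1(1) 3 by (intro mult_mono) auto
      finally show ?thesis by (simp add: expandable_def)
    next
      case 4
      have "min (D u) (D v) \<le> R2 * (z - u)" using R2(2)[of u] 4 uv small by auto
      also have "\<dots> \<le> R * (v - u)" using R R2(1) 4 by (intro mult_mono) auto
      finally show ?thesis by (simp add: expandable_def)
    qed
  qed
  then show ?thesis using R(1) by blast
next
  case False
  then obtain F where F: "F \<in> \<Gamma>" "1 < deriv F z" by force
  obtain B where B: "B \<ge> 0" "\<And>s t. \<bar>ln (deriv F s) - ln (deriv F t)\<bar> \<le> B * \<bar>s - t\<bar>"
    using ln_deriv_lipschitz[OF F(1)] by blast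
  \<comment> \<open>Any number strictly between 1 and \<open>deriv F z\<close> would do;
    \<open>R\<close> is made large enough that \<open>1 + 1 / R \<le> l\<close>.\<close>
  define l where "l = (1 + deriv F z) / 2"
  have l: "1 < l" "l < deriv F z" using F by (auto simp: l_def)
  have "isCont (deriv F) z" using continuous_deriv[OF F(1), of UNIV] by (simp add: continuous_on_eq_continuous_at)
  then have "(deriv F \<longlongrightarrow> deriv F z) (at z)" by (simp add: isCont_def)
  then have "\<forall>\<^sub>F x in at z. l < deriv F x" using l(2) by (rule order_tendstoD(1))
  then obtain r where r: "r > 0" "\<And>x. x \<noteq> z \<Longrightarrow> dist x z < r \<Longrightarrow> l < deriv F x"
    unfolding eventually_at by auto
  then have r': "l < deriv F x" if "\<bar>x - z\<bar> < r" for x using that l by (cases "x = z") (auto simp: dist_real_def)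
  define R where "R = Max {1, B, 1 / r, 1 / (l - 1)}"
  have R: "R \<ge> 1" "R \<ge> B" "R \<ge> 1 / r" "R \<ge> 1 / (l - 1)" by (auto simp: R_def)
  have small: "1 / R \<le> r" "1 / R \<le> l - 1" using R r l by (auto simp: field_simps)
  have "expandable R u v" if uv: "u \<in> X" "v \<in> X" "z - 1 / R < u" "u < v" "v < z + 1 / R" for u v
  proof -
    obtain \<xi> where \<xi>: "u < \<xi>" "\<xi> < v" "F v - F u = (v - u) * deriv F \<xi>" using lift_mvt[OF F(1) uv(4)] .
    have "l < deriv F \<xi>" using uv \<xi> small by (intro r') auto
    then have ex: "(v - u) * l \<le> F v - F u" using \<xi>(3) uv by simp
    have "(1 + 1 / R) * (v - u) \<le> l * (v - u)" using small uv by (intro mult_right_mono) auto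
    then have 1: "(1 + 1 / R) * (v - u) \<le> F v - F u" using ex by (simp add: mult.commute)
    have "(v - u) * 1 \<le> (v - u) * l" using l uv by (intro mult_left_mono) auto
    then have vu: "v - u \<le> F v - F u" unfolding mult_1_right using ex by (rule order_trans)
    have "\<bar>ln (deriv F s) - ln (deriv F t)\<bar> \<le> R * (F v - F u)" if "s \<in> {u..v}" "t \<in> {u..v}" for s t
    proof -
      have "\<bar>ln (deriv F s) - ln (deriv F t)\<bar> \<le> B * \<bar>s - t\<bar>" by (rule B(2))
      also have "\<dots> \<le> R * (F v - F u)" using that vu R B(1) by (intro mult_mono) auto
      finally show ?thesis .
    qed
    from min_D_distortion[OF F(1) uv(4,1,2) this] 1 F(1) show ?thesis
      unfolding expandable_def by auto
  qed
  then show ?thesis using R(1) by blast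
qed

lemma expandable_shift:
  assumes "expandable R (u + of_int k) (v + of_int k)" "u \<in> X" "v \<in> X"
  shows "expandable R u v"
  using assms(1) unfolding expandable_def D_shift[OF assms(2)] D_shift[OF assms(3)]
    commutes_int
  by (auto simp: commutes_int D_shift X_lift assms)

text \<open>Compactness of the circle: counterexamples at the scales \<open>1 / Suc n\<close>,
  translated so that \<open>u\<close> lies in \<open>{0..1}\<close>, accumulate at some
  \<open>z\<close>, where \<open>locally_expandable\<close> contradicts them.\<close>

lemma uniformly_expandable:
  "\<exists>R\<ge>1. \<forall>u\<in>X. \<forall>v\<in>X. u < v \<longrightarrow> v < u + 1 / R \<longrightarrow> expandable R u v"
proof (rule ccontr)
  assume contr: "\<not> ?thesis"
  have "\<exists>u v. u \<in> X \<and> v \<in> X \<and> u \<in> {0..1} \<and> u < v \<and> v < u + 1 / Suc n \<and> \<not> expandable (Suc n) u v" for n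
  proof -
    have "\<not> (\<forall>u\<in>X. \<forall>v\<in>X. u < v \<longrightarrow> v < u + 1 / real (Suc n) \<longrightarrow> expandable (real (Suc n)) u v)"
      using contr by (metis of_nat_le_iff of_nat_1 le_add1 plus_1_eq_Suc)
    then obtain u v where uv: "u \<in> X" "v \<in> X" "u < v" "v < u + 1 / Suc n" "\<not> expandable (Suc n) u v" by blast
    define k where "k = - \<lfloor>u\<rfloor>"
    have "u + of_int k \<in> {0..1}" unfolding k_def by (auto, linarith)
    moreover have "\<not> expandable (Suc n) (u + of_int k) (v + of_int k)"
      using uv expandable_shift by blast
    ultimately show ?thesis using uv X_shift[of _ k]
      by (intro exI[of _ "u + of_int k"] exI[of _ "v + of_int k"]) auto
  qed
  then obtain u v where uv: "\<And>n::nat. u n \<in> X" "\<And>n. v n \<in> X" "\<And>n. u n \<in> {0..1}" "\<And>n. u n < v n"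
      "\<And>n. v n < u n + 1 / Suc n" "\<And>n. \<not> expandable (Suc n) (u n) (v n)" by metis
  obtain z s where z: "strict_mono (s :: nat \<Rightarrow> nat)" "(u \<circ> s) \<longlonglongrightarrow> z"
    using compact_imp_seq_compact[of "{0..1::real}"] uv(3) unfolding seq_compact_def by (metis compact_Icc)
  obtain R where R: "R \<ge> 1" "\<And>u v. u\<in>X \<Longrightarrow> v\<in>X \<Longrightarrow> z - 1 / R < u \<Longrightarrow> u < v \<Longrightarrow> v < z + 1 / R \<Longrightarrow> expandable R u v"
    using locally_expandable[of z] by blast
  have "\<forall>\<^sub>F n in sequentially. z - 1 / R < (u \<circ> s) n" by (rule order_tendstoD(1)[OF z(2)]) (use R in auto)
  moreover have "\<forall>\<^sub>F n in sequentially. (u \<circ> s) n < z + 1 / (2 * R)" by (rule order_tendstoD(2)[OF z(2)]) (use R in auto)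
  moreover have "\<forall>\<^sub>F n in sequentially. nat \<lceil>2 * R\<rceil> \<le> n" by (rule eventually_ge_at_top)
  ultimately have "\<forall>\<^sub>F n in sequentially. z - 1 / R < (u \<circ> s) n \<and> (u \<circ> s) n < z + 1 / (2 * R) \<and> nat \<lceil>2 * R\<rceil> \<le> n"
    by eventually_elim auto
  then obtain n where n: "z - 1 / R < u (s n)" "u (s n) < z + 1 / (2 * R)" "nat \<lceil>2 * R\<rceil> \<le> n"
    by (auto simp: eventually_sequentially)
  have sn: "2 * R \<le> Suc (s n)" using n(3) z(1) seq_suble[OF z(1), of n] by linarith
  have "1 / Suc (s n) \<le> 1 / (2 * R)" using sn R by (intro divide_left_mono) auto
  moreover have "1 / R = 1 / (2 * R) + 1 / (2 * R)" using R by (simp add: field_simps)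
  ultimately have "v (s n) < z + 1 / R" using uv(5)[of "s n"] n(2) by linarith
  then have "expandable R (u (s n)) (v (s n))" using R(2) uv n by blast
  then have "expandable (Suc (s n)) (u (s n)) (v (s n))"
    by (rule expandable_mono) (use sn R uv in auto)
  then show False using uv(6) by blast
qed

text \<open>Keeps an expanded pair within one period, so that the factor
  \<open>exp (B * (v - u))\<close> of the separation argument stays bounded.\<close>

lemma lift_gap_less_1: assumes "F \<in> \<Gamma>" "v - u < 1" shows "F v - F u < 1"
  using commutes_one[OF assms(1), of u] lift_less_iff[OF assms(1), of v "u + 1"] assms(2) by simp

text \<open>Under expansion the quantity \<open>min (D u) (D v) / (v - u) * exp (B * (v - u))\<close> does not decrease,
  and it is bounded once \<open>v - u\<close> is macroscopic.\<close>

theorem separation: "\<exists>c>0. \<forall>u\<in>X. \<forall>v\<in>X. u < v \<longrightarrow> c * min (D u) (D v) \<le> v - u"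
proof -
  obtain N where N: "N \<ge> 1" "\<And>u v. u\<in>X \<Longrightarrow> v\<in>X \<Longrightarrow> u < v \<Longrightarrow> v < u + 1 / N \<Longrightarrow> expandable N u v"
    using uniformly_expandable by blast
  \<comment> \<open>With this value \<open>B * (v - u) \<le> (B - N) * (F v - F u)\<close> whenever
    \<open>F\<close> expands by \<open>1 + 1 / N\<close>; the growth of the exponential factor thus
    pays for the distortion \<open>exp (- N * (F v - F u))\<close>.\<close>
  define B where "B = N * (N + 1)"
  have B: "B \<ge> 0" using N by (simp add: B_def)
  define q where "q u v = min (D u) (D v) / (v - u)" for u v
  have cap: "q u v * exp (B * (v - u)) \<le> N * exp B" if "q u v \<le> N" "u < v" "v - u < 1" for u v
  proof -
    have "q u v * exp (B * (v - u)) \<le> N * exp (B * (v - u))" using that(1) by (simp add: mult_right_mono)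
    also have "\<dots> \<le> N * exp B" using that B N by (simp add: mult_left_le)
    finally show ?thesis .
  qed
  \<comment> \<open>\<open>k\<close> bounds the number of expansions left before the length reaches
    \<open>1 / N\<close>; each one uses up a factor \<open>1 + 1 / N\<close>.\<close>
  have main: "q u v * exp (B * (v - u)) \<le> N * exp B"
    if "u \<in> X" "v \<in> X" "u < v" "v - u < 1" "1 / N \<le> (1 + 1 / N) ^ k * (v - u)" for u v k
    using that
  proof (induction k arbitrary: u v)
    case 0
    have "q u v \<le> 1 / (v - u)" using D_le_1 0 by (auto simp: q_def min_le_iff_disj intro!: divide_right_mono)
    also have "\<dots> \<le> N" using 0 N by (simp add: field_simps)
    finally show ?case using cap 0 by blast
  next
    case (Suc k)
    show ?case
    proof (cases "1 / N \<le> v - u")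
      case True
      have "q u v \<le> 1 / (v - u)" using D_le_1 Suc by (auto simp: q_def min_le_iff_disj intro!: divide_right_mono)
      also have "\<dots> \<le> N" using True Suc.prems N by (simp add: field_simps)
      finally show ?thesis using cap Suc.prems by blast
    next
      case False
      then have "expandable N u v" using N Suc.prems by simp
      then consider "min (D u) (D v) \<le> N * (v - u)"
        | F where "F \<in> \<Gamma>" "(1 + 1 / N) * (v - u) \<le> F v - F u"
          "exp (- N * (F v - F u)) * q u v \<le> q (F u) (F v)"
        unfolding expandable_def q_def by blast
      then show ?thesis
      proof cases
        case 1
        then have "q u v \<le> N" using Suc.prems by (simp add: q_def field_simps)
        then show ?thesis using cap Suc.prems by blast
      next
        case (2 F)
        have IH: "q (F u) (F v) * exp (B * (F v - F u)) \<le> N * exp B"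
        proof (rule Suc.IH)
          show "F u \<in> X" "F v \<in> X" "F u < F v" "F v - F u < 1"
            using X_lift Suc.prems 2(1) lift_less_iff lift_gap_less_1 by auto
          have "1 / N \<le> (1 + 1 / N) ^ k * ((1 + 1 / N) * (v - u))" using Suc.prems(5) by (simp add: algebra_simps)
          also have "\<dots> \<le> (1 + 1 / N) ^ k * (F v - F u)" using 2(2) N by (intro mult_left_mono) auto
          finally show "1 / N \<le> (1 + 1 / N) ^ k * (F v - F u)" .
        qed
        have q0: "0 \<le> q u v" using D_pos Suc.prems by (simp add: q_def less_imp_le)
        have "B * (v - u) = N^2 * ((1 + 1 / N) * (v - u))"
          using N by (simp add: B_def power2_eq_square field_simps)
        also have "\<dots> \<le> N^2 * (F v - F u)" using 2(2) by (intro mult_left_mono) auto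
        also have "\<dots> = - N * (F v - F u) + B * (F v - F u)"
          by (simp add: B_def power2_eq_square algebra_simps)
        finally have "exp (B * (v - u)) \<le> exp (- N * (F v - F u)) * exp (B * (F v - F u))"
          unfolding mult_exp_exp by (simp only: exp_le_cancel_iff)
        then have "q u v * exp (B * (v - u)) \<le> q u v * (exp (- N * (F v - F u)) * exp (B * (F v - F u)))"
          using q0 by (rule mult_left_mono)
        also have "\<dots> = exp (- N * (F v - F u)) * q u v * exp (B * (F v - F u))" by simp
        also have "\<dots> \<le> q (F u) (F v) * exp (B * (F v - F u))" using 2(3) by (rule mult_right_mono) simp
        finally show ?thesis using IH by simp
      qed
    qed
  qed
  define c where "c = 1 / (N * exp B)"
  have c: "0 < c" "c \<le> 1" using N B by (auto simp: c_def field_simps intro!: mult_ge1_I)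
  have "c * min (D u) (D v) \<le> v - u" if uv: "u \<in> X" "v \<in> X" "u < v" for u v
  proof (cases "v - u < 1")
    case True
    obtain k where k: "1 / N / (v - u) < (1 + 1 / N) ^ k"
      using real_arch_pow[of "1 + 1 / N" "1 / N / (v - u)"] N by auto
    then have "1 / N \<le> (1 + 1 / N) ^ k * (v - u)"
      using uv pos_divide_less_eq[of "v - u" "1 / N" "(1 + 1 / N) ^ k"] by simp
    then have "q u v * exp (B * (v - u)) \<le> N * exp B" using main uv True by blast
    moreover have "q u v * 1 \<le> q u v * exp (B * (v - u))"
      using D_pos uv B by (intro mult_left_mono) (auto simp: q_def less_imp_le)
    ultimately have "q u v \<le> N * exp B" by simp
    then show ?thesis using uv N by (simp add: q_def c_def field_simps)
  next
    case False
    have "c * min (D u) (D v) \<le> 1 * 1" using c D_le_1 D_pos uv by (intro mult_mono) (auto simp: min_le_iff_disj less_imp_le)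
    then show ?thesis using False by simp
  qed
  then show ?thesis using c by blast
qed

end

section \<open>Pairs with bounded Moebius invariant\<close>

lemma card_spaced:
  fixes A :: "real set"
  assumes "A \<subseteq> {a..b}" "0 < \<delta>" "\<And>s t. s \<in> A \<Longrightarrow> t \<in> A \<Longrightarrow> s < t \<Longrightarrow> \<delta> \<le> t - s" "a \<le> b"
  shows "finite A" "real (card A) \<le> (b - a) / \<delta> + 1"
proof -
  define f where "f t = nat \<lfloor>(t - a) / \<delta>\<rfloor>" for t
  have inj: "inj_on f A"
  proof (rule linorder_inj_onI)
    fix s t assume st: "s < t" "s \<in> A" "t \<in> A"
    then have "(s - a) / \<delta> + 1 \<le> (t - a) / \<delta>" using assms(2) assms(3)[of s t] divide_right_mono[of "s - a + \<delta>" "t - a" \<delta>]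
      by (simp add: add_divide_distrib)
    moreover have "0 \<le> (s - a) / \<delta>" using assms st by auto
    ultimately show "f s \<noteq> f t" unfolding f_def by linarith
  qed auto
  have sub: "f ` A \<subseteq> {..nat \<lfloor>(b - a) / \<delta>\<rfloor>}"
    using assms(1,2) by (auto simp: f_def intro!: nat_mono floor_mono divide_right_mono)
  show "finite A" using finite_subset[OF sub] inj finite_image_iff by blast
  have "card A = card (f ` A)" using inj by (simp add: card_image)
  also have "\<dots> \<le> nat \<lfloor>(b - a) / \<delta>\<rfloor> + 1" using card_mono[OF _ sub] by simp
  finally have "real (card A) \<le> real (nat \<lfloor>(b - a) / \<delta>\<rfloor>) + 1" by linarith
  moreover have "0 \<le> (b - a) / \<delta>" using assms by simp
  ultimately show "real (card A) \<le> (b - a) / \<delta> + 1" by linarith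
qed

context circle_lifts begin

text \<open>Points with \<open>D \<ge> \<tau>\<close> are \<open>c * \<tau>\<close> apart. The
  separation constant is a parameter because callers need the count with a \<open>c\<close> fixed
  beforehand.\<close>

lemma card_deriv_ge:
  assumes c: "0 < c" "\<And>u v. u\<in>X \<Longrightarrow> v\<in>X \<Longrightarrow> u < v \<Longrightarrow> c * min (D u) (D v) \<le> v - u"
    and "0 < \<tau>" "a \<le> b" "A \<subseteq> {t \<in> X. t \<in> {a..b} \<and> \<tau> \<le> D t}"
  shows "finite A" "real (card A) \<le> (b - a) / (c * \<tau>) + 1"
proof -
  have gap: "c * \<tau> \<le> t - s" if "s \<in> A" "t \<in> A" "s < t" for s t
  proof -
    have "c * \<tau> \<le> c * min (D s) (D t)" using that assms by (intro mult_left_mono) auto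
    also have "\<dots> \<le> t - s" using that assms(5) by (intro c) auto
    finally show ?thesis .
  qed
  show "finite A" "real (card A) \<le> (b - a) / (c * \<tau>) + 1"
    by (rule card_spaced[of A a b "c * \<tau>"]; use assms gap in auto)+
qed

text \<open>On \<open>X\<close>, where \<open>0 < D t \<le> 1\<close>, this is the index of the
  dyadic shell containing \<open>D t\<close>; the two lemmas below give its ends.\<close>

definition level :: "real \<Rightarrow> nat" where "level t = (LEAST k. (1 / 2) ^ Suc k < D t)"

lemma level_less: "t \<in> X \<Longrightarrow> (1 / 2) ^ Suc (level t) < D t"
proof -
  assume "t \<in> X"
  then obtain k where "(1 / 2) ^ k < D t" using real_arch_pow_inv[of "D t" "1/2"] D_pos by auto
  then have "(1 / 2) ^ Suc k < D t" using zero_less_power[of "1 / 2 :: real" k] by (simp add: field_simps)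
  then show ?thesis unfolding level_def by (rule LeastI)
qed

lemma level_ge: "t \<in> X \<Longrightarrow> D t \<le> (1 / 2) ^ level t"
proof (cases "level t")
  case 0
  then show "t \<in> X \<Longrightarrow> D t \<le> (1 / 2) ^ level t" using D_le_1 by simp
next
  case (Suc k)
  then have "\<not> (1 / 2) ^ Suc k < D t" unfolding level_def by (metis lessI not_less_Least)
  then show "D t \<le> (1 / 2) ^ level t" using Suc by simp
qed

definition Qf :: "real \<Rightarrow> real \<Rightarrow> real" where "Qf u w = (u - w)^2 / (D u * D w)"

lemma Qf_le_iff: "u \<in> X \<Longrightarrow> w \<in> X \<Longrightarrow> Qf u w \<le> Q \<longleftrightarrow> (u - w)^2 \<le> Q * (D u * D w)"
  using D_pos by (simp add: Qf_def pos_divide_le_eq)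

lemma Qf_shift: "u \<in> X \<Longrightarrow> w \<in> X \<Longrightarrow> Qf (u + of_int k) (w + of_int k) = Qf u w"
  by (simp add: Qf_def D_shift)

text \<open>With \<rho> the square root of 1/2, the pair has distance at most
  \<open>q * \<rho> ^ (k + l)\<close>. If \<open>k \<le> l\<close>, there are of order
  \<open>\<rho> ^ (- 2k)\<close> choices for the first point, and the spacing of order
  \<open>\<rho> ^ (2l)\<close> leaves of order \<open>\<rho> ^ (k - l)\<close> partners for each;
  the product is of order \<open>\<rho> ^ (- k - l)\<close>. If \<open>l < k\<close>, the roles are
  exchanged.\<close>

lemma card_pairs:
  assumes "0 < Q"
  obtains C where "0 < C"
    "\<And>k l P. finite P \<Longrightarrow> P \<subseteq> {(y, w). y \<in> X \<and> w \<in> X \<and> 0 \<le> y \<and> y \<le> 1 \<and> Qf y w \<le> Q \<and> level y = k \<and> level w = l} \<Longrightarrow>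
       real (card P) * sqrt (1 / 2) ^ (k + l) \<le> C"
proof -
  obtain c where c: "0 < c" "\<And>u v. u\<in>X \<Longrightarrow> v\<in>X \<Longrightarrow> u < v \<Longrightarrow> c * min (D u) (D v) \<le> v - u"
    using separation by blast
  define q where "q = sqrt Q"
  have q: "0 < q" using assms by (simp add: q_def)
  define \<rho> where "\<rho> = sqrt (1 / 2)"
  have \<rho>: "0 < \<rho>" "\<rho> < 1" "\<rho> * \<rho> = 1 / 2" by (auto simp: \<rho>_def)
  have \<rho>2: "(1 / 2) ^ k = \<rho> ^ k * \<rho> ^ k" for k unfolding \<rho>(3)[symmetric] by (simp add: power_mult_distrib)
  define A where "A a b k = {t \<in> X. t \<in> {a..b} \<and> level t = k}" for a b k
  have A: "finite (A a b k)" "real (card (A a b k)) \<le> (b - a) * 2 / (c * (\<rho> ^ k * \<rho> ^ k)) + 1"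
    if "a \<le> b" for a b k
  proof -
    have sub: "A a b k \<subseteq> {t \<in> X. t \<in> {a..b} \<and> (1 / 2) ^ Suc k \<le> D t}"
      using level_less by (auto simp: A_def less_imp_le)
    show "finite (A a b k)" by (rule card_deriv_ge(1)[of c "(1 / 2) ^ Suc k" a b]) (use c that sub in auto)
    have "real (card (A a b k)) \<le> (b - a) / (c * (1 / 2) ^ Suc k) + 1"
      by (rule card_deriv_ge(2)) (use c that sub in auto)
    also have "c * (1 / 2) ^ Suc k = c * (\<rho> ^ k * \<rho> ^ k) / 2" unfolding \<rho>2[symmetric] by simp
    finally show "real (card (A a b k)) \<le> (b - a) * 2 / (c * (\<rho> ^ k * \<rho> ^ k)) + 1" by simp
  qed
  have far: "real (card (A a b k)) * (\<rho> ^ k * \<rho> ^ k) \<le> (b - a) * 2 / c + 1" if "a \<le> b" for a b k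
  proof -
    have "\<rho> ^ k * \<rho> ^ k \<le> 1" using \<rho> by (simp add: mult_le_one power_le_one)
    have p: "0 < \<rho> ^ k * \<rho> ^ k" using \<rho> by simp
    have "real (card (A a b k)) * (\<rho> ^ k * \<rho> ^ k) \<le> ((b - a) * 2 / (c * (\<rho> ^ k * \<rho> ^ k)) + 1) * (\<rho> ^ k * \<rho> ^ k)"
      using A(2)[OF that] p by (intro mult_right_mono) auto
    also have "\<dots> = (b - a) * 2 / c + \<rho> ^ k * \<rho> ^ k" using p c(1) \<rho> by (simp add: field_simps)
    finally show ?thesis using \<open>\<rho> ^ k * \<rho> ^ k \<le> 1\<close> by simp
  qed
  \<comment> \<open>The summand 1 in the count turns into \<open>\<rho> ^ l\<close>, which is
    absorbed by \<open>\<rho> ^ k\<close> only if the partner lies in the deeper shell.\<close>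
  have near: "real (card (A (t - q * (\<rho> ^ k * \<rho> ^ l)) (t + q * (\<rho> ^ k * \<rho> ^ l)) l)) * \<rho> ^ l \<le> (4 * q / c + 1) * \<rho> ^ k"
    if "k \<le> l" for t k l
  proof -
    have p: "0 < \<rho> ^ l" "0 < \<rho> ^ k" using \<rho> by simp_all
    have pl: "\<rho> ^ l \<le> \<rho> ^ k" using \<rho> that by (intro power_decreasing) auto
    have "real (card (A (t - q * (\<rho> ^ k * \<rho> ^ l)) (t + q * (\<rho> ^ k * \<rho> ^ l)) l)) * \<rho> ^ l
        \<le> ((t + q * (\<rho> ^ k * \<rho> ^ l) - (t - q * (\<rho> ^ k * \<rho> ^ l))) * 2 / (c * (\<rho> ^ l * \<rho> ^ l)) + 1) * \<rho> ^ l"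
      using p q by (intro mult_right_mono A(2)) auto
    also have "\<dots> = 4 * q / c * \<rho> ^ k + \<rho> ^ l" using p c(1) \<rho>(1) by (simp add: field_simps)
    finally show ?thesis using pl by (simp add: algebra_simps)
  qed
  \<comment> \<open>The second factor counts points in \<open>{- q..1 + q}\<close>, an interval of
    length \<open>2 * q + 1\<close>, and also covers the count in \<open>{0..1}\<close>.\<close>
  define C where "C = (4 * q / c + 1) * ((2 * q + 1) * 2 / c + 1)"
  show thesis
  proof (rule that[of C])
    show "0 < C" using q c by (simp add: C_def add_pos_pos)
    fix k l P assume fin: "finite P" and P: "P \<subseteq> {(y, w). y \<in> X \<and> w \<in> X \<and> 0 \<le> y \<and> y \<le> 1 \<and> Qf y w \<le> Q \<and> level y = k \<and> level w = l}"
    have dist: "\<bar>y - w\<bar> \<le> q * (\<rho> ^ k * \<rho> ^ l)" if "(y, w) \<in> P" for y w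
    proof -
      have yw: "y \<in> X" "w \<in> X" "(y - w)^2 \<le> Q * (D y * D w)" "level y = k" "level w = l"
        using that P Qf_le_iff by blast+
      have "D y * D w \<le> (\<rho> ^ k * \<rho> ^ k) * (\<rho> ^ l * \<rho> ^ l)"
        using level_ge[OF yw(1)] level_ge[OF yw(2)] D_pos[OF yw(2)] yw(4,5) \<rho>
        unfolding \<rho>2[symmetric] by (intro mult_mono) auto
      then have "Q * (D y * D w) \<le> Q * ((\<rho> ^ k * \<rho> ^ k) * (\<rho> ^ l * \<rho> ^ l))" using assms by simp
      also have "\<dots> = (q * (\<rho> ^ k * \<rho> ^ l))^2" using assms by (simp add: q_def power_mult_distrib power2_eq_square)
      finally have "(y - w)^2 \<le> (q * (\<rho> ^ k * \<rho> ^ l))^2" using yw(3) by linarith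
      then have "\<bar>y - w\<bar> \<le> \<bar>q * (\<rho> ^ k * \<rho> ^ l)\<bar>" by (simp only: abs_le_square_iff)
      then show ?thesis using q \<rho> by simp
    qed
    have small: "\<rho> ^ k * \<rho> ^ l \<le> 1" using \<rho> by (simp add: mult_le_one power_le_one)
    then have small': "q * (\<rho> ^ k * \<rho> ^ l) \<le> q" using q by simp
    have card_Sigma: "real (card P) * (\<rho> ^ n * \<rho> ^ n * \<rho> ^ m) \<le> a * b * \<rho> ^ n"
      if S: "card P \<le> (\<Sum>s\<in>S. card (W s))" "finite S" and a: "real (card S) * (\<rho> ^ n * \<rho> ^ n) \<le> a"
        and b: "\<And>s. real (card (W s)) * \<rho> ^ m \<le> b * \<rho> ^ n" "0 \<le> b"
      for S :: "real set" and W :: "real \<Rightarrow> real set" and n m a b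
    proof -
      have "real (card P) * (\<rho> ^ n * \<rho> ^ n * \<rho> ^ m) \<le> real (\<Sum>s\<in>S. card (W s)) * (\<rho> ^ n * \<rho> ^ n * \<rho> ^ m)"
        using S \<rho> by (intro mult_right_mono of_nat_mono) auto
      also have "\<dots> = (\<Sum>s\<in>S. real (card (W s)) * \<rho> ^ m) * (\<rho> ^ n * \<rho> ^ n)"
        by (simp add: sum_distrib_left sum_distrib_right mult_ac)
      also have "\<dots> \<le> (\<Sum>s\<in>S. b * \<rho> ^ n) * (\<rho> ^ n * \<rho> ^ n)"
        using \<rho>(1) by (intro mult_right_mono sum_mono b) simp
      also have "\<dots> = real (card S) * (\<rho> ^ n * \<rho> ^ n) * (b * \<rho> ^ n)" by (simp add: mult_ac)
      also have "\<dots> \<le> a * (b * \<rho> ^ n)" using b(2) \<rho>(1) by (intro mult_right_mono a) simp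
      finally show ?thesis by (simp add: mult_ac)
    qed
    show "real (card P) * sqrt (1 / 2) ^ (k + l) \<le> C"
    proof (cases "k \<le> l")
      case True
      define W where "W y = A (y - q * (\<rho> ^ k * \<rho> ^ l)) (y + q * (\<rho> ^ k * \<rho> ^ l)) l" for y
      have finW: "finite (W y)" for y unfolding W_def using q \<rho> by (intro A) auto
      have "P \<subseteq> Sigma (A 0 1 k) W"
        using P dist unfolding A_def W_def by (auto simp: abs_le_iff) (smt (verit) dist)+
      then have "card P \<le> card (Sigma (A 0 1 k) W)" by (intro card_mono finite_SigmaI A finW) auto
      also have "\<dots> = (\<Sum>y\<in>A 0 1 k. card (W y))" using finW A by (intro card_SigmaI) auto
      finally have "real (card P) * (\<rho> ^ k * \<rho> ^ k * \<rho> ^ l) \<le> (2 / c + 1) * (4 * q / c + 1) * \<rho> ^ k"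
        using near[OF True] far[of 0 1 k] A(1)[of 0 1 k] q c
        by (intro card_Sigma[where S = "A 0 1 k" and W = W]) (auto simp: W_def)
      then have "(real (card P) * (\<rho> ^ k * \<rho> ^ l)) * \<rho> ^ k \<le> ((2 / c + 1) * (4 * q / c + 1)) * \<rho> ^ k" by (simp add: mult_ac)
      then have "real (card P) * (\<rho> ^ k * \<rho> ^ l) \<le> (2 / c + 1) * (4 * q / c + 1)"
        using \<rho> by (simp only: mult_le_cancel_right_pos zero_less_power)
      also have "\<dots> \<le> C" unfolding C_def using q c by (subst mult.commute) (auto intro!: mult_left_mono simp: field_simps)
      finally show ?thesis by (simp add: \<rho>_def power_add)
    next
      case False
      define W where "W w = A (w - q * (\<rho> ^ l * \<rho> ^ k)) (w + q * (\<rho> ^ l * \<rho> ^ k)) k" for w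
      have finW: "finite (W y)" for y unfolding W_def using q \<rho> by (intro A) auto
      \<comment> \<open>When \<open>w\<close> is chosen first it need not lie in
        \<open>{0..1}\<close>, but it is within \<open>q\<close> of \<open>y\<close>, which
        does.\<close>
      have "prod.swap ` P \<subseteq> Sigma (A (- q) (1 + q) l) W"
      proof
        fix p assume "p \<in> prod.swap ` P"
        then obtain y w where p: "p = (w, y)" "(y, w) \<in> P" by auto
        then have yw: "y \<in> X" "w \<in> X" "0 \<le> y" "y \<le> 1" "level y = k" "level w = l" using P by auto
        show "p \<in> Sigma (A (- q) (1 + q) l) W"
          using dist[OF p(2)] small' yw unfolding p(1) A_def W_def by (auto simp: mult.commute)
      qed
      then have "card (prod.swap ` P) \<le> card (Sigma (A (- q) (1 + q) l) W)" using q by (intro card_mono finite_SigmaI A finW) auto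
      also have "\<dots> = (\<Sum>y\<in>A (- q) (1 + q) l. card (W y))" using finW A q by (intro card_SigmaI) auto
      also have "card (prod.swap ` P) = card P" by (intro card_image) (auto simp: inj_on_def)
      finally have "real (card P) * (\<rho> ^ l * \<rho> ^ l * \<rho> ^ k) \<le> ((2 * q + 1) * 2 / c + 1) * (4 * q / c + 1) * \<rho> ^ l"
        using near[of l k] far[of "- q" "1 + q" l] A(1)[of "- q" "1 + q" l] q c False
        by (intro card_Sigma[where S = "A (- q) (1 + q) l" and W = W]) (auto simp: W_def algebra_simps)
      then have "(real (card P) * (\<rho> ^ k * \<rho> ^ l)) * \<rho> ^ l \<le> C * \<rho> ^ l" by (simp add: mult_ac C_def)
      then have "real (card P) * (\<rho> ^ k * \<rho> ^ l) \<le> C"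
        using \<rho> by (simp only: mult_le_cancel_right_pos zero_less_power)
      then show ?thesis by (simp add: \<rho>_def power_add)
    qed
  qed
qed

text \<open>A pair of levels \<open>k\<close> and \<open>l\<close> contributes at most
  \<open>\<rho> ^ (2 * (k + l))\<close> and there are at most \<open>C / \<rho> ^ (k + l)\<close> of
  them; what remains is the tail of a double geometric series.\<close>

lemma sum_pairs_small:
  assumes "0 < Q" "0 < \<theta>"
  obtains \<epsilon> where "0 < \<epsilon>" "\<And>P. finite P \<Longrightarrow>
    P \<subseteq> {(y, w). y \<in> X \<and> w \<in> X \<and> 0 \<le> y \<and> y \<le> 1 \<and> Qf y w \<le> Q \<and> D y < \<epsilon>} \<Longrightarrow> (\<Sum>(y, w)\<in>P. D y * D w) \<le> \<theta>"
proof -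
  obtain C where C: "0 < C"
    "\<And>k l P. finite P \<Longrightarrow> P \<subseteq> {(y, w). y \<in> X \<and> w \<in> X \<and> 0 \<le> y \<and> y \<le> 1 \<and> Qf y w \<le> Q \<and> level y = k \<and> level w = l} \<Longrightarrow>
       real (card P) * sqrt (1 / 2) ^ (k + l) \<le> C"
    using card_pairs[OF assms(1)] by blast
  define \<rho> where "\<rho> = sqrt (1 / 2)"
  have \<rho>: "0 < \<rho>" "\<rho> < 1" "\<rho> * \<rho> = 1 / 2" by (auto simp: \<rho>_def)
  have \<rho>2: "(1 / 2) ^ k = \<rho> ^ k * \<rho> ^ k" for k unfolding \<rho>(3)[symmetric] by (simp add: power_mult_distrib)
  have geo: "(\<Sum>k\<in>{m..<n}. \<rho> ^ k) \<le> \<rho> ^ m / (1 - \<rho>)" for m n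
  proof (cases "m \<le> n")
    case True
    then have "(1 - \<rho>) * (\<Sum>k\<in>{m..<n}. \<rho> ^ k) = \<rho> ^ m - \<rho> ^ n"
    proof (induction n rule: dec_induct)
      case (step n)
      have "(1 - \<rho>) * (\<Sum>k\<in>{m..<Suc n}. \<rho> ^ k) = (1 - \<rho>) * (\<Sum>k\<in>{m..<n}. \<rho> ^ k) + (1 - \<rho>) * \<rho> ^ n"
        using step by (simp add: distrib_left)
      then show ?case unfolding step.IH by (simp add: algebra_simps)
    qed simp
    then have "(\<Sum>k\<in>{m..<n}. \<rho> ^ k) = (\<rho> ^ m - \<rho> ^ n) / (1 - \<rho>)"
      using \<rho> by (simp add: field_simps)
    also have "\<dots> \<le> \<rho> ^ m / (1 - \<rho>)" using \<rho> by (intro divide_right_mono) auto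
    finally show ?thesis .
  qed (use \<rho> in auto)
  \<comment> \<open>The series is cut off in the index of \<open>y\<close> alone, so the tail is
    \<open>C * \<rho> ^ k0 / (1 - \<rho>)^2\<close>, which is to be below \<theta>.\<close>
  obtain k0 where k0: "\<rho> ^ k0 < \<theta> * (1 - \<rho>) * (1 - \<rho>) / C"
    using real_arch_pow_inv[of "\<theta> * (1 - \<rho>) * (1 - \<rho>) / C" \<rho>] assms C \<rho> by auto
  show thesis
  proof (rule that[of "(1 / 2) ^ Suc k0"])
    show "(0 :: real) < (1 / 2) ^ Suc k0" by simp
    fix P assume fin: "finite P"
      and P: "P \<subseteq> {(y, w). y \<in> X \<and> w \<in> X \<and> 0 \<le> y \<and> y \<le> 1 \<and> Qf y w \<le> Q \<and> D y < (1 / 2) ^ Suc k0}"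
    define g where "g p = (level (fst p), level (snd p))" for p
    obtain M where M: "\<And>p. p \<in> P \<Longrightarrow> level (fst p) < M \<and> level (snd p) < M"
    proof -
      have "finite (insert 0 ((\<lambda>p. level (fst p)) ` P \<union> (\<lambda>p. level (snd p)) ` P))" using fin by simp
      then obtain M where "\<forall>x\<in>insert 0 ((\<lambda>p. level (fst p)) ` P \<union> (\<lambda>p. level (snd p)) ` P). x < M"
        using finite_nat_set_iff_bounded by blast
      then show thesis using that by blast
    qed
    have lev: "k0 \<le> level y" if "(y, w) \<in> P" for y w
    proof -
      have "(1 / 2) ^ Suc (level y) < (1 / 2 :: real) ^ Suc k0" 
      proof (rule less_trans[OF level_less])
        show "y \<in> X" "D y < (1 / 2) ^ Suc k0" using that P by auto
      qed
      then have "Suc k0 < Suc (level y)" by (subst (asm) power_strict_decreasing_iff) auto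
      then show ?thesis by simp
    qed
    have gP: "g ` P \<subseteq> {k0..<M} \<times> {0..<M}" using M lev by (auto simp: g_def)
    have piece: "(\<Sum>(y, w)\<in>{p \<in> P. g p = (k, l)}. D y * D w) \<le> C * (\<rho> ^ k * \<rho> ^ l)" for k l
    proof -
      have "(\<Sum>(y, w)\<in>{p \<in> P. g p = (k, l)}. D y * D w) \<le> (\<Sum>p\<in>{p \<in> P. g p = (k, l)}. (\<rho> ^ k * \<rho> ^ k) * (\<rho> ^ l * \<rho> ^ l))"
      proof (rule sum_mono, clarsimp)
        fix y w assume "(y, w) \<in> P" "g (y, w) = (k, l)"
        then have yw: "y \<in> X" "w \<in> X" "level y = k" "level w = l" using P by (auto simp: g_def)
        show "D y * D w \<le> (\<rho> ^ k * \<rho> ^ k) * (\<rho> ^ l * \<rho> ^ l)"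
          using level_ge[OF yw(1)] level_ge[OF yw(2)] D_pos[OF yw(2)] yw(3,4) \<rho>
          unfolding \<rho>2[symmetric] by (intro mult_mono) auto
      qed
      also have "\<dots> = real (card {p \<in> P. g p = (k, l)}) * sqrt (1 / 2) ^ (k + l) * (\<rho> ^ k * \<rho> ^ l)"
        by (simp add: power_add \<rho>_def)
      also have "\<dots> \<le> C * (\<rho> ^ k * \<rho> ^ l)"
        using \<rho> P fin by (intro mult_right_mono C(2)) (auto simp: g_def)
      finally show ?thesis .
    qed
    have "(\<Sum>(y, w)\<in>P. D y * D w) = (\<Sum>kl\<in>{k0..<M} \<times> {0..<M}. \<Sum>(y, w)\<in>{p \<in> P. g p = kl}. D y * D w)"
      by (rule sum.group[symmetric]) (use fin gP in auto)
    also have "\<dots> \<le> (\<Sum>(k, l)\<in>{k0..<M} \<times> {0..<M}. C * (\<rho> ^ k * \<rho> ^ l))"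
      by (intro sum_mono) (use piece in auto)
    also have "\<dots> = (\<Sum>k\<in>{k0..<M}. \<Sum>l\<in>{0..<M}. C * (\<rho> ^ k * \<rho> ^ l))"
      by (simp add: sum.cartesian_product)
    also have "\<dots> = C * ((\<Sum>k\<in>{k0..<M}. \<rho> ^ k) * (\<Sum>l\<in>{0..<M}. \<rho> ^ l))"
      by (subst sum_product) (simp only: sum_distrib_left)
    also have "\<dots> \<le> C * (\<rho> ^ k0 / (1 - \<rho>) * (\<rho> ^ 0 / (1 - \<rho>)))"
      using C \<rho> by (intro mult_left_mono mult_mono geo sum_nonneg) auto
    also have "\<dots> = \<rho> ^ k0 * C / ((1 - \<rho>) * (1 - \<rho>))" by simp
    also have "\<dots> \<le> \<theta>"
    proof -
      have "\<rho> ^ k0 * C < \<theta> * (1 - \<rho>) * (1 - \<rho>)" using k0 C(1) pos_less_divide_eq by blast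
      moreover have "0 < (1 - \<rho>) * (1 - \<rho>)" using \<rho> by simp
      ultimately show ?thesis by (simp only: pos_divide_le_eq mult.assoc less_imp_le)
    qed
    finally show "(\<Sum>(y, w)\<in>P. D y * D w) \<le> \<theta>" .
  qed
qed

section \<open>Transport of the invariant along simple paths\<close>

definition at_most_doubles :: "real \<Rightarrow> (real \<Rightarrow> real) \<Rightarrow> real \<Rightarrow> bool" where
  "at_most_doubles Q F u \<longleftrightarrow> (\<forall>w\<in>X. w \<noteq> u \<longrightarrow> Qf u w \<le> Q \<longrightarrow> Qf (F u) (F w) \<le> 2 * Qf u w)"

text \<open>A Schreier path inside \<open>D < \<epsilon>\<close> starting at the class of
  \<open>u\<close>, recorded by composites of lifts, because the path has to move the neighbours of
  \<open>u\<close> as well. The condition on differences makes the path simple on the circle, so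
  that no pair is counted twice when distortions are added up.\<close>

definition linked :: "(real \<Rightarrow> real) set \<Rightarrow> real \<Rightarrow> (real \<Rightarrow> real) \<Rightarrow> real \<Rightarrow> bool" where
  "linked \<Sigma> \<epsilon> F u \<longleftrightarrow> (\<exists>n f. f 0 = id \<and> f n = F \<and> (\<forall>i<n. \<exists>\<sigma>\<in>\<Sigma>. f (Suc i) = \<sigma> \<circ> f i) \<and>
     (\<forall>i\<le>n. D (f i u) < \<epsilon>) \<and> (\<forall>i\<le>n. \<forall>j<i. f i u - f j u \<notin> \<int>))"

lemma linkedE:
  assumes "linked \<Sigma> \<epsilon> F u"
  obtains n f where "f 0 = id" "f n = F" "\<forall>i<n. \<exists>\<sigma>\<in>\<Sigma>. f (Suc i) = \<sigma> \<circ> f i"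
    "\<forall>i\<le>n. D (f i u) < \<epsilon>" "\<forall>i\<le>n. \<forall>j<i. f i u - f j u \<notin> \<int>"
  using assms unfolding linked_def by (elim exE conjE)

lemma chain_mem:
  assumes "f 0 = id" "\<And>i. i < n \<Longrightarrow> \<exists>\<sigma>\<in>\<Sigma>. f (Suc i) = \<sigma> \<circ> f i" "\<Sigma> \<subseteq> \<Gamma>" "i \<le> n"
  shows "f i \<in> \<Gamma>"
  using assms(4)
proof (induction i)
  case (Suc i)
  then have "f i \<in> \<Gamma>" "\<exists>\<sigma>\<in>\<Sigma>. f (Suc i) = \<sigma> \<circ> f i" using assms(2)[of i] by simp_all
  then show ?case using comp_mem assms(3) by (metis subsetD)
qed (simp add: assms(1) id_mem)

text \<open>By the cocycle rule for \<open>D\<close>, the ratio of \<open>Qf s t\<close> to its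
  image is exactly the expression inside the logarithm of
  \<open>projective_distortion\<close>.\<close>

lemma Qf_step:
  assumes "\<sigma> \<in> \<Gamma>"
  obtains C where "0 \<le> C" "\<And>s t. s \<in> X \<Longrightarrow> t \<in> X \<Longrightarrow> s \<noteq> t \<Longrightarrow> \<bar>s - t\<bar> \<le> 1 \<Longrightarrow>
    Qf (\<sigma> s) (\<sigma> t) \<le> Qf s t * exp (C * (s - t)^2)"
proof -
  obtain C where C: "0 \<le> C" "\<And>s t. s \<noteq> t \<Longrightarrow> \<bar>s - t\<bar> \<le> 1 \<Longrightarrow>
         \<bar>ln (deriv \<sigma> s * deriv \<sigma> t * (s - t)^2 / (\<sigma> s - \<sigma> t)^2)\<bar> \<le> C * (s - t)^2"
    using projective_distortion[OF assms] by blast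
  show thesis
  proof (rule that[OF C(1)])
    fix s t assume st: "s \<in> X" "t \<in> X" "s \<noteq> t" "\<bar>s - t\<bar> \<le> 1"
    define E where "E = deriv \<sigma> s * deriv \<sigma> t * (s - t)^2 / (\<sigma> s - \<sigma> t)^2"
    have ne: "\<sigma> s - \<sigma> t \<noteq> 0" using lift_eq_iff[OF assms] st by simp
    have pos: "0 < deriv \<sigma> s" "0 < deriv \<sigma> t" "0 < D s" "0 < D t" "0 < (s - t)^2" "0 < (\<sigma> s - \<sigma> t)^2"
      using deriv_pos[OF assms] D_pos st ne by auto
    have E: "0 < E" unfolding E_def using pos by simp
    have "Qf (\<sigma> s) (\<sigma> t) * E = Qf s t"
      unfolding E_def Qf_def D_comp[OF st(1) assms] D_comp[OF st(2) assms]
      using pos ne by (simp add: field_simps)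
    then have "Qf (\<sigma> s) (\<sigma> t) = Qf s t * inverse E" using E by (simp add: field_simps)
    also have "inverse E = exp (- ln E)" using E by (simp add: exp_minus)
    also have "Qf s t * \<dots> \<le> Qf s t * exp (C * (s - t)^2)"
      using C(2)[OF st(3,4)] pos by (intro mult_left_mono) (auto simp: E_def[symmetric] Qf_def)
    finally show "Qf (\<sigma> s) (\<sigma> t) \<le> Qf s t * exp (C * (s - t)^2)" .
  qed
qed

text \<open>A bootstrap along the path: as long as \<open>Qf\<close> has not exceeded
  \<open>2 * Q\<close>, all pairs visited are among those of \<open>sum_pairs_small\<close>, so the
  accumulated distortion is at most \<open>ln 2\<close> and the next value of \<open>Qf\<close> is
  again at most doubled.\<close>

lemma Qf_linked:
  assumes "finite \<Sigma>" "\<Sigma> \<subseteq> \<Gamma>" "0 < Q"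
  obtains \<epsilon> where "0 < \<epsilon>" "\<And>F u. linked \<Sigma> \<epsilon> F u \<Longrightarrow> u \<in> X \<Longrightarrow> at_most_doubles Q F u"
proof -
  have "\<forall>\<sigma>\<in>\<Sigma>. \<exists>C\<ge>0. \<forall>s t. s \<in> X \<longrightarrow> t \<in> X \<longrightarrow> s \<noteq> t \<longrightarrow> \<bar>s - t\<bar> \<le> 1 \<longrightarrow> Qf (\<sigma> s) (\<sigma> t) \<le> Qf s t * exp (C * (s - t)^2)"
  proof
    fix \<sigma> assume "\<sigma> \<in> \<Sigma>"
    then show "\<exists>C\<ge>0. \<forall>s t. s \<in> X \<longrightarrow> t \<in> X \<longrightarrow> s \<noteq> t \<longrightarrow> \<bar>s - t\<bar> \<le> 1 \<longrightarrow> Qf (\<sigma> s) (\<sigma> t) \<le> Qf s t * exp (C * (s - t)^2)"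
      using Qf_step[of \<sigma>] assms(2) by (metis subsetD)
  qed
  then obtain Cs where Cs: "\<And>\<sigma>. \<sigma> \<in> \<Sigma> \<Longrightarrow> 0 \<le> Cs \<sigma>"
    "\<And>\<sigma> s t. \<sigma> \<in> \<Sigma> \<Longrightarrow> s \<in> X \<Longrightarrow> t \<in> X \<Longrightarrow> s \<noteq> t \<Longrightarrow> \<bar>s - t\<bar> \<le> 1 \<Longrightarrow> Qf (\<sigma> s) (\<sigma> t) \<le> Qf s t * exp (Cs \<sigma> * (s - t)^2)"
    by metis
  \<comment> \<open>The summand 1 keeps \<open>C\<close> positive, as \<theta> is defined by
    dividing by it.\<close>
  define C where "C = 1 + sum Cs \<Sigma>"
  have C: "0 < C" unfolding C_def using Cs by (intro add_pos_nonneg sum_nonneg) auto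
  have Qf0: "0 \<le> Qf s t" if "s \<in> X" "t \<in> X" for s t
    unfolding Qf_def using D_pos that by (simp add: less_imp_le)
  have step: "Qf (\<sigma> s) (\<sigma> t) \<le> Qf s t * exp (C * (s - t)^2)"
    if "\<sigma> \<in> \<Sigma>" "s \<in> X" "t \<in> X" "s \<noteq> t" "\<bar>s - t\<bar> \<le> 1" for \<sigma> s t
  proof -
    have "Cs \<sigma> \<le> C" unfolding C_def using that(1) assms(1) Cs(1) member_le_sum[of \<sigma> \<Sigma> Cs] by fastforce
    then have "Qf s t * exp (Cs \<sigma> * (s - t)^2) \<le> Qf s t * exp (C * (s - t)^2)"
      using Qf0 that by (intro mult_left_mono) (auto intro!: mult_right_mono)
    then show ?thesis using Cs(2)[OF that] by linarith
  qed
  define \<theta> where "\<theta> = ln 2 / (C * (2 * Q))"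
  have \<theta>: "0 < \<theta>" using C assms(3) by (simp add: \<theta>_def)
  obtain \<epsilon>1 where \<epsilon>1: "0 < \<epsilon>1" "\<And>P. finite P \<Longrightarrow>
    P \<subseteq> {(y, w). y \<in> X \<and> w \<in> X \<and> 0 \<le> y \<and> y \<le> 1 \<and> Qf y w \<le> 2 * Q \<and> D y < \<epsilon>1} \<Longrightarrow> (\<Sum>(y, w)\<in>P. D y * D w) \<le> \<theta>"
    using sum_pairs_small[of "2 * Q" \<theta>] assms(3) \<theta> by auto
  \<comment> \<open>The bound \<open>1 / (2 * Q)\<close> keeps paired points within distance 1, the
    range of \<open>projective_distortion\<close>.\<close>
  define \<epsilon> where "\<epsilon> = min \<epsilon>1 (1 / (2 * Q))"
  have \<epsilon>: "0 < \<epsilon>" "\<epsilon> \<le> \<epsilon>1" "\<epsilon> \<le> 1 / (2 * Q)" using \<epsilon>1 assms(3) by (auto simp: \<epsilon>_def)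
  show thesis
  proof (rule that[OF \<epsilon>(1)], unfold at_most_doubles_def, intro ballI impI)
    fix F u w assume link: "linked \<Sigma> \<epsilon> F u" and uw: "u \<in> X" "w \<in> X" "w \<noteq> u" "Qf u w \<le> Q"
    from link obtain n f where f0: "f 0 = id" "f n = F" "\<forall>i<n. \<exists>\<sigma>\<in>\<Sigma>. f (Suc i) = \<sigma> \<circ> f i"
      "\<forall>i\<le>n. D (f i u) < \<epsilon>" "\<forall>i\<le>n. \<forall>j<i. f i u - f j u \<notin> \<int>"
      by (rule linkedE)
    note f = f0(1,2) f0(3-5)[rule_format]
    have mem: "f i \<in> \<Gamma>" if "i \<le> n" for i by (rule chain_mem[OF f(1,3) assms(2) that])
    have inX: "f i u \<in> X" "f i w \<in> X" "f i u \<noteq> f i w" if "i \<le> n" for i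
      using X_lift[OF _ mem[OF that]] uw lift_eq_iff[OF mem[OF that]] by auto
    define S where "S i = (\<Sum>j<i. (f j u - f j w)^2)" for i
    have "Qf (f i u) (f i w) \<le> Qf u w * exp (C * S i) \<and> C * S i \<le> ln 2" if "i \<le> n" for i
      using that
    proof (induction i rule: less_induct)
      case (less i)
      show ?case
      proof (cases i)
        case 0
        then show ?thesis by (simp add: S_def f)
      next
        case (Suc m)
        have Qb: "Qf (f j u) (f j w) \<le> 2 * Q" if "j \<le> m" for j
        proof -
          have "Qf (f j u) (f j w) \<le> Qf u w * exp (C * S j)" "C * S j \<le> ln 2"
            using less.IH[of j] less.prems that Suc by auto
          moreover have "exp (C * S j) \<le> 2" using \<open>C * S j \<le> ln 2\<close> by (metis exp_le_cancel_iff exp_ln zero_less_numeral)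
          moreover have "Qf u w * exp (C * S j) \<le> Q * 2"
            using uw Qf0 assms(3) \<open>exp (C * S j) \<le> 2\<close> by (intro mult_mono) auto
          ultimately show ?thesis by linarith
        qed
        have sq: "(f j u - f j w)^2 \<le> 2 * Q * (D (f j u) * D (f j w))" if "j \<le> m" for j
          using Qb[OF that] inX[of j] that less.prems Suc Qf_le_iff by auto
        have "(f m u - f m w)^2 \<le> 2 * Q * (\<epsilon> * 1)"
        proof -
          have "D (f m u) * D (f m w) \<le> \<epsilon> * 1"
            using f(4)[of m] inX[of m] less.prems Suc D_le_1 D_pos \<epsilon>(1) by (intro mult_mono) (auto simp: less_imp_le)
          then have "2 * Q * (D (f m u) * D (f m w)) \<le> 2 * Q * (\<epsilon> * 1)" using assms(3) by (intro mult_left_mono) auto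
          then show ?thesis using sq[of m] by linarith
        qed
        also have "\<dots> \<le> 1" using \<epsilon> assms(3) by (simp add: field_simps)
        finally have d1: "\<bar>f m u - f m w\<bar> \<le> 1" by (simp add: abs_square_le_1)
        obtain \<sigma> where \<sigma>: "\<sigma> \<in> \<Sigma>" "f i = \<sigma> \<circ> f m" using f(3)[of m] less.prems Suc by auto
        have "Qf (f i u) (f i w) \<le> Qf (f m u) (f m w) * exp (C * (f m u - f m w)^2)"
          using step[OF \<sigma>(1) _ _ _ d1] inX[of m] less.prems Suc \<sigma>(2) by simp
        also have "\<dots> \<le> Qf u w * exp (C * S m) * exp (C * (f m u - f m w)^2)"
          using less.IH[of m] less.prems Suc by (intro mult_right_mono) auto
        also have "\<dots> = Qf u w * exp (C * S i)"
          by (simp add: Suc S_def mult_exp_exp distrib_left mult.assoc)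
        finally have 1: "Qf (f i u) (f i w) \<le> Qf u w * exp (C * S i)" .
        \<comment> \<open>Each pair is translated so that its first point lies in
          \<open>{0..1}\<close>; simplicity of the path makes this injective, so the sum along the
          path is a sum over a set of pairs.\<close>
        define pr where "pr j = (f j u + of_int (- \<lfloor>f j u\<rfloor>), f j w + of_int (- \<lfloor>f j u\<rfloor>))" for j
        have inj: "inj_on pr {..m}"
        proof (rule linorder_inj_onI)
          fix j k assume jk: "j < k" "j \<in> {..m}" "k \<in> {..m}"
          have "f k u - f j u = of_int (\<lfloor>f k u\<rfloor> - \<lfloor>f j u\<rfloor>)" if "pr j = pr k" using that by (simp add: pr_def)
          then show "pr j \<noteq> pr k" using f(5)[of k j] jk less.prems Suc by (metis Ints_of_int atMost_iff le_trans less_imp_le_nat lessI)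
        qed auto
        have "(\<Sum>(y, w)\<in>pr ` {..m}. D y * D w) \<le> \<theta>"
        proof (rule \<epsilon>1(2))
          show "pr ` {..m} \<subseteq> {(y, w). y \<in> X \<and> w \<in> X \<and> 0 \<le> y \<and> y \<le> 1 \<and> Qf y w \<le> 2 * Q \<and> D y < \<epsilon>1}"
          proof
            fix p assume "p \<in> pr ` {..m}"
            then obtain j where j: "j \<le> m" "p = pr j" by auto
            have jn: "j \<le> n" using j less.prems Suc by simp
            have "0 \<le> f j u + of_int (- \<lfloor>f j u\<rfloor>)" "f j u + of_int (- \<lfloor>f j u\<rfloor>) \<le> 1" by (auto, linarith)
            then show "p \<in> {(y, w). y \<in> X \<and> w \<in> X \<and> 0 \<le> y \<and> y \<le> 1 \<and> Qf y w \<le> 2 * Q \<and> D y < \<epsilon>1}"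
              using X_shift[OF inX(1)[OF jn], of "- \<lfloor>f j u\<rfloor>"] X_shift[OF inX(2)[OF jn], of "- \<lfloor>f j u\<rfloor>"]
                Qf_shift[OF inX(1,2)[OF jn], of "- \<lfloor>f j u\<rfloor>"]
                D_shift[OF inX(1)[OF jn], of "- \<lfloor>f j u\<rfloor>"] f(4)[OF jn] \<epsilon>(2) Qb[OF j(1)]
              unfolding j(2) pr_def mem_Collect_eq prod.case by linarith
          qed
        qed simp
        also have "(\<Sum>(y, w)\<in>pr ` {..m}. D y * D w) = (\<Sum>j\<le>m. D (fst (pr j)) * D (snd (pr j)))"
          using sum.reindex[OF inj, of "\<lambda>(y, w). D y * D w"] by (simp add: case_prod_unfold)
        also have "\<dots> = (\<Sum>j\<le>m. D (f j u) * D (f j w))"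
          using D_shift inX less.prems Suc by (intro sum.cong) (auto simp: pr_def simp del: of_int_minus)
        finally have "(\<Sum>j\<le>m. D (f j u) * D (f j w)) \<le> \<theta>" .
        moreover have "S i \<le> 2 * Q * (\<Sum>j\<le>m. D (f j u) * D (f j w))"
          unfolding S_def Suc lessThan_Suc_atMost sum_distrib_left by (intro sum_mono sq) auto
        moreover have "2 * Q * (\<Sum>j\<le>m. D (f j u) * D (f j w)) \<le> 2 * Q * \<theta>"
          using calculation(1) assms(3) by (intro mult_left_mono) auto
        ultimately have "C * S i \<le> C * (2 * Q * \<theta>)" using C by (intro mult_left_mono) auto
        also have "\<dots> = ln 2" using C assms(3) by (simp add: \<theta>_def)
        finally show ?thesis using 1 by blast
      qed
    qed
    from this[of n] have *: "Qf (F u) (F w) \<le> Qf u w * exp (C * S n)" "C * S n \<le> ln 2" by (auto simp: f)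
    have "exp (C * S n) \<le> 2" using *(2) by (metis exp_le_cancel_iff exp_ln zero_less_numeral)
    then have "Qf u w * exp (C * S n) \<le> Qf u w * 2" using Qf0[OF uw(1,2)] by (intro mult_left_mono)
    then show "Qf (F u) (F w) \<le> 2 * Qf u w" using * by linarith
  qed
qed

end

section \<open>Sequences going to different ends\<close>

text \<open>The fixed point is now \<open>t0\<close> itself, so that \<open>deriv h t0 = 1\<close>
  by \<open>stabilizer_deriv\<close> and \<open>D t0 = 1\<close>.\<close>

locale base_cusp = cusp \<Gamma> t0 h t0 b for \<Gamma> t0 h b
begin

text \<open>The displacement has derivative \<open>1 - deriv h x\<close>, which vanishes at
  \<open>t0\<close> and is continuous.\<close>

lemma displacement_lipschitz:
  assumes "0 < \<kappa>"
  obtains \<rho> where "0 < \<rho>"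
    "\<And>x y. t0 \<le> x \<Longrightarrow> x \<le> y \<Longrightarrow> y \<le> t0 + \<rho> \<Longrightarrow> \<bar>(x - h x) - (y - h y)\<bar> \<le> \<kappa> * (y - x)"
proof -
  have "isCont (deriv h) t0"
    using continuous_deriv[OF h_mem, of UNIV] by (simp add: continuous_on_eq_continuous_at)
  then have "\<exists>d>0. \<forall>x. dist x t0 < d \<longrightarrow> dist (deriv h x) (deriv h t0) < \<kappa>"
    using assms unfolding continuous_at_eps_delta by blast
  then obtain d where d: "d > 0" "\<And>x. \<bar>x - t0\<bar> < d \<Longrightarrow> \<bar>deriv h x - 1\<bar> < \<kappa>"
    using stabilizer_deriv[OF h_mem h_fix] by (auto simp: dist_real_def)
  show thesis
  proof (rule that[of "d / 2"])
    fix x y assume xy: "t0 \<le> x" "x \<le> y" "y \<le> t0 + d / 2"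
    show "\<bar>(x - h x) - (y - h y)\<bar> \<le> \<kappa> * (y - x)"
    proof (cases "x = y")
      case False
      obtain \<xi> where \<xi>: "x < \<xi>" "\<xi> < y" "h y - h x = (y - x) * deriv h \<xi>"
        using lift_mvt[OF h_mem, of x y] xy False by auto
      have "(x - h x) - (y - h y) = (y - x) * (deriv h \<xi> - 1)" using \<xi>(3) by (simp add: algebra_simps)
      also have "\<bar>\<dots>\<bar> = (y - x) * \<bar>deriv h \<xi> - 1\<bar>" using xy by (simp add: abs_mult)
      also have "\<dots> \<le> (y - x) * \<kappa>" using d(2)[of \<xi>] \<xi> xy d(1) by (intro mult_left_mono) auto
      finally show ?thesis by (simp add: mult.commute)
    qed simp
  qed (use d in simp)
qed

text \<open>The base point itself can be a neighbour (when \<open>h\<close> has nonzero second derivative there), hence the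
  premise \<open>t0 < w\<close> in the second estimate.\<close>

lemma left_neighbour_bound:
  assumes C: "1 \<le> C" "\<And>w. w \<in> X \<Longrightarrow> t0 < w \<Longrightarrow> w \<le> b \<Longrightarrow> D w \<le> C * (w - h w)"
    and c: "0 < c" "\<And>u v. u \<in> X \<Longrightarrow> v \<in> X \<Longrightarrow> u < v \<Longrightarrow> c * min (D u) (D v) \<le> v - u"
    and y: "y \<in> X" "t0 < y" "y \<le> b" "D y \<le> C * d * (y - h y)" "0 < d" "d \<le> 1"
    and lip: "\<And>x. t0 \<le> x \<Longrightarrow> x \<le> y \<Longrightarrow> \<bar>(x - h x) - (y - h y)\<bar> \<le> \<kappa> * (y - x)"
    and \<kappa>: "0 < \<kappa>" "(\<kappa> * C)^2 * Q \<le> 1" "\<kappa> * C * Q < c" "0 < Q"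
    and w: "w \<in> X" "w < y" "Qf y w \<le> Q"
  shows "t0 \<le> w" "t0 < w \<Longrightarrow> y - w \<le> 2 * C * sqrt (Qf y w * d) * (y - h y)"
proof -
  define l where "l = y - h y"
  have l: "0 < l" using h_less y by (simp add: l_def)
  define x where "x = y - w"
  have x: "0 < x" using w by (simp add: x_def)
  have Dpos: "0 < D y" "0 < D w" using D_pos y w by auto
  have xx: "x^2 = Qf y w * D y * D w" using Dpos by (simp add: x_def Qf_def)
  have Q0: "0 \<le> Qf y w" unfolding Qf_def using Dpos by simp
  have Dy: "D y \<le> C * d * l" using y by (simp add: l_def)
  show "t0 \<le> w"
  proof (rule ccontr)
    assume "\<not> t0 \<le> w"
    then have wt: "w < t0" by simp
    \<comment> \<open>Separation from \<open>t0\<close>, where \<open>D\<close> is 1, bounds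
      \<open>D w\<close> by \<open>x / c\<close>, and the formula for \<open>Qf\<close> then bounds
      \<open>x\<close> by a multiple of the displacement \<open>l\<close>. As the displacement
      vanishes at \<open>t0\<close>, \<open>l \<le> \<kappa> * (y - t0)\<close>, which for small
      \<kappa> gives \<open>x \<le> y - t0\<close>.\<close>
    have "c * D w \<le> t0 - w" using c(2)[OF w(1) t0_mem wt] D_le_1[OF w(1)] D_t0 by (simp add: min_def)
    then have "D w \<le> x / c" using c y by (simp add: x_def field_simps)
    then have "x^2 \<le> Q * (C * d * l) * (x / c)"
      unfolding xx using w Q0 Dy Dpos by (intro mult_mono) auto
    also have "\<dots> \<le> Q * (C * 1 * l) * (x / c)"
      using y \<kappa> C l x c by (intro mult_left_mono mult_right_mono) auto
    finally have "x * x \<le> (Q * C * l / c) * x" by (simp add: power2_eq_square mult_ac)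
    then have "x \<le> Q * C * l / c" using x by (simp only: mult_le_cancel_right_pos)
    also have "\<dots> \<le> Q * C * (\<kappa> * (y - t0)) / c"
      using lip[of t0] y h_fix \<kappa> C c by (intro divide_right_mono mult_left_mono) (auto simp: l_def)
    also have "\<dots> = \<kappa> * C * Q / c * (y - t0)" by simp
    also have "\<dots> \<le> 1 * (y - t0)" using \<kappa>(3) c y by (intro mult_right_mono) auto
    finally show False using wt by (simp add: x_def)
  qed
  assume wt: "t0 < w"
  define A where "A = (C * sqrt (Qf y w * d))^2"
  have A: "A = C * C * Qf y w * d" using Q0 y by (simp add: A_def power2_eq_square)
  have sA: "sqrt A = C * sqrt (Qf y w * d)" using C Q0 y by (simp add: A_def)
  have Iw: "w - h w \<le> l + \<kappa> * x" using lip[of w] wt w by (auto simp: l_def x_def abs_le_iff)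
  have "D w \<le> C * (w - h w)" using C w wt y by auto
  also have "\<dots> \<le> C * (l + \<kappa> * x)" using Iw C by (intro mult_left_mono) auto
  finally have Dw: "D w \<le> C * (l + \<kappa> * x)" .
  have "x^2 \<le> Qf y w * (C * d * l) * (C * (l + \<kappa> * x))"
    unfolding xx using Q0 Dy Dw Dpos by (intro mult_mono) auto
  also have "\<dots> = A * l * l + A * \<kappa> * l * x" unfolding A by (simp add: algebra_simps)
  finally have le: "x^2 \<le> A * l * l + A * \<kappa> * l * x" .
  have A0: "0 \<le> A" by (simp add: A_def)
  have "A * \<kappa>^2 = (\<kappa> * C)^2 * Qf y w * d" unfolding A by (simp add: power2_eq_square algebra_simps)
  also have "\<dots> \<le> (\<kappa> * C)^2 * Q * 1" using w y Q0 \<kappa> by (intro mult_mono) auto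
  finally have "A * \<kappa>^2 \<le> 1" using \<kappa> by linarith
  then have "sqrt (A * \<kappa>^2) \<le> 1" by simp
  then have k1: "sqrt A * \<kappa> \<le> 1" using \<kappa> by (simp add: real_sqrt_mult)
  \<comment> \<open>If \<open>x\<close> were larger, the two terms on the right of \<open>le\<close>
    would be at most a quarter and a half of \<open>x^2\<close>.\<close>
  have "x \<le> 2 * sqrt A * l"
  proof (rule ccontr)
    assume "\<not> x \<le> 2 * sqrt A * l"
    then have g: "sqrt A * l < x / 2" by simp
    have sl: "0 \<le> sqrt A * l" using A0 l by simp
    have "A * l * l = (sqrt A * l) * (sqrt A * l)"
      using A0 by (metis mult.assoc mult.left_commute real_sqrt_mult_self abs_of_nonneg)
    also have "\<dots> \<le> (x / 2) * (x / 2)" using g sl by (intro mult_mono) auto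
    finally have 1: "A * l * l \<le> x^2 / 4" by (simp add: power2_eq_square)
    have "A * \<kappa> * l * x = (sqrt A * \<kappa>) * (sqrt A * l) * x"
      using A0 by (simp add: mult.left_commute mult.assoc flip: mult.assoc[of "sqrt A" "sqrt A"])
    also have "\<dots> \<le> 1 * (x / 2) * x" using k1 g sl x \<kappa> A0 by (intro mult_mono) auto
    finally have "A * \<kappa> * l * x \<le> x^2 / 2" by (simp add: power2_eq_square)
    then have "x^2 \<le> x^2 / 4 + x^2 / 2" using 1 le by linarith
    moreover have "0 < x^2" using x by simp
    ultimately show False by simp
  qed
  then show "y - w \<le> 2 * C * sqrt (Qf y w * d) * (y - h y)" unfolding sA x_def l_def by (simp add: mult_ac)
qed

text \<open>During the first \<open>M\<close> iterates the displacement changes by at most half of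
  \<open>y - h y\<close>, so every step has between 1/2 and 3/2 of the original length.\<close>

lemma iterate_gaps:
  assumes y: "t0 < y" "y \<le> b"
    and lip: "\<And>x. t0 \<le> x \<Longrightarrow> x \<le> y \<Longrightarrow> \<bar>(x - h x) - (y - h y)\<bar> \<le> \<kappa> * (y - x)"
    and \<kappa>: "0 < \<kappa>" "\<kappa> * (3 * real M) \<le> 1"
  shows "j \<le> M \<Longrightarrow> real j * (y - h y) / 2 \<le> y - (h ^^ j) y \<and> y - (h ^^ j) y \<le> 3 * real j * (y - h y) / 2"
proof (induction j)
  case 0
  then show ?case by simp
next
  case (Suc j)
  define l where "l = y - h y"
  have l: "0 < l" using h_less y by (simp add: l_def)
  define e where "e = y - (h ^^ j) y"
  have e: "real j * l / 2 \<le> e" "e \<le> 3 * real j * l / 2" using Suc by (auto simp: l_def e_def)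
  have "\<kappa> * e \<le> \<kappa> * (3 * real j * l / 2)" using e \<kappa> by (intro mult_left_mono) auto
  also have "\<dots> = \<kappa> * (3 * real j) * (l / 2)" by simp
  also have "\<dots> \<le> \<kappa> * (3 * real M) * (l / 2)"
    using Suc.prems \<kappa> l by (intro mult_right_mono mult_left_mono) auto
  also have "\<dots> \<le> 1 * (l / 2)" using \<kappa> l by (intro mult_right_mono) auto
  finally have "\<kappa> * e \<le> l / 2" by simp
  moreover have "\<bar>((h ^^ j) y - h ((h ^^ j) y)) - l\<bar> \<le> \<kappa> * e"
    using lip[of "(h ^^ j) y"] it_gt[OF y(1), of j] it_le[OF y, of j] by (simp add: l_def e_def)
  ultimately have "l / 2 \<le> (h ^^ j) y - h ((h ^^ j) y)" "(h ^^ j) y - h ((h ^^ j) y) \<le> 3 * l / 2"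
    by (auto simp: abs_le_iff)
  moreover have "y - (h ^^ Suc j) y = e + ((h ^^ j) y - h ((h ^^ j) y))" by (simp add: e_def)
  ultimately have "l / 2 + real j * l / 2 \<le> y - (h ^^ Suc j) y \<and> y - (h ^^ Suc j) y \<le> 3 * real j * l / 2 + 3 * l / 2"
    using e by linarith
  then show ?case unfolding l_def[symmetric] by (simp add: algebra_simps add_divide_distrib)
qed

text \<open>\<open>p\<close> and \<open>q\<close> lie in the same fundamental domain, so
  \<open>w\<close> is trapped between \<open>(h ^^ Suc m) y\<close> and
  \<open>(h ^^ (m - 1)) y\<close>. The reference point \<open>q\<close> allows \<open>D w\<close> to
  be bounded below by a multiple of \<open>l * D q\<close>, independently of
  \<open>p\<close>.\<close>

lemma iterate_neighbours:
  assumes C: "1 \<le> C" "\<And>n x. x \<in> {h b..b} \<Longrightarrow> deriv (h ^^ n) x \<le> C * ((h ^^ n) x - h ((h ^^ n) x))"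
      "\<And>n x. x \<in> {h b..b} \<Longrightarrow> (h ^^ n) x - h ((h ^^ n) x) \<le> C * deriv (h ^^ n) x"
    and p: "p \<in> X" "h b < p" "p \<le> b" and q: "q \<in> X" "h b < q" "q \<le> b"
    and y: "y = (h ^^ n) p"
    and lip: "\<And>x. t0 \<le> x \<Longrightarrow> x \<le> y \<Longrightarrow> \<bar>(x - h x) - (y - h y)\<bar> \<le> \<kappa> * (y - x)"
    and \<kappa>: "0 < \<kappa>" "\<kappa> * (6 * real (M + 1)) \<le> 1"
    and m: "2 \<le> m" "m \<le> M"
  defines "w \<equiv> (h ^^ m) ((h ^^ n) q)"
  shows "real m * (y - h y) / 4 \<le> y - w"
    and "Qf y w \<le> 18 * C^2 / D q * (real m)^2 / D p"
proof -
  have hb: "t0 < h b" "h b < b" using it_gt[OF z_less_b, of 1] h_less[OF z_less_b] by auto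
  have y0: "t0 < y" "y \<le> b" unfolding y using it_gt[of p n] it_le[of p n] p hb by auto
  define l where "l = y - h y"
  have l: "0 < l" using h_less y0 by (simp add: l_def)
  \<comment> \<open>\<open>iterate_gaps\<close> is needed up to index \<open>m + 1\<close>; the
    factor 6 in the hypothesis also keeps the displacement at \<open>w\<close> above
    \<open>l / 2\<close>, since \<open>y - w \<le> 3 * m * l\<close>.\<close>
  have "\<kappa> * (3 * real (M + 1)) = \<kappa> * (6 * real (M + 1)) / 2" by simp
  then have \<kappa>M: "\<kappa> * (3 * real (M + 1)) \<le> 1" using \<kappa>(2) by linarith
  note gaps = iterate_gaps[OF y0 lip \<kappa>(1) \<kappa>M, unfolded l_def[symmetric]]
  have "h y \<le> (h ^^ n) (h b)" unfolding y using p lift_le_iff[OF comp_mem[OF h_mem it_mem[of n]], of p b]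
    by (simp add: funpow_swap1)
  also have "\<dots> < (h ^^ n) q" using q lift_less_iff[OF it_mem] by blast
  finally have "(h ^^ m) (h y) < w" unfolding w_def using lift_less_iff[OF it_mem] by blast
  then have lo: "(h ^^ Suc m) y < w" by (simp add: funpow_swap1)
  have "h ((h ^^ n) q) \<le> (h ^^ n) (h b)" using q lift_le_iff[OF comp_mem[OF h_mem it_mem[of n]], of q b]
    by (simp add: funpow_swap1)
  also have "\<dots> < y" unfolding y using p lift_less_iff[OF it_mem] by blast
  finally have "(h ^^ (m - 1)) (h ((h ^^ n) q)) < (h ^^ (m - 1)) y" using lift_less_iff[OF it_mem] by blast
  moreover have "w = (h ^^ (m - 1)) (h ((h ^^ n) q))"
    using m unfolding w_def by (cases m) (auto simp: funpow_swap1)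
  ultimately have hi: "w < (h ^^ (m - 1)) y" by simp
  have x1: "real (m - 1) * l / 2 < y - w" using gaps[of "m - 1"] hi m by linarith
  have x2: "y - w < 3 * real (Suc m) * l / 2" using gaps[of "Suc m"] lo m by linarith
  have "real m * l / 4 \<le> real (m - 1) * l / 2" using m l by (simp add: field_simps of_nat_diff)
  then show "real m * (y - h y) / 4 \<le> y - w" using x1 by (simp add: l_def)
  have "3 * real (Suc m) * l / 2 \<le> 3 * real m * l" using m l by (simp add: field_simps)
  then have x3: "y - w \<le> 3 * real m * l" using x2 by linarith
  have xpos: "0 < y - w" using x1 l by (smt (verit) divide_nonneg_nonneg mult_nonneg_nonneg of_nat_0_le_iff)
  have tw: "t0 < w" unfolding w_def by (intro it_gt) (use q hb in linarith)
  have "\<kappa> * (y - w) \<le> \<kappa> * (3 * real m * l)" using x3 \<kappa> by (intro mult_left_mono) auto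
  also have "\<dots> = \<kappa> * (6 * real m) * (l / 2)" by simp
  also have "\<dots> \<le> \<kappa> * (6 * real (M + 1)) * (l / 2)" using m \<kappa> l by (intro mult_right_mono mult_left_mono) auto
  also have "\<dots> \<le> 1 * (l / 2)" using \<kappa> l by (intro mult_right_mono) auto
  finally have Iw: "l / 2 \<le> w - h w" using lip[of w] tw xpos by (auto simp: l_def abs_le_iff)
  have dq: "0 < D q" "0 < D p" using D_pos p q by auto
  have wq: "w = (h ^^ (m + n)) q" by (simp add: w_def funpow_add)
  have "l / 2 \<le> C * deriv (h ^^ (m + n)) q" using Iw C(3)[of q "m + n"] q by (simp add: wq)
  then have "l / 2 * D q \<le> C * deriv (h ^^ (m + n)) q * D q" using dq by (intro mult_right_mono) auto
  then have Dw: "l / 2 * D q \<le> C * D w" using D_comp[OF q(1) it_mem] by (simp add: wq mult.assoc)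
  have "l \<le> C * deriv (h ^^ n) p" using C(3)[of p n] p by (simp add: l_def y)
  then have "l * D p \<le> C * deriv (h ^^ n) p * D p" using dq by (intro mult_right_mono) auto
  then have Dy: "l * D p \<le> C * D y" using D_comp[OF p(1) it_mem] by (simp add: y mult.assoc)
  have yX: "y \<in> X" "w \<in> X" using X_lift it_mem p q by (auto simp: y wq)
  have "(l * D p) * (l / 2 * D q) \<le> (C * D y) * (C * D w)"
    using C(1) D_pos[OF yX(1)] l dq by (intro mult_mono[OF Dy Dw]) auto
  then have prod: "l^2 * (D p * D q) \<le> 2 * C^2 * (D y * D w)" by (simp add: power2_eq_square mult_ac)
  have "(y - w)^2 \<le> (3 * real m * l)^2" using x3 xpos by (intro power_mono) auto
  also have "\<dots> = 9 * (real m)^2 / (D p * D q) * (l^2 * (D p * D q))" using dq by (simp add: power_mult_distrib)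
  also have "\<dots> \<le> 9 * (real m)^2 / (D p * D q) * (2 * C^2 * (D y * D w))"
    using prod dq by (intro mult_left_mono) auto
  also have "\<dots> = 18 * C^2 / D q * (real m)^2 / D p * (D y * D w)" by (simp add: mult_ac)
  finally show "Qf y w \<le> 18 * C^2 / D q * (real m)^2 / D p" using Qf_le_iff[OF yX] by blast
qed

end

context base_cusp begin

text \<open>The scale ratio \<open>s = sqrt (D p / D p')\<close> is bounded: the neighbours \<open>(h ^^ m) ((h ^^ n) q)\<close> of
  \<open>y\<close>, for \<open>m\<close> between \<open>m0\<close> and \<open>2 * m0\<close> with \<open>m0\<close> of the order of \<open>s\<close>, are sent to points of
  derivative at least of the order of \<open>l'\<close> in an interval of length of the order of \<open>l'\<close>. Two points
  \<open>z' 2\<close> and \<open>z' 3\<close> are pulled back, and the points \<open>z m\<close> are pushed forward up to \<open>m = 2 * m0 + 1\<close>,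
  because the extreme one may land on the base point.\<close>

lemma neighbour_transport_bound:
  obtains \<Lambda> where "1 \<le> \<Lambda>"
    "\<And>p p'. p \<in> X \<Longrightarrow> h b < p \<Longrightarrow> p \<le> b \<Longrightarrow> p' \<in> X \<Longrightarrow> h b < p' \<Longrightarrow> p' \<le> b \<Longrightarrow> \<Lambda> * D p' \<le> D p \<Longrightarrow>
      \<exists>Q>0. \<exists>n0. \<forall>n\<ge>n0. \<forall>n'\<ge>n0. \<forall>F\<in>\<Gamma>. \<forall>H\<in>\<Gamma>. (\<forall>t. H (F t) = t) \<longrightarrow> (\<forall>t. F (H t) = t) \<longrightarrow>
        F ((h ^^ n) p) = (h ^^ n') p' \<longrightarrow>
        at_most_doubles Q F ((h ^^ n) p) \<longrightarrow> \<not> at_most_doubles Q H ((h ^^ n') p')"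
proof -
  obtain c where c: "0 < c" "\<And>u v. u\<in>X \<Longrightarrow> v\<in>X \<Longrightarrow> u < v \<Longrightarrow> c * min (D u) (D v) \<le> v - u"
    using separation by blast
  obtain C1 where C1: "1 \<le> C1" "\<And>w. w \<in> X \<Longrightarrow> t0 < w \<Longrightarrow> w \<le> b \<Longrightarrow> D w \<le> C1 * (w - h w)"
    using D_le_displacement by blast
  obtain C2 where C2: "1 \<le> C2" "\<And>n x. x \<in> {h b..b} \<Longrightarrow> deriv (h ^^ n) x \<le> C2 * ((h ^^ n) x - h ((h ^^ n) x))"
      "\<And>n x. x \<in> {h b..b} \<Longrightarrow> (h ^^ n) x - h ((h ^^ n) x) \<le> C2 * deriv (h ^^ n) x"
    using it_deriv_displacement by blast
  define C where "C = max C1 C2"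
  have CC: "1 \<le> C" "C1 \<le> C" "C2 \<le> C" using C1 by (auto simp: C_def)
  have hb: "t0 < h b" "h b < b" using it_gt[OF z_less_b, of 1] h_less[OF z_less_b] by auto
  have disp: "0 \<le> x - h x" if "t0 < x" "x \<le> b" for x using h_less[OF that] by simp
  have in_b: "t0 < (h ^^ n) x" "(h ^^ n) x \<le> b" if "x \<in> {h b..b}" for x n
    using it_gt[of x n] it_le[of x n] that hb by auto
  have CD: "D w \<le> C * (w - h w)" if "w \<in> X" "t0 < w" "w \<le> b" for w
    using C1(2)[OF that] mult_right_mono[OF CC(2) disp[OF that(2,3)]] by linarith
  have Cup: "deriv (h ^^ n) x \<le> C * ((h ^^ n) x - h ((h ^^ n) x))" if "x \<in> {h b..b}" for n x
    using C2(2)[OF that, of n] mult_right_mono[OF CC(3) disp[OF in_b[OF that, of n]]] by linarith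
  have Clo: "(h ^^ n) x - h ((h ^^ n) x) \<le> C * deriv (h ^^ n) x" if "x \<in> {h b..b}" for n x
    using C2(3)[OF that, of n] mult_right_mono[OF CC(3), of "deriv (h ^^ n) x"] deriv_pos[OF it_mem, of n x] by linarith
  \<comment> \<open>Fixed before \<open>p\<close> and \<open>p'\<close>, so that \<open>K\<close>,
    and with it \<Lambda>, does not depend on them.\<close>
  obtain q where q: "q \<in> X" "h b < q" "q \<le> b" using dense_X[OF hb(2)] by auto
  define K where "K = 18 * C^2 / D q"
  have K: "1 \<le> K"
  proof -
    have "1 \<le> C^2" using CC(1) by simp
    then show ?thesis unfolding K_def using D_pos[OF q(1)] D_le_1[OF q(1)] by (simp add: field_simps)
  qed
  \<comment> \<open>\<open>W * s\<close> bounds \<open>m0\<close>. In units of \<open>l'\<close>,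
    \<open>L\<close> bounds the distance of the transported points from \<open>y'\<close>, and
    \<tau> bounds their \<open>D\<close> from below.\<close>
  define W where "W = 8 * C * sqrt (18 * K) + 3"
  define L where "L = 4 * C * sqrt (2 * K) * W"
  define \<tau> where "\<tau> = 1 / (32 * C * K * W^2)"
  have W: "3 \<le> W" using CC K by (simp add: W_def)
  have L: "0 < L" using CC K W by (simp add: L_def)
  have \<tau>: "0 < \<tau>" using CC K W by (simp add: \<tau>_def)
  \<comment> \<open>At most \<open>L / (c * \<tau>) + 1\<close> points fit under these bounds,
    whereas \<open>m0 + 1\<close> of them are produced with \<open>m0 \<ge> s\<close>; this
    \<Lambda> forces \<open>s \<ge> L / (c * \<tau>) + 1\<close>.\<close>
  define \<Lambda> where "\<Lambda> = (L / (c * \<tau>) + 1)^2"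
  have \<Lambda>1: "1 \<le> L / (c * \<tau>) + 1" using L c \<tau> by simp
  have \<Lambda>: "1 \<le> \<Lambda>" using \<Lambda>1 unfolding \<Lambda>_def by (rule one_le_power)
  show thesis
  proof (rule that[OF \<Lambda>])
    fix p p' assume p: "p \<in> X" "h b < p" "p \<le> b" and p': "p' \<in> X" "h b < p'" "p' \<le> b" and \<Lambda>p: "\<Lambda> * D p' \<le> D p"
    define d d' where "d = D p" and "d' = D p'"
    have d: "0 < d" "d \<le> 1" "0 < d'" "d' \<le> 1" using D_pos D_le_1 p p' by (auto simp: d_def d'_def)
    define s where "s = sqrt (d / d')"
    have s2: "s^2 = d / d'" using d by (simp add: s_def)
    have "L / (c * \<tau>) + 1 = sqrt \<Lambda>" using \<Lambda>1 by (simp add: \<Lambda>_def)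
    also have "\<dots> \<le> s" unfolding s_def using \<Lambda>p d by (intro real_sqrt_le_mono) (simp add: field_simps d_def d'_def)
    finally have s: "L / (c * \<tau>) + 1 \<le> s" .
    have s1: "1 \<le> s" using s \<Lambda>1 by linarith
    define a where "a = 2 * C * sqrt (18 * K) * s"
    have a: "0 < a" using CC K s1 by (simp add: a_def)
    \<comment> \<open>The point pulled back from \<open>z' 2\<close> will be within
      \<open>a * l\<close> of \<open>y\<close>, and \<open>z m\<close> is at least
      \<open>m * l / 4\<close> away; so \<open>m \<ge> 4 * a\<close> puts \<open>z m\<close> on its
      far side. Adding 2 ensures \<open>m \<ge> 2\<close> for
      \<open>iterate_neighbours\<close>.\<close>
    define m0 where "m0 = nat \<lceil>4 * a\<rceil> + 2"
    have m0: "4 * a \<le> real m0" "real m0 \<le> 4 * a + 3" "2 \<le> m0" using a by (auto simp: m0_def) linarith+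
    have "3 * 1 \<le> 3 * s" using s1 by simp
    then have m0W: "real m0 \<le> W * s" using m0(2) by (simp add: a_def W_def algebra_simps)
    define M where "M = 2 * m0 + 3"
    \<comment> \<open>Large enough for the points pulled back from \<open>y'\<close>, whose
      \<open>Qf\<close> is doubled from \<open>9 * K / d'\<close>, and for those pushed forward with
      indices up to \<open>M\<close>.\<close>
    define Q where "Q = 18 * K / d' + 2 * (K * (real M)^2 / d)"
    have Qge: "18 * K / d' \<le> Q" "2 * (K * (real M)^2 / d) \<le> Q" using K d by (auto simp: Q_def)
    have Qpos: "0 < Q" using K d by (auto simp: Q_def intro!: add_pos_nonneg)
    \<comment> \<open>It depends on \<open>Q\<close> and \<open>M\<close>, hence on \<open>p\<close>
      and \<open>p'\<close>; so do \<rho> and \<open>n0\<close>, while \<Lambda> was fixed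
      before.\<close>
    define \<kappa> where "\<kappa> = min (1 / (C * (Q + 1))) (min (c / (2 * C * Q)) (1 / (6 * real (M + 1))))"
    have \<kappa>0: "0 < \<kappa>" using CC Qpos c by (simp add: \<kappa>_def)
    have \<kappa>3: "\<kappa> * (6 * real (M + 1)) \<le> 1"
    proof -
      have "\<kappa> \<le> 1 / (6 * real (M + 1))" by (simp add: \<kappa>_def)
      then show ?thesis by (simp add: field_simps)
    qed
    have \<kappa>2: "\<kappa> * C * Q < c"
    proof -
      have "\<kappa> \<le> c / (2 * C * Q)" by (simp add: \<kappa>_def)
      then have "\<kappa> * (2 * C * Q) \<le> c" using CC Qpos by (simp add: pos_le_divide_eq)
      moreover have "\<kappa> * (2 * C * Q) = 2 * (\<kappa> * C * Q)" by simp
      moreover have "0 < \<kappa> * C * Q" using \<kappa>0 CC Qpos by simp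
      ultimately show ?thesis by linarith
    qed
    have \<kappa>1: "(\<kappa> * C)^2 * Q \<le> 1"
    proof -
      have "\<kappa> \<le> 1 / (C * (Q + 1))" by (simp add: \<kappa>_def)
      moreover have "0 < C * (Q + 1)" using CC Qpos by simp
      ultimately have "\<kappa> * (C * (Q + 1)) \<le> 1" by (simp only: pos_le_divide_eq)
      then have "\<kappa> * C \<le> 1 / (Q + 1)" using Qpos by (simp add: pos_le_divide_eq mult.assoc)
      then have "(\<kappa> * C)^2 \<le> (1 / (Q + 1))^2" using \<kappa>0 CC by (intro power_mono) auto
      then have "(\<kappa> * C)^2 * Q \<le> (1 / (Q + 1))^2 * Q" using Qpos by (intro mult_right_mono) auto
      also have "\<dots> \<le> (1 / (Q + 1))^2 * (Q + 1)^2" using Qpos by (intro mult_left_mono) (auto simp: power2_eq_square algebra_simps)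
      also have "\<dots> = 1" using Qpos by (simp add: power_divide)
      finally show ?thesis .
    qed
    obtain \<rho> where \<rho>: "0 < \<rho>"
      "\<And>x y. t0 \<le> x \<Longrightarrow> x \<le> y \<Longrightarrow> y \<le> t0 + \<rho> \<Longrightarrow> \<bar>(x - h x) - (y - h y)\<bar> \<le> \<kappa> * (y - x)"
      using displacement_lipschitz[OF \<kappa>0] by blast
    have "\<forall>\<^sub>F n in sequentially. (h ^^ n) b < t0 + \<rho>" by (rule order_tendstoD(2)[OF it_b_tendsto]) (use \<rho> in auto)
    then obtain n0 where n0: "\<And>n. n \<ge> n0 \<Longrightarrow> (h ^^ n) b < t0 + \<rho>" unfolding eventually_sequentially by blast
    have small: "(h ^^ n) x \<le> t0 + \<rho>" if "n \<ge> n0" "x \<le> b" for n x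
      using n0[OF that(1)] that(2) lift_le_iff[OF it_mem, of n x b] by linarith
    have contr: False
      if n: "n \<ge> n0" "n' \<ge> n0" and F: "F \<in> \<Gamma>" "H \<in> \<Gamma>" "\<And>t. H (F t) = t" "\<And>t. F (H t) = t" "F y = y'"
        and y_def: "y = (h ^^ n) p" and y'_def: "y' = (h ^^ n') p'"
        and FH: "at_most_doubles Q F y" "at_most_doubles Q H y'"
      for n n' F H y y'
    proof -
      note FQ = FH(1)[unfolded at_most_doubles_def, rule_format]
        and HQ = FH(2)[unfolded at_most_doubles_def, rule_format]
      have Hy: "H y' = y" using F by metis
      have yb: "t0 < y" "y \<le> b" "t0 < y'" "y' \<le> b" unfolding y_def y'_def using in_b p p' by auto
      have yX: "y \<in> X" "y' \<in> X" unfolding y_def y'_def using X_lift it_mem p p' by auto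
      have lip: "\<bar>(x - h x) - (y - h y)\<bar> \<le> \<kappa> * (y - x)" if "t0 \<le> x" "x \<le> y" for x
        using \<rho>(2)[OF that] small[OF n(1) p(3)] by (simp add: y_def)
      have lip': "\<bar>(x - h x) - (y' - h y')\<bar> \<le> \<kappa> * (y' - x)" if "t0 \<le> x" "x \<le> y'" for x
        using \<rho>(2)[OF that] small[OF n(2) p'(3)] by (simp add: y'_def)
      define l l' where "l = y - h y" and "l' = y' - h y'"
      have l: "0 < l" "0 < l'" using h_less yb by (auto simp: l_def l'_def)
      have Dy: "D y \<le> C * d * (y - h y)" "D y' \<le> C * d' * (y' - h y')"
        using Cup[of p n] Cup[of p' n'] p p' D_comp[OF p(1) it_mem, of n] D_comp[OF p'(1) it_mem, of n'] d
          mult_right_mono[of "deriv (h ^^ n) p" _ d] mult_right_mono[of "deriv (h ^^ n') p'" _ d']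
        by (auto simp: y_def y'_def d_def d'_def mult_ac)
      have U1: "t0 \<le> w" if "w \<in> X" "w < y" "Qf y w \<le> Q" for w
        by (rule left_neighbour_bound(1)[of C c y d \<kappa> Q w]; fact)
      have U2: "y - w \<le> 2 * C * sqrt (Qf y w * d) * l" if "w \<in> X" "w < y" "Qf y w \<le> Q" "t0 < w" for w
        unfolding l_def by (rule left_neighbour_bound(2)[of C c y d \<kappa> Q w]; fact)
      have U1': "t0 \<le> w" if "w \<in> X" "w < y'" "Qf y' w \<le> Q" for w
        by (rule left_neighbour_bound(1)[of C c y' d' \<kappa> Q w]; fact)
      have U2': "y' - w \<le> 2 * C * sqrt (Qf y' w * d') * l'" if "w \<in> X" "w < y'" "Qf y' w \<le> Q" "t0 < w" for w
        unfolding l'_def by (rule left_neighbour_bound(2)[of C c y' d' \<kappa> Q w]; fact)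
      define z where "z m = (h ^^ m) ((h ^^ n) q)" for m
      define z' where "z' m = (h ^^ m) ((h ^^ n') q)" for m
      have zX: "z m \<in> X" "z' m \<in> X" for m unfolding z_def z'_def using X_lift it_mem q by auto
      have z: "real m * l / 4 \<le> y - z m" "Qf y (z m) \<le> K * (real m)^2 / d" if "2 \<le> m" "m \<le> M" for m
        using iterate_neighbours[OF CC(1) Cup Clo p q y_def lip \<kappa>0 \<kappa>3 that]
        by (auto simp: z_def K_def l_def d_def)
      have z': "real m * l' / 4 \<le> y' - z' m" "Qf y' (z' m) \<le> K * (real m)^2 / d'" if "2 \<le> m" "m \<le> M" for m
        using iterate_neighbours[OF CC(1) Cup Clo p' q y'_def lip' \<kappa>0 \<kappa>3 that]
        by (auto simp: z'_def K_def l'_def d'_def)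
      have zlt: "z m < y" if "2 \<le> m" "m \<le> M" for m
        using z(1)[OF that] l that by (smt (verit) divide_pos_pos mult_pos_pos of_nat_0_less_iff not_numeral_le_zero gr0I)
      have z'lt: "z' m < y'" if "2 \<le> m" "m \<le> M" for m
        using z'(1)[OF that] l that by (smt (verit) divide_pos_pos mult_pos_pos of_nat_0_less_iff not_numeral_le_zero gr0I)
      have zdec: "z (Suc m) < z m" "z' (Suc m) < z' m" for m
        unfolding z_def z'_def using h_less[OF in_b[of "(h ^^ _) q", folded funpow_add]]
          h_less[OF in_b, of q "m + n"] h_less[OF in_b, of q "m + n'"] q by (auto simp: funpow_add)
      have zanti: "z j < z i" if "i < j" for i j
        using lift_Suc_mono_less[of "\<lambda>m. - z m" i j] zdec that by simp
      have pull: "Qf y (H (z' m)) \<le> 18 * K / d'" "H (z' m) < y" "H (z' m) \<in> X" if "m = 2 \<or> m = 3" for m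
      proof -
        have m: "2 \<le> m" "m \<le> M" "real m \<le> 3" using that by (auto simp: M_def)
        have "(real m)^2 \<le> 3^2" using m by (intro power_mono) auto
        then have "K * (real m)^2 / d' \<le> K * 9 / d'" using K d by (intro divide_right_mono mult_left_mono) auto
        then have Q9: "Qf y' (z' m) \<le> 9 * K / d'" using z'(2)[OF m(1,2)] by (simp add: mult.commute)
        have "0 \<le> 9 * K / d'" using K d by simp
        then have "Qf y' (z' m) \<le> Q" using Q9 Qge(1) by simp
        then have "Qf y (H (z' m)) \<le> 2 * Qf y' (z' m)" using HQ[OF zX(2), of m] z'lt[OF m(1,2)] Hy by simp
        then show "Qf y (H (z' m)) \<le> 18 * K / d'" using Q9 by simp
        show "H (z' m) < y" using z'lt[OF m(1,2)] lift_less_iff[OF F(2)] Hy by metis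
        show "H (z' m) \<in> X" using X_lift[OF zX(2) F(2)] .
      qed
      define v where "v = H (z' 2)"
      have "t0 \<le> H (z' 3)" using U1[of "H (z' 3)"] pull[of 3] Qge(1) by simp
      also have "H (z' 3) < v" unfolding v_def using lift_less_iff[OF F(2)] zdec(2)[of 2] by (simp add: numeral_3_eq_3 numeral_2_eq_2)
      finally have "t0 < v" .
      then have "y - v \<le> 2 * C * sqrt (Qf y v * d) * l" using U2[of v] pull[of 2] Qge(1) by (simp add: v_def)
      also have "\<dots> \<le> 2 * C * sqrt (18 * K / d' * d) * l"
        using pull(1)[of 2] d CC l by (intro mult_right_mono mult_left_mono real_sqrt_le_mono) (auto simp: v_def)
      also have "18 * K / d' * d = 18 * K * (d / d')" by simp
      also have "2 * C * sqrt (18 * K * (d / d')) * l = a * l" unfolding real_sqrt_mult a_def s_def by simp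
      finally have yv: "y - v \<le> a * l" .
      \<comment> \<open>This keeps the images away from \<open>y'\<close>, at distance at least
        \<open>l' / 2\<close>, as \<open>z' 2\<close> is that far.\<close>
      have Fz: "F (z m) \<le> z' 2" if "m0 \<le> m" "m \<le> M" for m
      proof -
        have "4 * a \<le> real m" using m0(1) that by linarith
        then have "a * l \<le> real m * l / 4" using mult_right_mono[of "4 * a" "real m" l] l by simp
        also have "\<dots> \<le> y - z m" using z(1)[of m] that m0(3) by auto
        finally have "z m \<le> v" using yv by simp
        then show ?thesis using lift_le_iff[OF F(1)] F(4) unfolding v_def by metis
      qed
      have push: "Qf y' (F (z m)) \<le> 2 * (K * (real m)^2 / d)" "F (z m) < y'" "F (z m) \<in> X" "Qf y' (F (z m)) \<le> Q"
        if "m0 \<le> m" "m \<le> M" for m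
      proof -
        have m: "2 \<le> m" using that m0(3) by simp
        have "(real m)^2 \<le> (real M)^2" using that by (intro power_mono) auto
        then have le: "K * (real m)^2 / d \<le> K * (real M)^2 / d" using K d by (intro divide_right_mono mult_left_mono) auto
        have "0 \<le> K * (real M)^2 / d" using K d by simp
        then have "Qf y (z m) \<le> Q" using z(2)[OF m that(2)] le Qge(2) by linarith
        then have "Qf y' (F (z m)) \<le> 2 * Qf y (z m)" using FQ[OF zX(1), of m] zlt[OF m that(2)] F(5) by simp
        then show "Qf y' (F (z m)) \<le> 2 * (K * (real m)^2 / d)" using z(2)[OF m that(2)] by linarith
        then show "Qf y' (F (z m)) \<le> Q" using le Qge(2) by linarith
        show "F (z m) < y'" using zlt[OF m that(2)] lift_less_iff[OF F(1)] F(5) by metis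
        show "F (z m) \<in> X" using X_lift[OF zX(1) F(1)] .
      qed
      have "m0 \<le> 2 * m0 + 1" "2 * m0 + 1 \<le> M" by (simp_all add: M_def)
      then have last: "t0 \<le> F (z (2 * m0 + 1))" using U1'[OF push(3,2,4)] by blast
      have "F (z (2 * m0 + 1)) < F (z m)" if "m \<le> 2 * m0" for m
        using zanti[of m "2 * m0 + 1"] that lift_less_iff[OF F(1)] by simp
      then have Ft0: "t0 < F (z m)" if "m \<le> 2 * m0" for m using that last by (meson le_less_trans)
      have near: "y' - F (z m) \<le> L * l'" and big: "\<tau> * l' \<le> D (F (z m))" if m: "m0 \<le> m" "m \<le> 2 * m0" for m
      proof -
        have mM: "m \<le> M" using m by (simp add: M_def)
        have m2: "real m \<le> 2 * (W * s)" using m m0W by linarith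
        have "y' - F (z m) \<le> 2 * C * sqrt (Qf y' (F (z m)) * d') * l'"
          using U2'[OF push(3,2,4)[OF m(1) mM] Ft0[OF m(2)]] .
        also have "\<dots> \<le> 2 * C * sqrt (2 * (K * (real m)^2 / d) * d') * l'"
          using push(1)[OF m(1) mM] d CC l by (intro mult_right_mono mult_left_mono real_sqrt_le_mono) auto
        also have "2 * (K * (real m)^2 / d) * d' = 2 * K * (real m / s)^2"
          using d by (simp add: power_divide s2)
        also have "2 * C * sqrt (2 * K * (real m / s)^2) * l' = 2 * C * sqrt (2 * K) * (real m / s) * l'"
          unfolding real_sqrt_mult[of "2 * K"] using s1 by simp
        also have "\<dots> \<le> 2 * C * sqrt (2 * K) * (2 * W) * l'"
          using m2 s1 l CC K by (intro mult_right_mono mult_left_mono) (auto simp: pos_divide_le_eq)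
        also have "\<dots> = L * l'" by (simp add: L_def)
        finally show "y' - F (z m) \<le> L * l'" .
        define w where "w = F (z m)"
        have wX: "w \<in> X" using push(3)[OF m(1) mM] by (simp add: w_def)
        \<comment> \<open>A point that far from \<open>y'\<close> whose \<open>Qf\<close> is bounded
          cannot have small \<open>D\<close>, because \<open>(y' - w)^2\<close> is
          \<open>Qf y' w * D y' * D w\<close>.\<close>
        have "real 2 * l' / 4 \<le> y' - z' 2" by (rule z'(1)) (auto simp: M_def)
        then have "l' / 2 \<le> y' - w" using Fz[OF m(1) mM] by (simp add: w_def)
        then have "(l' / 2)^2 \<le> (y' - w)^2" using l by (intro power_mono) auto
        also have "\<dots> \<le> 2 * (K * (real m)^2 / d) * (D y' * D w)"
          using push(1)[OF m(1) mM] Qf_le_iff[OF yX(2) wX] by (simp add: w_def)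
        also have "\<dots> \<le> 2 * (K * (real m)^2 / d) * (C * d' * l' * D w)"
          using Dy(2) K d D_pos[OF wX] by (intro mult_left_mono mult_right_mono) (auto simp: l'_def)
        also have "\<dots> = (2 * K * C * l' * D w) * ((real m)^2 / s^2)" using d by (simp add: s2)
        also have "\<dots> \<le> (2 * K * C * l' * D w) * (4 * W^2)"
        proof (rule mult_left_mono)
          have "(real m)^2 \<le> (2 * (W * s))^2" using m2 by (intro power_mono) auto
          then show "(real m)^2 / s^2 \<le> 4 * W^2" using s1 by (simp add: pos_divide_le_eq power_mult_distrib)
          show "0 \<le> 2 * K * C * l' * D w" using K CC l D_pos[OF wX] by simp
        qed
        finally have "l' * l' \<le> l' * (32 * C * K * W^2 * D w)" by (simp add: power2_eq_square mult_ac)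
        then have "l' \<le> 32 * C * K * W^2 * D w" using l by (simp only: mult_le_cancel_left_pos)
        then show "\<tau> * l' \<le> D (F (z m))"
          using CC K W by (simp add: \<tau>_def w_def pos_divide_le_eq mult.commute)
      qed
      define A where "A = (\<lambda>m. F (z m)) ` {m0..2 * m0}"
      have "inj (\<lambda>m. F (z m))"
        by (rule linorder_injI) (use zanti lift_eq_iff[OF F(1)] in \<open>fastforce\<close>)
      then have cA: "card A = m0 + 1" unfolding A_def by (subst card_image) (auto intro: inj_on_subset)
      have A: "A \<subseteq> {t \<in> X. t \<in> {y' - L * l'..y'} \<and> \<tau> * l' \<le> D t}"
        using near big push(2,3) by (force simp: A_def M_def)
      have "real (card A) \<le> (y' - (y' - L * l')) / (c * (\<tau> * l')) + 1"
        by (rule card_deriv_ge(2)[OF c(1) c(2) _ _ A]) (use \<tau> l L in auto)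
      then have "real m0 \<le> L / (c * \<tau>)" using l by (simp add: cA mult.assoc[symmetric])
      moreover have "s \<le> real m0"
      proof -
        have "1 \<le> C * sqrt (18 * K)" using CC(1) K mult_mono[of 1 C 1 "sqrt (18 * K)"] by simp
        then have "1 * s \<le> C * sqrt (18 * K) * s" using s1 by (intro mult_right_mono) auto
        then have "s \<le> a" using s1 a by (simp add: a_def)
        then show ?thesis using m0(1) a by linarith
      qed
      ultimately show False using s by linarith
    qed
    show "\<exists>Q>0. \<exists>n0. \<forall>n\<ge>n0. \<forall>n'\<ge>n0. \<forall>F\<in>\<Gamma>. \<forall>H\<in>\<Gamma>. (\<forall>t. H (F t) = t) \<longrightarrow> (\<forall>t. F (H t) = t) \<longrightarrow>
        F ((h ^^ n) p) = (h ^^ n') p' \<longrightarrow>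
        at_most_doubles Q F ((h ^^ n) p) \<longrightarrow> \<not> at_most_doubles Q H ((h ^^ n') p')"
      using contr Qpos by (intro exI[of _ Q] conjI exI[of _ n0]) blast+
  qed
qed

end

section \<open>Reversal and translation of linked paths; choice of the sequences\<close>

context circle_lifts begin

lemma linked_mono:
  assumes "linked \<Sigma> \<epsilon> F u" "\<epsilon> \<le> \<epsilon>'" shows "linked \<Sigma> \<epsilon>' F u"
proof -
  obtain n f where f: "f 0 = id" "f n = F" "\<forall>i<n. \<exists>\<sigma>\<in>\<Sigma>. f (Suc i) = \<sigma> \<circ> f i"
      "\<forall>i\<le>n. D (f i u) < \<epsilon>" "\<forall>i\<le>n. \<forall>j<i. f i u - f j u \<notin> \<int>"
    using assms(1) by (rule linkedE)
  then have "\<forall>i\<le>n. D (f i u) < \<epsilon>'" using assms(2) by force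
  then show ?thesis unfolding linked_def using f by blast
qed

text \<open>The path is run backwards: its partial composites are
  \<open>f (n - i) \<circ> H\<close>, and its steps are the inverse generators.\<close>

lemma linked_inverse:
  assumes "linked \<Sigma> \<epsilon> F u" "\<Sigma> \<subseteq> \<Gamma>" "\<And>\<sigma>. \<sigma> \<in> \<Sigma> \<Longrightarrow> \<exists>\<sigma>'\<in>\<Sigma>. \<forall>t. \<sigma>' (\<sigma> t) = t"
    and H: "\<And>t. H (F t) = t" "\<And>t. F (H t) = t"
  shows "linked \<Sigma> \<epsilon> H (F u)"
proof -
  obtain n f where f0: "f 0 = id" "f n = F" "\<forall>i<n. \<exists>\<sigma>\<in>\<Sigma>. f (Suc i) = \<sigma> \<circ> f i"
      "\<forall>i\<le>n. D (f i u) < \<epsilon>" "\<forall>i\<le>n. \<forall>j<i. f i u - f j u \<notin> \<int>"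
    using assms(1) by (rule linkedE)
  note f = f0(1,2) f0(3-5)[rule_format]
  show ?thesis unfolding linked_def
  proof (intro exI[of _ n] exI[of _ "\<lambda>i. f (n - i) \<circ> H"] conjI allI impI)
    show "f (n - 0) \<circ> H = id" "f (n - n) \<circ> H = H" using f H by auto
    fix i assume i: "i < n"
    then obtain \<sigma> where \<sigma>: "\<sigma> \<in> \<Sigma>" "f (Suc (n - Suc i)) = \<sigma> \<circ> f (n - Suc i)" using f(3)[of "n - Suc i"] by auto
    then have *: "f (n - i) = \<sigma> \<circ> f (n - Suc i)" using i by (simp add: Suc_diff_Suc)
    obtain \<sigma>' where "\<sigma>' \<in> \<Sigma>" "\<And>t. \<sigma>' (\<sigma> t) = t" using assms(3)[OF \<sigma>(1)] by blast
    then show "\<exists>\<sigma>\<in>\<Sigma>. f (n - Suc i) \<circ> H = \<sigma> \<circ> (f (n - i) \<circ> H)"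
      using * by (intro bexI[of _ \<sigma>']) auto
  next
    fix i assume "i \<le> n"
    then show "D ((f (n - i) \<circ> H) (F u)) < \<epsilon>" using f(4)[of "n - i"] H by simp
    fix j assume "j < i"
    then have "f (n - j) u - f (n - i) u \<notin> \<int>" using f(5)[of "n - j" "n - i"] \<open>i \<le> n\<close> by simp
    then show "(f (n - i) \<circ> H) (F u) - (f (n - j) \<circ> H) (F u) \<notin> \<int>"
      using Ints_minus[of "f (n - i) u - f (n - j) u"] H by auto
  qed
qed

lemma linked_shift:
  assumes "linked \<Sigma> \<epsilon> F (u + of_int k)" "\<Sigma> \<subseteq> \<Gamma>" "u \<in> X"
  shows "linked \<Sigma> \<epsilon> F u"
proof -
  obtain n f where f0: "f 0 = id" "f n = F" "\<forall>i<n. \<exists>\<sigma>\<in>\<Sigma>. f (Suc i) = \<sigma> \<circ> f i"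
      "\<forall>i\<le>n. D (f i (u + of_int k)) < \<epsilon>" "\<forall>i\<le>n. \<forall>j<i. f i (u + of_int k) - f j (u + of_int k) \<notin> \<int>"
    using assms(1) by (rule linkedE)
  have mem: "f i \<in> \<Gamma>" if "i \<le> n" for i
    using chain_mem[OF f0(1) f0(3)[rule_format] assms(2) that] .
  have sh: "f i (u + of_int k) = f i u + of_int k" if "i \<le> n" for i using commutes_int[OF mem[OF that]] .
  show ?thesis unfolding linked_def
  proof (intro exI[of _ n] exI[of _ f] conjI allI impI)
    fix i assume i: "i \<le> n"
    then show "D (f i u) < \<epsilon>" using f0(4)[rule_format, OF i] sh[OF i] D_shift[OF X_lift[OF assms(3) mem[OF i]]] by simp
    fix j assume j: "j < i"
    then show "f i u - f j u \<notin> \<int>" using f0(5)[rule_format, OF i j] sh[OF i] sh[of j] i by simp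
  qed (use f0 in auto)
qed

text \<open>The sequences are \<open>(h ^^ n) (p i)\<close> with \<open>D (p i)\<close> dropping by
  at least the factor \<Lambda> at each index. A link between two of them would give a map and its
  inverse that both at most double \<open>Qf\<close>, which \<open>neighbour_transport_bound\<close>
  excludes.\<close>

theorem unlinked_sequences:
  assumes "finite \<Sigma>" "\<Sigma> \<subseteq> \<Gamma>" "\<And>\<sigma>. \<sigma> \<in> \<Sigma> \<Longrightarrow> \<exists>\<sigma>'\<in>\<Sigma>. \<forall>t. \<sigma>' (\<sigma> t) = t"
  obtains \<epsilon> and y :: "nat \<Rightarrow> nat \<Rightarrow> real" where "0 < \<epsilon>" "\<And>i n. y i n \<in> X"
    "\<And>i m n. m < n \<Longrightarrow> y i m - y i n \<notin> \<int>"
    "\<And>i j m n F k. i < N \<Longrightarrow> j < N \<Longrightarrow> i \<noteq> j \<Longrightarrow> F \<in> \<Gamma> \<Longrightarrow> linked \<Sigma> \<epsilon> F (y i m) \<Longrightarrow> F (y i m) \<noteq> y j n + of_int k"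
proof -
  obtain h b where "cusp \<Gamma> t0 h t0 b" using right_cusp[OF nonexpandable] .
  then interpret base_cusp \<Gamma> t0 h b by (simp add: base_cusp_def)
  have hb: "t0 < h b" "h b < b" using it_gt[OF z_less_b, of 1] h_less[OF z_less_b] by auto
  obtain c where c: "0 < c" "\<And>u v. u\<in>X \<Longrightarrow> v\<in>X \<Longrightarrow> u < v \<Longrightarrow> c * min (D u) (D v) \<le> v - u"
    using separation by blast
  \<comment> \<open>The fundamental domain contains infinitely many orbit points by density, but
    only finitely many with \<open>D \<ge> \<delta>\<close>.\<close>
  have small: "\<exists>p\<in>X. h b < p \<and> p \<le> b \<and> D p < \<delta>" if "0 < \<delta>" for \<delta>
  proof (rule ccontr)
    assume contr: "\<not> ?thesis"
    define A where "A = {p \<in> X. h b < p \<and> p < b}"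
    have "A \<subseteq> {t \<in> X. t \<in> {h b..b} \<and> \<delta> \<le> D t}" using contr by (auto simp: A_def not_less less_imp_le)
    then have fin: "finite A" using card_deriv_ge(1)[OF c that less_imp_le[OF hb(2)]] by blast
    have "A \<noteq> {}" using dense_X[OF hb(2)] by (auto simp: A_def)
    then have M: "Max A \<in> A" "\<And>x. x \<in> A \<Longrightarrow> x \<le> Max A" using fin by auto
    then obtain x where "x \<in> X" "Max A < x" "x < b" using dense_X[of "Max A" b] by (auto simp: A_def)
    then have "x \<in> A" using M(1) by (auto simp: A_def)
    then show False using M(2) \<open>Max A < x\<close> by force
  qed
  obtain \<Lambda> where \<Lambda>: "1 \<le> \<Lambda>"
    "\<And>p p'. p \<in> X \<Longrightarrow> h b < p \<Longrightarrow> p \<le> b \<Longrightarrow> p' \<in> X \<Longrightarrow> h b < p' \<Longrightarrow> p' \<le> b \<Longrightarrow> \<Lambda> * D p' \<le> D p \<Longrightarrow>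
      \<exists>Q>0. \<exists>n0. \<forall>n\<ge>n0. \<forall>n'\<ge>n0. \<forall>F\<in>\<Gamma>. \<forall>H\<in>\<Gamma>. (\<forall>t. H (F t) = t) \<longrightarrow> (\<forall>t. F (H t) = t) \<longrightarrow>
        F ((h ^^ n) p) = (h ^^ n') p' \<longrightarrow>
        at_most_doubles Q F ((h ^^ n) p) \<longrightarrow> \<not> at_most_doubles Q H ((h ^^ n') p')"
    using neighbour_transport_bound by blast
  have "\<exists>p. \<forall>i. (p i \<in> X \<and> h b < p i \<and> p i \<le> b) \<and> \<Lambda> * D (p (Suc i)) \<le> D (p i)"
  proof (rule dependent_nat_choice)
    show "\<exists>x. x \<in> X \<and> h b < x \<and> x \<le> b" using small[of 1] by auto
    fix x i assume "x \<in> X \<and> h b < x \<and> x \<le> b"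
    then have "0 < D x / \<Lambda>" using D_pos \<Lambda>(1) by simp
    then obtain p where "p \<in> X" "h b < p" "p \<le> b" "D p < D x / \<Lambda>" using small by blast
    then show "\<exists>y. (y \<in> X \<and> h b < y \<and> y \<le> b) \<and> \<Lambda> * D y \<le> D x"
      using \<Lambda>(1) by (intro exI[of _ p]) (auto simp: field_simps)
  qed
  then obtain p :: "nat \<Rightarrow> real" where p: "\<And>i. p i \<in> X" "\<And>i. h b < p i" "\<And>i. p i \<le> b"
      "\<And>i. \<Lambda> * D (p (Suc i)) \<le> D (p i)" by blast
  have pdec: "\<Lambda> * D (p j) \<le> D (p i)" if "i < j" for i j
  proof -
    have "D (p j) \<le> D (p (Suc i))"
    proof (rule lift_Suc_antimono_le[of "\<lambda>i. D (p i)"])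
      fix n
      have "1 * D (p (Suc n)) \<le> \<Lambda> * D (p (Suc n))" using \<Lambda>(1) D_pos[OF p(1)] by (intro mult_right_mono) (auto simp: less_imp_le)
      then show "D (p (Suc n)) \<le> D (p n)" using p(4)[of n] by simp
    qed (use that in simp)
    then show ?thesis using p(4)[of i] \<Lambda>(1) mult_left_mono[of "D (p j)" "D (p (Suc i))" \<Lambda>] by linarith
  qed
  define y where "y i n = (h ^^ n) (p i)" for i n
  have yX: "y i n \<in> X" for i n unfolding y_def using X_lift[OF p(1) it_mem] .
  define sep where "sep \<epsilon> n0 i j \<longleftrightarrow> (\<forall>m\<ge>n0. \<forall>n\<ge>n0. \<forall>F\<in>\<Gamma>. \<forall>k. linked \<Sigma> \<epsilon> F (y i m) \<longrightarrow> F (y i m) \<noteq> y j n + of_int k)"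
    for \<epsilon> :: real and n0 i j :: nat
  have sep_less: "\<exists>\<epsilon>>0. \<exists>n0. sep \<epsilon> n0 i j \<and> sep \<epsilon> n0 j i" if ij: "i < j" for i j
  proof -
    obtain Q n0 where Q: "0 < Q" and n0: "\<forall>m\<ge>n0. \<forall>n\<ge>n0. \<forall>F\<in>\<Gamma>. \<forall>H\<in>\<Gamma>.
        (\<forall>t. H (F t) = t) \<longrightarrow> (\<forall>t. F (H t) = t) \<longrightarrow> F (y i m) = y j n \<longrightarrow>
        at_most_doubles Q F (y i m) \<longrightarrow> \<not> at_most_doubles Q H (y j n)"
      using \<Lambda>(2)[OF p(1)[of i] p(2)[of i] p(3)[of i] p(1)[of j] p(2)[of j] p(3)[of j] pdec[OF ij]]
      unfolding y_def[symmetric] by (elim exE conjE)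
    obtain \<epsilon> where \<epsilon>: "0 < \<epsilon>" "\<And>F u. linked \<Sigma> \<epsilon> F u \<Longrightarrow> u \<in> X \<Longrightarrow> at_most_doubles Q F u"
      using Qf_linked[OF assms(1,2) Q] by blast
    have 1: "sep \<epsilon> n0 i j"
      unfolding sep_def
    proof (intro allI impI ballI notI)
      fix m n F k assume mn: "m \<ge> n0" "n \<ge> n0" and F: "F \<in> \<Gamma>" "linked \<Sigma> \<epsilon> F (y i m)" "F (y i m) = y j n + of_int k"
      obtain H where H: "H \<in> \<Gamma>" "\<And>t. H (F t) = t" "\<And>t. F (H t) = t" using inverseE[OF F(1)] by metis
      have linkH: "linked \<Sigma> \<epsilon> H (y j n)"
        using linked_inverse[OF F(2) assms(2,3) H(2,3)] linked_shift[OF _ assms(2) yX] unfolding F(3) by blast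
      \<comment> \<open>\<open>F\<close> reaches only a translate of \<open>y j n\<close>; composing
        with an integer translation does not change \<open>Qf\<close> and yields a map to which
        \<open>n0\<close> applies.\<close>
      define F' where "F' = (\<lambda>t. t + of_int (- k)) \<circ> F"
      define H' where "H' = H \<circ> (\<lambda>t. t + of_int k)"
      have mem: "F' \<in> \<Gamma>" "H' \<in> \<Gamma>" unfolding F'_def H'_def using comp_mem shift_mem F(1) H(1) by blast+
      have Heq: "H' t = H t + of_int k" for t unfolding H'_def using commutes_int[OF H(1)] by simp
      have "\<forall>t. H' (F' t) = t" "\<forall>t. F' (H' t) = t" "F' (y i m) = y j n"
        using H F(3) by (auto simp: F'_def H'_def)
      moreover have "at_most_doubles Q F' (y i m)"
        using \<epsilon>(2)[OF F(2) yX] Qf_shift[OF X_lift[OF yX F(1)] X_lift[OF _ F(1)]]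
        by (simp add: at_most_doubles_def F'_def del: of_int_minus)
      moreover have "at_most_doubles Q H' (y j n)"
        using \<epsilon>(2)[OF linkH yX] Qf_shift[OF X_lift[OF yX H(1)] X_lift[OF _ H(1)]]
        by (simp add: at_most_doubles_def Heq)
      ultimately show False using n0 mn mem by blast
    qed
    \<comment> \<open>The bound needs the larger \<open>D\<close> at the start, so this direction is
      reduced to the previous one by reversing the path.\<close>
    have 2: "sep \<epsilon> n0 j i"
      unfolding sep_def
    proof (intro allI impI ballI notI)
      fix m n F k assume mn: "m \<ge> n0" "n \<ge> n0" and F: "F \<in> \<Gamma>" "linked \<Sigma> \<epsilon> F (y j m)" "F (y j m) = y i n + of_int k"
      obtain H where H: "H \<in> \<Gamma>" "\<And>t. H (F t) = t" "\<And>t. F (H t) = t" using inverseE[OF F(1)] by metis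
      have "linked \<Sigma> \<epsilon> H (y i n)"
        using linked_inverse[OF F(2) assms(2,3) H(2,3)] linked_shift[OF _ assms(2) yX] unfolding F(3) by blast
      moreover have "H (y i n) + of_int k = y j m" using H(2)[of "y j m"] commutes_int[OF H(1)] unfolding F(3) by simp
      then have "H (y i n) = y j m + of_int (- k)" by simp
      ultimately show False using 1 mn H(1) unfolding sep_def by blast
    qed
    show ?thesis using 1 2 \<epsilon>(1) by blast
  qed
  have sep_ne: "\<exists>\<epsilon>>0. \<exists>n0. sep \<epsilon> n0 i j" if "i \<noteq> j" for i j
    using sep_less[of i j] sep_less[of j i] that by (meson linorder_neq_iff)
  then obtain E M where EM: "\<And>i j. i \<noteq> j \<Longrightarrow> 0 < E i j \<and> sep (E i j) (M i j) i j" by metis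
  define pairs where "pairs = {(i, j). i < N \<and> j < N \<and> i \<noteq> j}"
  have fin: "finite pairs" by (rule finite_subset[of _ "{..<N} \<times> {..<N}"]) (auto simp: pairs_def)
  \<comment> \<open>Every pair of indices has its own \<open>Q\<close>, hence its own threshold and
    starting index. Only finitely many pairs lie below \<open>N\<close>, which is why
    \<open>N\<close> is fixed in advance; 1 and 0 are inserted for the case of no pairs.\<close>
  define \<epsilon> where "\<epsilon> = Min (insert 1 ((\<lambda>(i, j). E i j) ` pairs))"
  define n0 where "n0 = Max (insert 0 ((\<lambda>(i, j). M i j) ` pairs))"
  show thesis
  proof (rule that[of \<epsilon> "\<lambda>i n. y i (n + n0)"])
    show "0 < \<epsilon>" unfolding \<epsilon>_def using fin EM by (subst Min_gr_iff) (auto simp: pairs_def)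
    show "y i (n + n0) \<in> X" for i n by (rule yX)
    fix i m n :: nat assume mn: "m < n"
    \<comment> \<open>The translate \<open>t0 + 1\<close> is fixed by \<open>h\<close> as well, so
      \<open>(t0, b]\<close> is shorter than a period and decreasing sequences in it stay injective
      modulo integers.\<close>
    have "h (t0 + 1) = t0 + 1" using commutes_one[OF h_mem, of t0] h_fix by simp
    then have "b < t0 + 1" using h_less[of "t0 + 1"] by force
    moreover have "y i (Suc n) < y i n" for n
      using h_less[OF it_gt[of "p i" n]] it_le[of "p i" n] p(2)[of i] p(3)[of i] hb by (simp add: y_def)
    then have "y i n < y i m" if "m < n" for m n
      using lift_Suc_mono_less[of "\<lambda>n. - y i n" m n] that by simp
    then have "y i (n + n0) < y i (m + n0)" using mn by simp
    moreover have "t0 < y i (n + n0)" "y i (m + n0) \<le> b"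
      unfolding y_def using it_gt[of "p i"] it_le[of "p i"] p(2)[of i] p(3)[of i] hb by (meson less_trans order_trans)+
    ultimately have "0 < y i (m + n0) - y i (n + n0)" "y i (m + n0) - y i (n + n0) < 1" by linarith+
    then show "y i (m + n0) - y i (n + n0) \<notin> \<int>" by (auto elim!: Ints_cases)
  next
    fix i j m n F k assume ij: "i < N" "j < N" "i \<noteq> j" and F: "F \<in> \<Gamma>" "linked \<Sigma> \<epsilon> F (y i (m + n0))"
    have "(i, j) \<in> pairs" using ij by (simp add: pairs_def)
    then have "\<epsilon> \<le> E i j" "M i j \<le> n0" unfolding \<epsilon>_def n0_def using fin by (auto intro!: Min_le Max_ge)
    then have "linked \<Sigma> (E i j) F (y i (m + n0))" "m + n0 \<ge> M i j" "n + n0 \<ge> M i j"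
      using linked_mono[OF F(2)] by auto
    then show "F (y i (m + n0)) \<noteq> y j (n + n0) + of_int k"
      using EM[OF ij(3)] F(1) unfolding sep_def by blast
  qed
qed

end

section \<open>Ends of locally finite graphs\<close>

lemma finite_relpow_Image:
  fixes E :: "('a \<times> 'a) set"
  assumes "\<And>v. finite {w. (v, w) \<in> E}"
  shows "finite {w. (v, w) \<in> E ^^ k}"
proof (induction k)
  case (Suc k)
  have "{w. (v, w) \<in> E ^^ Suc k} = (\<Union>u\<in>{u. (v, u) \<in> E ^^ k}. {w. (u, w) \<in> E})" by auto
  then show ?case using Suc assms by simp
qed simp

lemma edge_point_in_realization:
  "x \<in> V \<Longrightarrow> y \<in> V \<Longrightarrow> x = y \<or> (x, y) \<in> E \<Longrightarrow> 0 \<le> t \<Longrightarrow> t \<le> 1 \<Longrightarrow>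
    (\<lambda>v. (1 - t) * indicator {x} v + t * indicator {y} v) \<in> realization V E"
  unfolding realization_def by blast

lemma indicator_in_realization: "v \<in> V \<Longrightarrow> (indicator {v} :: 'a \<Rightarrow> real) \<in> realization V E"
  using edge_point_in_realization[of v V v E 0] by simp

text \<open>The removed set is the full subgraph on \<open>K\<close>: an edge with an endpoint
  outside \<open>K\<close> loses at most its other endpoint.\<close>

lemma connected_path_realization:
  assumes "(v, w) \<in> (E \<inter> (- K) \<times> (- K))\<^sup>*" "v \<in> V - K" "E \<subseteq> V \<times> V"
  shows "connected_component (realization V E - {p. \<forall>u. p u \<noteq> 0 \<longrightarrow> u \<in> K})
    (indicator {v} :: 'a \<Rightarrow> real) (indicator {w})"
  using assms(1)
proof (induction rule: rtrancl_induct)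
  case base
  have "(indicator {v} :: 'a \<Rightarrow> real) \<in> realization V E - {p. \<forall>u. p u \<noteq> 0 \<longrightarrow> u \<in> K}"
    using assms(2) indicator_in_realization[of v V E] by (auto simp: indicator_def)
  then show ?case by simp
next
  case (step x y)
  then have xy: "(x, y) \<in> E" "x \<notin> K" "y \<notin> K" "x \<in> V" "y \<in> V" using assms(3) by auto
  define g :: "real \<Rightarrow> 'a \<Rightarrow> real" where "g t = (\<lambda>u. (1 - t) * indicator {x} u + t * indicator {y} u)" for t
  have "continuous_on {0..1} g"
    unfolding g_def by (intro continuous_on_coordinatewise_then_product continuous_intros)
  then have "connected (g ` {0..1})" by (intro connected_continuous_image) auto
  moreover have "g ` {0..1} \<subseteq> realization V E - {p. \<forall>u. p u \<noteq> 0 \<longrightarrow> u \<in> K}"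
  proof
    fix p assume "p \<in> g ` {0..1}"
    then obtain t where t: "p = g t" "0 \<le> t" "t \<le> 1" by auto
    have "p \<in> realization V E" unfolding t(1) g_def
      by (rule edge_point_in_realization) (use xy t in auto)
    moreover have "p x \<noteq> 0 \<or> p y \<noteq> 0" using t by (auto simp: g_def indicator_def)
    ultimately show "p \<in> realization V E - {p. \<forall>u. p u \<noteq> 0 \<longrightarrow> u \<in> K}" using xy by auto
  qed
  moreover have "g 0 = indicator {x}" "g 1 = indicator {y}" by (auto simp: g_def)
  then have "indicator {x} \<in> g ` {0..1}" "indicator {y} \<in> g ` {0..1}" by (metis atLeastAtMost_iff image_eqI order_refl zero_le_one)+
  ultimately have "connected_component (realization V E - {p. \<forall>u. p u \<noteq> 0 \<longrightarrow> u \<in> K})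
      (indicator {x} :: 'a \<Rightarrow> real) (indicator {y})"
    unfolding connected_component_def by blast
  with step.IH show ?case by (rule connected_component_trans)
qed

lemma compact_subgraph:
  assumes "finite K"
  shows "compact (realization V E \<inter> {p. \<forall>u. p u \<noteq> 0 \<longrightarrow> u \<in> K})"
proof -
  define g :: "'a \<times> 'a \<Rightarrow> real \<Rightarrow> 'a \<Rightarrow> real"
    where "g e t = (\<lambda>u. (1 - t) * indicator {fst e} u + t * indicator {snd e} u)" for e t
  define P where "P = {e \<in> K \<times> K. fst e \<in> V \<and> snd e \<in> V \<and> (fst e = snd e \<or> e \<in> E)}"
  have "realization V E \<inter> {p. \<forall>u. p u \<noteq> 0 \<longrightarrow> u \<in> K} = (\<Union>e\<in>P. g e ` {0..1})"
  proof (intro equalityI subsetI)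
    fix p assume "p \<in> realization V E \<inter> {p. \<forall>u. p u \<noteq> 0 \<longrightarrow> u \<in> K}"
    then obtain x y t where p: "p = (\<lambda>v. (1 - t) * indicator {x} v + t * indicator {y} v)"
      "x \<in> V" "y \<in> V" "x = y \<or> (x, y) \<in> E" "0 \<le> t" "t \<le> 1" and sK: "\<And>u. p u \<noteq> 0 \<Longrightarrow> u \<in> K"
      unfolding realization_def by blast
    consider "t = 0" | "t = 1" | "0 < t" "t < 1" using p by linarith
    then show "p \<in> (\<Union>e\<in>P. g e ` {0..1})"
    proof cases
      \<comment> \<open>At a vertex the other endpoint of the edge may lie outside \<open>K\<close>,
        so the degenerate edge is used.\<close>
      case 1
      then have "x \<in> K" using sK[of x] p by (simp add: indicator_def)
      then show ?thesis using p 1 by (intro UN_I[of "(x, x)"]) (auto simp: P_def g_def intro!: image_eqI[of _ _ 0])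
    next
      case 2
      then have "y \<in> K" using sK[of y] p by (simp add: indicator_def)
      then show ?thesis using p 2 by (intro UN_I[of "(y, y)"]) (auto simp: P_def g_def intro!: image_eqI[of _ _ 0])
    next
      case 3
      then have "x \<in> K" "y \<in> K" using sK[of x] sK[of y] p by (auto simp: indicator_def)
      then show ?thesis using p by (intro UN_I[of "(x, y)"]) (auto simp: P_def g_def intro!: image_eqI[of _ _ t])
    qed
  next
    fix p assume "p \<in> (\<Union>e\<in>P. g e ` {0..1})"
    then obtain e t where e: "e \<in> P" "p = g e t" "0 \<le> t" "t \<le> 1" by auto
    then have "p \<in> realization V E" unfolding e(2) g_def
      by (intro edge_point_in_realization) (auto simp: P_def)
    moreover have "\<forall>u. p u \<noteq> 0 \<longrightarrow> u \<in> K" using e by (auto simp: g_def P_def indicator_def split: if_splits)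
    ultimately show "p \<in> realization V E \<inter> {p. \<forall>u. p u \<noteq> 0 \<longrightarrow> u \<in> K}" by blast
  qed
  moreover have "compact (\<Union>e\<in>P. g e ` {0..1})"
  proof (rule compact_UN)
    show "finite P" by (rule finite_subset[of _ "K \<times> K"]) (use assms in \<open>auto simp: P_def\<close>)
    fix e
    have "continuous_on {0..1} (g e)"
      unfolding g_def by (intro continuous_on_coordinatewise_then_product continuous_intros)
    then show "compact (g e ` {0..1})" by (intro compact_continuous_image) auto
  qed
  ultimately show ?thesis by simp
qed

lemma open_coordinate_nonzero: "open {p :: 'a \<Rightarrow> real. \<exists>u\<in>A. p u \<noteq> 0}"
proof -
  have "open {p :: 'a \<Rightarrow> real. p u \<noteq> 0}" for u
    by (intro open_Collect_neq continuous_intros continuous_on_product_coordinates)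
  then have "open (\<Union>u\<in>A. {p :: 'a \<Rightarrow> real. p u \<noteq> 0})" by blast
  moreover have "(\<Union>u\<in>A. {p :: 'a \<Rightarrow> real. p u \<noteq> 0}) = {p. \<exists>u\<in>A. p u \<noteq> 0}" by auto
  ultimately show ?thesis by simp
qed

text \<open>Let \<open>A\<close> be the combinatorial component of \<open>b\<close>. A nonzero
  coordinate in \<open>A\<close>, or one outside both \<open>A\<close> and \<open>K\<close>, are
  open conditions; a point satisfying both would lie on an edge leading out of \<open>A\<close> and
  avoiding \<open>K\<close>.\<close>

lemma separated_vertices:
  assumes "b \<in> V - K" "b' \<in> V - K" "sym E" "(b, b') \<notin> (E \<inter> (- K) \<times> (- K))\<^sup>*"
  shows "\<not> connected_component (realization V E - {p. \<forall>u. p u \<noteq> 0 \<longrightarrow> u \<in> K})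
    (indicator {b} :: 'a \<Rightarrow> real) (indicator {b'})"
proof
  let ?R = "realization V E - {p :: 'a \<Rightarrow> real. \<forall>u. p u \<noteq> 0 \<longrightarrow> u \<in> K}"
  assume "connected_component ?R (indicator {b}) (indicator {b'})"
  then obtain T where T: "connected T" "T \<subseteq> ?R" "indicator {b} \<in> T" "indicator {b'} \<in> T"
    unfolding connected_component_def by blast
  define A where "A = {v. (b, v) \<in> (E \<inter> (- K) \<times> (- K))\<^sup>*}"
  let ?U = "{p :: 'a \<Rightarrow> real. \<exists>u\<in>A. p u \<noteq> 0}" and ?W = "{p :: 'a \<Rightarrow> real. \<exists>u\<in>- A - K. p u \<noteq> 0}"
  have disj: "?U \<inter> ?W \<inter> T = {}"
  proof (rule ccontr)
    assume "?U \<inter> ?W \<inter> T \<noteq> {}"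
    then obtain p u w where p: "p \<in> T" "u \<in> A" "p u \<noteq> 0" "w \<notin> A" "w \<notin> K" "p w \<noteq> 0" by auto
    then obtain x y t where xy: "p = (\<lambda>v. (1 - t) * indicator {x} v + t * indicator {y} v)" "x = y \<or> (x, y) \<in> E"
      using T(2) unfolding realization_def by blast
    have "u = x \<or> u = y" "w = x \<or> w = y" "u \<noteq> w" using p xy by (auto simp: indicator_def split: if_splits)
    then have uw: "(u, w) \<in> E" using xy(2) assms(3) by (auto dest: symD)
    have "u \<notin> K" using p(2) assms(1) unfolding A_def by (auto elim: rtranclE)
    then have "w \<in> A" using uw p unfolding A_def by (auto intro: rtrancl_into_rtrancl)
    then show False using p by blast
  qed
  have "T \<subseteq> ?U \<union> ?W" using T(2) by blast
  moreover have "indicator {b} \<in> ?U \<inter> T" using T(3) by (auto simp: A_def indicator_def intro!: bexI[of _ b])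
  moreover have "indicator {b'} \<in> ?W \<inter> T" using T(4) assms by (auto simp: A_def indicator_def intro!: bexI[of _ b'])
  ultimately show False
    using connectedD[OF T(1) open_coordinate_nonzero open_coordinate_nonzero, of A "- A - K"] disj by blast
qed

text \<open>By local finiteness only finitely many vertices border \<open>K\<close>, and each vertex
  outside \<open>K\<close> is joined to one of them off \<open>K\<close>. So each sequence has
  infinitely many terms in one component, which is therefore unbounded, and \<open>unlinked\<close>
  makes these components distinct.\<close>

lemma number_of_ends_ge:
  fixes y :: "nat \<Rightarrow> nat \<Rightarrow> 'a"
  assumes E: "E \<subseteq> V \<times> V" "sym E" "\<And>v. finite {w. (v, w) \<in> E}"
    and conn: "\<And>v w. v \<in> V \<Longrightarrow> w \<in> V \<Longrightarrow> (v, w) \<in> E\<^sup>*"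
    and K: "finite K" "K \<noteq> {}" "K \<subseteq> V"
    and y: "\<And>i n. y i n \<in> V" "\<And>i. inj (y i)"
    and unlinked: "\<And>i j m n. i < N \<Longrightarrow> j < N \<Longrightarrow> i \<noteq> j \<Longrightarrow> y i m \<notin> K \<Longrightarrow> y j n \<notin> K \<Longrightarrow>
      (y i m, y j n) \<notin> (E \<inter> (- K) \<times> (- K))\<^sup>*"
  shows "enat N \<le> number_of_ends V E"
proof -
  define E' where "E' = E \<inter> (- K) \<times> (- K)"
  have symE': "sym (E'\<^sup>*)" by (rule sym_rtrancl) (use E(2) in \<open>auto simp: E'_def sym_def\<close>)
  define B where "B = (\<Union>k\<in>K. {w. (k, w) \<in> E}) - K"
  have finB: "finite B" unfolding B_def using K E(3) by blast
  obtain k0 where k0: "k0 \<in> K" using K by blast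
  have boundary: "\<exists>b\<in>B. (v, b) \<in> E'\<^sup>*" if "v \<in> V" "v \<notin> K" for v
  proof -
    have "(v, k0) \<in> E\<^sup>*" using conn that k0 K by blast
    then show ?thesis using that(2)
    proof (induction rule: converse_rtrancl_induct)
      case base
      then show ?case using k0 by simp
    next
      case (step u w)
      show ?case
      proof (cases "w \<in> K")
        case True
        then have "u \<in> B" using step E(2) by (auto simp: B_def dest: symD)
        then show ?thesis by blast
      next
        case False
        then obtain b where "b \<in> B" "(w, b) \<in> E'\<^sup>*" using step by blast
        moreover have "(u, w) \<in> E'" using step False by (simp add: E'_def)
        ultimately show ?thesis by (meson converse_rtrancl_into_rtrancl)
      qed
    qed
  qed
  \<comment> \<open>The pigeonhole principle over the finite set \<open>B\<close>.\<close>
  have "\<exists>b\<in>B. infinite {n. y i n \<notin> K \<and> (y i n, b) \<in> E'\<^sup>*}" for i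
  proof -
    have "finite {n. y i n \<in> K}" using finite_vimageI[OF K(1) y(2)[of i]] by (simp add: vimage_def)
    then have "infinite (UNIV - {n. y i n \<in> K})" using infinite_UNIV_nat by (rule Diff_infinite_finite)
    moreover have "UNIV - {n. y i n \<in> K} = {n. y i n \<notin> K}" by auto
    ultimately have inf: "infinite {n. y i n \<notin> K}" by simp
    have "{n. y i n \<notin> K} \<subseteq> (\<Union>b\<in>B. {n. y i n \<notin> K \<and> (y i n, b) \<in> E'\<^sup>*})"
      using boundary[OF y(1)] by blast
    then show ?thesis using inf finB by (meson finite_UN finite_subset)
  qed
  then obtain b where b: "\<And>i. b i \<in> B" "\<And>i. infinite {n. y i n \<notin> K \<and> (y i n, b i) \<in> E'\<^sup>*}" by metis
  have bV: "b i \<in> V - K" for i using b(1)[of i] E(1) by (auto simp: B_def)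
  let ?P = "{p :: 'a \<Rightarrow> real. \<forall>u. p u \<noteq> 0 \<longrightarrow> u \<in> K}"
  let ?R = "realization V E - ?P"
  define C where "C i = connected_component_set ?R (indicator {b i})" for i
  have inR: "indicator {b i} \<in> ?R" for i
    using bV[of i] indicator_in_realization[of "b i" V E] by (auto simp: indicator_def)
  have comp: "C i \<in> components ?R" for i unfolding C_def components_def using inR by blast
  have unb: "\<not> graph_bounded E (C i)" for i
  proof
    assume "graph_bounded E (C i)"
    then obtain n where n: "\<And>p q v w. p \<in> C i \<Longrightarrow> q \<in> C i \<Longrightarrow> p v \<noteq> 0 \<Longrightarrow> q w \<noteq> 0 \<Longrightarrow> \<exists>k\<le>n. (v, w) \<in> E ^^ k"
      unfolding graph_bounded_def by blast
    have "y i ` {m. y i m \<notin> K \<and> (y i m, b i) \<in> E'\<^sup>*} \<subseteq> (\<Union>k\<le>n. {w. (b i, w) \<in> E ^^ k})"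
    proof
      fix w assume "w \<in> y i ` {m. y i m \<notin> K \<and> (y i m, b i) \<in> E'\<^sup>*}"
      then have "(w, b i) \<in> E'\<^sup>*" by blast
      then have "(b i, w) \<in> E'\<^sup>*" using symE' by (blast dest: symD)
      then have "indicator {w} \<in> C i"
        unfolding C_def mem_Collect_eq E'_def by (rule connected_path_realization[OF _ bV E(1)])
      moreover have "indicator {b i} \<in> C i" unfolding C_def using inR by simp
      ultimately show "w \<in> (\<Union>k\<le>n. {w. (b i, w) \<in> E ^^ k})"
        using n[of "indicator {b i}" "indicator {w}" "b i" w] by auto
    qed
    moreover have "finite (\<Union>k\<le>n. {w. (b i, w) \<in> E ^^ k})" using finite_relpow_Image[OF E(3)] by blast
    ultimately have "finite (y i ` {m. y i m \<notin> K \<and> (y i m, b i) \<in> E'\<^sup>*})" by (rule finite_subset)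
    then show False using b(2)[of i] finite_imageD inj_on_subset[OF y(2)] by blast
  qed
  have inj: "inj_on C {..<N}"
  proof (rule inj_onI, rule ccontr)
    fix i j assume ij: "i \<in> {..<N}" "j \<in> {..<N}" "C i = C j" "i \<noteq> j"
    obtain m where m: "y i m \<notin> K" "(y i m, b i) \<in> E'\<^sup>*" using b(2)[of i] not_finite_existsD by blast
    obtain n where n: "y j n \<notin> K" "(y j n, b j) \<in> E'\<^sup>*" using b(2)[of j] not_finite_existsD by blast
    have "(b i, b j) \<notin> E'\<^sup>*"
    proof
      assume "(b i, b j) \<in> E'\<^sup>*"
      moreover have "(b j, y j n) \<in> E'\<^sup>*" using n symE' by (blast dest: symD)
      ultimately have "(y i m, y j n) \<in> E'\<^sup>*" using m by (meson rtrancl_trans)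
      then show False using unlinked[of i j m n] ij m n by (auto simp: E'_def)
    qed
    then have "\<not> connected_component ?R (indicator {b i}) (indicator {b j})"
      unfolding E'_def by (rule separated_vertices[OF bV bV E(2)])
    moreover have "indicator {b j} \<in> C j" unfolding C_def using inR by simp
    then have "indicator {b j} \<in> C i" using ij by simp
    ultimately show False by (simp add: C_def)
  qed
  let ?S = "{C \<in> components ?R. \<not> graph_bounded E C}"
  have sub: "C ` {..<N} \<subseteq> ?S" using comp unb by blast
  have "enat N \<le> ecount ?S"
  proof (cases "finite ?S")
    case True
    have "N = card (C ` {..<N})" using inj by (simp add: card_image)
    also have "\<dots> \<le> card ?S" using True sub by (rule card_mono)
    finally show ?thesis using True by (simp add: ecount_def)
  qed (simp add: ecount_def)
  also have "realization V E - ?P = realization V E - (realization V E \<inter> ?P)" by blast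
  also have "ecount {C \<in> components (realization V E - (realization V E \<inter> ?P)). \<not> graph_bounded E C}
      \<le> number_of_ends V E"
    unfolding number_of_ends_def
    by (rule SUP_upper) (use compact_subgraph[OF K(1), of V E] in auto)
  finally show ?thesis .
qed

section \<open>Lifts of circle diffeomorphisms\<close>

lemma Cr_real_has_deriv:
  assumes "Cr_real r F" "k < r"
  shows "((deriv ^^ k) F has_real_derivative (deriv ^^ Suc k) F t) (at t)"
  using assms by (auto simp: Cr_real_def field_differentiable_derivI)

text \<open>\<open>deriv\<close> is a description operator, so equality as functions, also at points
  of non-differentiability, comes from having the same candidate derivatives.\<close>

lemma deriv_add_const: "deriv (\<lambda>t. F t + c) = deriv (F :: real \<Rightarrow> real)"
proof -
  have "((\<lambda>t. F t + c) has_real_derivative D) (at t) \<longleftrightarrow> (F has_real_derivative D) (at t)" for t D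
    using DERIV_add[OF _ DERIV_const[of c], of F D t] DERIV_add[OF _ DERIV_const[of "- c"], of "\<lambda>t. F t + c" D t] by auto
  then show ?thesis unfolding deriv_def by (intro ext) simp
qed

lemma Cr_real_add_const:
  assumes "Cr_real r F" shows "Cr_real r (\<lambda>t. F t + c)"
proof -
  have k: "(deriv ^^ Suc k) (\<lambda>t. F t + c) = (deriv ^^ Suc k) F" for k
    by (simp add: funpow_swap1 deriv_add_const)
  have "(deriv ^^ k) (\<lambda>t. F t + c) field_differentiable at t" if "k < r" for k t
  proof (cases k)
    case 0
    then have "F field_differentiable at t" using assms that by (auto simp: Cr_real_def)
    then show ?thesis using 0 by (auto intro!: derivative_intros)
  next
    case (Suc j)
    then show ?thesis using assms that k[of j] by (auto simp: Cr_real_def)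
  qed
  moreover have "continuous_on UNIV ((deriv ^^ r) (\<lambda>t. F t + c))"
  proof (cases r)
    case 0
    then show ?thesis using assms by (auto simp: Cr_real_def intro!: continuous_intros)
  next
    case (Suc j)
    then show ?thesis using assms k[of j] by (auto simp: Cr_real_def)
  qed
  ultimately show ?thesis by (simp add: Cr_real_def)
qed

lemma Cr_real_continuous:
  assumes "Cr_real r F" "k \<le> r" shows "continuous_on UNIV ((deriv ^^ k) F)"
proof (cases "k < r")
  case True
  then show ?thesis
    using Cr_real_has_deriv[OF assms(1) True] by (meson DERIV_continuous continuous_at_imp_continuous_on)
next
  case False
  then show ?thesis using assms by (auto simp: Cr_real_def)
qed

lemma deriv_shift_eq:
  assumes "\<And>t. F (t + 1) = F t + (c :: real)" shows "deriv F (t + 1) = deriv F t"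
proof -
  have "(F has_real_derivative D) (at (t + 1)) \<longleftrightarrow> ((\<lambda>x. F x + c) has_real_derivative D) (at t)" for D
    using DERIV_shift[of F D t 1] assms by simp
  then have "deriv F (t + 1) = deriv (\<lambda>x. F x + c) t" unfolding deriv_def by simp
  then show ?thesis by (simp add: deriv_add_const)
qed

lemma higher_deriv_periodic:
  assumes "\<And>t. F (t + 1) = F t + (1 :: real)" shows "(deriv ^^ Suc k) F (t + 1) = (deriv ^^ Suc k) F t"
proof (induction k arbitrary: t)
  case 0
  then show ?case using deriv_shift_eq[of F 1] assms by simp
next
  case (Suc k)
  then show ?case using deriv_shift_eq[of "(deriv ^^ Suc k) F" 0] by simp
qed

lemma periodic_bounded:
  fixes f :: "real \<Rightarrow> real"
  assumes "continuous_on UNIV f" "\<And>t. f (t + 1) = f t"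
  obtains B where "0 < B" "\<And>t. \<bar>f t\<bar> \<le> B"
proof -
  have "compact (f ` {0..1})"
    by (intro compact_continuous_image continuous_on_subset[OF assms(1)]) auto
  then obtain B where B: "0 < B" "\<And>t. t \<in> {0..1} \<Longrightarrow> \<bar>f t\<bar> \<le> B"
    using compact_imp_bounded bounded_pos[of "f ` {0..1}"] by auto
  have int: "f (t + of_int k) = f t" for t k
  proof (induction k rule: int_induct[of _ 0])
    case (step1 i)
    then show ?case using assms(2)[of "t + of_int i"] by (simp add: add.assoc)
  next
    case (step2 i)
    then show ?case using assms(2)[of "t + of_int i - 1"] by (simp add: algebra_simps)
  qed simp
  have "\<bar>f t\<bar> \<le> B" for t
  proof -
    have "t - of_int \<lfloor>t\<rfloor> \<in> {0..1}" by (auto, linarith)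
    then show ?thesis using B(2)[of "t - of_int \<lfloor>t\<rfloor>"] int[of "t - of_int \<lfloor>t\<rfloor>" "\<lfloor>t\<rfloor>"] by simp
  qed
  then show thesis using that B(1) by blast
qed

lemma periodic_pos_lower:
  fixes f :: "real \<Rightarrow> real"
  assumes "continuous_on UNIV f" "\<And>t. f (t + 1) = f t" "\<And>t. 0 < f t"
  obtains m where "0 < m" "\<And>t. m \<le> f t"
proof -
  have "continuous_on UNIV (\<lambda>t. inverse (f t))"
    using assms by (intro continuous_on_inverse) (auto simp: less_imp_neq[symmetric])
  then obtain B where B: "0 < B" "\<And>t. \<bar>inverse (f t)\<bar> \<le> B"
    using periodic_bounded[of "\<lambda>t. inverse (f t)"] assms(2) by auto
  have "inverse B \<le> f t" for t
    using B(2)[of t] assms(3)[of t] le_imp_inverse_le[of "inverse (f t)" B] by simp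
  then show thesis using that[of "inverse B"] B(1) by simp
qed

context
  fixes F :: "real \<Rightarrow> real"
  assumes C3: "Cr_real 3 F" and one: "\<And>t. F (t + 1) = F t + 1" and pos: "\<And>t. 0 < deriv F t"
begin

lemma Cr_ln_deriv_lipschitz: "\<exists>B\<ge>0. \<forall>s t. \<bar>ln (deriv F s) - ln (deriv F t)\<bar> \<le> B * \<bar>s - t\<bar>"
proof -
  have per: "(deriv ^^ Suc k) F (t + 1) = (deriv ^^ Suc k) F t" for k t
    by (rule higher_deriv_periodic[of F, OF one])
  obtain m where m: "0 < m" "\<And>t. m \<le> deriv F t"
    using periodic_pos_lower[of "deriv F"] Cr_real_continuous[OF C3, of 1] per[of 0] pos by auto
  obtain B where B: "0 < B" "\<And>t. \<bar>(deriv ^^ 2) F t\<bar> \<le> B"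
    using periodic_bounded[OF Cr_real_continuous[OF C3, of 2]] per[of 1] by (auto simp: numeral_2_eq_2)
  have d: "((\<lambda>t. ln (deriv F t)) has_real_derivative (deriv ^^ 2) F t / deriv F t) (at t)" for t
    using Cr_real_has_deriv[OF C3, of 1 t] pos[of t]
    by (auto intro!: derivative_eq_intros simp: numeral_2_eq_2)
  have "\<bar>ln (deriv F s) - ln (deriv F t)\<bar> \<le> B / m * \<bar>s - t\<bar>" for s t
  proof -
    have "norm (ln (deriv F s) - ln (deriv F t)) \<le> B / m * norm (s - t)"
    proof (rule field_differentiable_bound[of UNIV "\<lambda>t. ln (deriv F t)"])
      fix x
      show "((\<lambda>t. ln (deriv F t)) has_real_derivative (deriv ^^ 2) F x / deriv F x) (at x within UNIV)"
        using d[of x] by simp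
      show "norm ((deriv ^^ 2) F x / deriv F x) \<le> B / m"
        using B(2)[of x] B(1) m pos[of x] by (auto simp: abs_divide intro!: frac_le)
    qed auto
    then show ?thesis by simp
  qed
  then show ?thesis using B m by (intro exI[of _ "B / m"]) auto
qed

text \<open>Taylor expansion at \<open>s\<close>: the squared difference quotient and
  \<open>deriv F s * deriv F t\<close> agree up to first order in \<open>t - s\<close>, both
  starting with \<open>a^2 + a * b * \<delta>\<close>. Their difference is quadratic, and passing to
  logarithms costs only the lower bound on \<open>deriv F\<close>.\<close>

lemma Cr_projective_distortion:
  "\<exists>C\<ge>0. \<forall>s t. s \<noteq> t \<longrightarrow> \<bar>s - t\<bar> \<le> 1 \<longrightarrow>
     \<bar>ln (deriv F s * deriv F t * (s - t)^2 / (F s - F t)^2)\<bar> \<le> C * (s - t)^2"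
proof -
  have per: "(deriv ^^ Suc k) F (t + 1) = (deriv ^^ Suc k) F t" for k t
    by (rule higher_deriv_periodic[of F, OF one])
  obtain m where m: "0 < m" "\<And>t. m \<le> deriv F t"
    using periodic_pos_lower[of "deriv F"] Cr_real_continuous[OF C3, of 1] per[of 0] pos by auto
  obtain M1 where M1: "0 < M1" "\<And>t. \<bar>deriv F t\<bar> \<le> M1"
    using periodic_bounded[OF Cr_real_continuous[OF C3, of 1]] per[of 0] by auto
  obtain M2 where M2: "0 < M2" "\<And>t. \<bar>(deriv ^^ 2) F t\<bar> \<le> M2"
    using periodic_bounded[OF Cr_real_continuous[OF C3, of 2]] per[of 1] by (auto simp: numeral_2_eq_2)
  obtain M3 where M3: "0 < M3" "\<And>t. \<bar>(deriv ^^ 3) F t\<bar> \<le> M3"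
    using periodic_bounded[OF Cr_real_continuous[OF C3, of 3]] per[of 2] by (auto simp: numeral_3_eq_3 numeral_2_eq_2)
  \<comment> \<open>One summand for each of the four terms left in
    \<open>A^2 - a * deriv F t\<close> after the cancellation.\<close>
  define K where "K = M2^2 / 4 + M3 * (M1 + M2) + M3^2 + M1 * M3"
  have K: "0 \<le> K" using M1 M2 M3 by (simp add: K_def)
  show ?thesis
  proof (intro exI[of _ "K / m^2"] conjI allI impI)
    show "0 \<le> K / m^2" using K by simp
    fix s t :: real assume st: "s \<noteq> t" "\<bar>s - t\<bar> \<le> 1"
    define \<delta> where "\<delta> = t - s"
    have \<delta>: "\<delta> \<noteq> 0" "\<bar>\<delta>\<bar> \<le> 1" using st by (auto simp: \<delta>_def)
    define lo hi where "lo = min s t" and "hi = max s t"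
    have d: "\<forall>k t. k < 3 \<and> lo \<le> t \<and> t \<le> hi \<longrightarrow> DERIV ((deriv ^^ k) F) t :> (deriv ^^ Suc k) F t"
      using Cr_real_has_deriv[OF C3] by auto
    obtain \<xi> where \<xi>: "F t = (\<Sum>k<3. (deriv ^^ k) F s / fact k * (t - s)^k) + (deriv ^^ 3) F \<xi> / fact 3 * (t - s)^3"
      using Taylor[of 3 "\<lambda>k. (deriv ^^ k) F" F lo hi s t] d st by (auto simp: lo_def hi_def)
    have d2: "\<forall>k t. k < 2 \<and> lo \<le> t \<and> t \<le> hi \<longrightarrow> DERIV ((deriv ^^ Suc k) F) t :> (deriv ^^ Suc (Suc k)) F t"
      using Cr_real_has_deriv[OF C3, of "Suc _"] by auto
    obtain \<eta> where \<eta>: "deriv F t = (\<Sum>k<2. (deriv ^^ Suc k) F s / fact k * (t - s)^k) + (deriv ^^ Suc 2) F \<eta> / fact 2 * (t - s)^2"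
      using Taylor[of 2 "\<lambda>k. (deriv ^^ Suc k) F" "deriv F" lo hi s t] d2 st by (auto simp: lo_def hi_def)
    define a b r e where "a = deriv F s" and "b = (deriv ^^ 2) F s"
      and "r = (deriv ^^ 3) F \<xi> / 6 * \<delta>^2" and "e = (deriv ^^ 3) F \<eta> / 2 * \<delta>^2"
    define A where "A = (F t - F s) / \<delta>"
    have A: "A = a + b * \<delta> / 2 + r"
      using \<xi> \<delta>(1) by (simp add: A_def a_def b_def r_def \<delta>_def[symmetric] numeral_3_eq_3 numeral_2_eq_2
          fact_numeral field_simps power2_eq_square power3_eq_cube)
    have Ft: "deriv F t = a + b * \<delta> + e"
      using \<eta> by (simp add: a_def b_def e_def \<delta>_def[symmetric] numeral_3_eq_3 numeral_2_eq_2)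
    have bnds: "\<bar>a\<bar> \<le> M1" "\<bar>b\<bar> \<le> M2" using M1 M2 by (auto simp: a_def b_def)
    have \<delta>2: "0 \<le> \<delta>^2" "\<delta>^2 \<le> 1" using \<delta>(2) by (auto simp: abs_square_le_1)
    have r: "\<bar>r\<bar> \<le> M3 / 2 * \<delta>^2"
    proof -
      have "\<bar>r\<bar> = \<bar>(deriv ^^ 3) F \<xi>\<bar> / 6 * \<delta>^2" by (simp add: r_def abs_mult)
      also have "\<dots> \<le> M3 / 2 * \<delta>^2" using M3(2)[of \<xi>] M3(1) by (intro mult_right_mono) auto
      finally show ?thesis .
    qed
    have e: "\<bar>e\<bar> \<le> M3 * \<delta>^2"
    proof -
      have "\<bar>e\<bar> = \<bar>(deriv ^^ 3) F \<eta>\<bar> / 2 * \<delta>^2" by (simp add: e_def abs_mult)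
      also have "\<dots> \<le> M3 * \<delta>^2" using M3(2)[of \<eta>] M3(1) by (intro mult_right_mono) auto
      finally show ?thesis .
    qed
    have "A^2 - a * deriv F t = b^2 * \<delta>^2 / 4 + 2 * r * (a + b * \<delta> / 2) + r^2 - a * e"
      unfolding A Ft by (simp add: power2_eq_square algebra_simps)
    also have "\<bar>\<dots>\<bar> \<le> M2^2 * \<delta>^2 / 4 + M3 * \<delta>^2 * (M1 + M2) + M3^2 * \<delta>^2 + M1 * (M3 * \<delta>^2)"
    proof -
      have "b^2 \<le> M2^2" using bnds(2) by (simp add: abs_le_square_iff[symmetric])
      then have 1: "\<bar>b^2 * \<delta>^2 / 4\<bar> \<le> M2^2 * \<delta>^2 / 4" by (simp add: mult_right_mono)
      have "\<bar>b * \<delta> / 2\<bar> \<le> M2" using mult_mono[OF bnds(2) \<delta>(2)] M2(1) by (simp add: abs_mult)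
      then have "\<bar>a + b * \<delta> / 2\<bar> \<le> M1 + M2" using bnds(1) by linarith
      then have "\<bar>2 * r\<bar> * \<bar>a + b * \<delta> / 2\<bar> \<le> (M3 * \<delta>^2) * (M1 + M2)" using r by (intro mult_mono) auto
      then have 2: "\<bar>2 * r * (a + b * \<delta> / 2)\<bar> \<le> M3 * \<delta>^2 * (M1 + M2)" by (simp add: abs_mult)
      have "r^2 \<le> (M3 * \<delta>^2)^2" using r M3(1) \<delta>2 by (simp add: abs_le_square_iff[symmetric])
      also have "\<dots> = M3^2 * (\<delta>^2 * \<delta>^2)" by (simp add: power2_eq_square)
      also have "\<dots> \<le> M3^2 * (\<delta>^2 * 1)" using \<delta>2 by (intro mult_left_mono) auto
      finally have 3: "\<bar>r^2\<bar> \<le> M3^2 * \<delta>^2" by simp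
      have "\<bar>a * e\<bar> \<le> M1 * (M3 * \<delta>^2)" unfolding abs_mult using bnds e M1(1) by (intro mult_mono) auto
      then show ?thesis using 1 2 3 by linarith
    qed
    also have "\<dots> = K * \<delta>^2" by (simp add: K_def algebra_simps)
    finally have diff: "\<bar>A^2 - a * deriv F t\<bar> \<le> K * \<delta>^2" .
    have Am: "m \<le> A"
    proof -
      have *: "m \<le> (F y - F x) / (y - x)" if xy: "x < y" for x y
      proof -
        obtain z where "F y - F x = (y - x) * deriv F z"
          using MVT2[of x y F "deriv F"] xy Cr_real_has_deriv[OF C3, of 0] by auto
        then show ?thesis using m(2)[of z] xy by simp
      qed
      show ?thesis
      proof (cases "s < t")
        case True
        then show ?thesis using * by (simp add: A_def \<delta>_def)
      next
        case False
        have "(F t - F s) / (t - s) = (F s - F t) / (s - t)" by (metis minus_diff_eq minus_divide_divide)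
        then show ?thesis using *[of t s] False st by (simp add: A_def \<delta>_def)
      qed
    qed
    define P where "P = a * deriv F t"
    have Pm: "m^2 \<le> P" unfolding P_def power2_eq_square a_def using m pos[of s] by (intro mult_mono) (auto simp: less_imp_le)
    have A2: "m^2 \<le> A^2" using Am m(1) by (intro power_mono) auto
    have m2: "0 < m^2" using m by simp
    have ln_le: "ln x - ln y \<le> \<bar>x - y\<bar> / m^2" if "m^2 \<le> x" "m^2 \<le> y" for x y
    proof -
      have "0 < x" "0 < y" using that m2 by linarith+
      then have "ln x - ln y = ln (x / y)" by (simp add: ln_div)
      also have "\<dots> \<le> x / y - 1" using \<open>0 < x\<close> \<open>0 < y\<close> by (intro ln_le_minus_one) simp
      also have "\<dots> = (x - y) / y" using \<open>0 < y\<close> by (simp add: field_simps)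
      also have "\<dots> \<le> \<bar>x - y\<bar> / y" using \<open>0 < y\<close> by (intro divide_right_mono) auto
      also have "\<dots> \<le> \<bar>x - y\<bar> / m^2" using that m2 \<open>0 < y\<close> by (intro divide_left_mono mult_pos_pos) auto
      finally show ?thesis .
    qed
    have "deriv F s * deriv F t * (s - t)^2 / (F s - F t)^2 = P / A^2"
      using \<delta>(1) by (simp add: P_def A_def a_def \<delta>_def power_divide power2_commute)
    then have "\<bar>ln (deriv F s * deriv F t * (s - t)^2 / (F s - F t)^2)\<bar> = \<bar>ln P - ln (A^2)\<bar>"
      using less_le_trans[OF m2 Pm] less_le_trans[OF m2 A2] by (simp add: ln_div)
    also have "\<dots> \<le> \<bar>A^2 - P\<bar> / m^2" using ln_le[OF Pm A2] ln_le[OF A2 Pm] by (auto simp: abs_le_iff abs_minus_commute)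
    also have "\<dots> \<le> K * \<delta>^2 / m^2" using diff by (intro divide_right_mono) (auto simp: P_def)
    finally show "\<bar>ln (deriv F s * deriv F t * (s - t)^2 / (F s - F t)^2)\<bar> \<le> K / m^2 * (s - t)^2"
      by (simp add: \<delta>_def power2_commute)
  qed
qed

end

text \<open>A path of minimal length repeats no vertex.\<close>

lemma distinct_chain:
  assumes "(a, b) \<in> R\<^sup>*"
  obtains n f where "f 0 = a" "f n = b" "\<And>i. i < n \<Longrightarrow> (f i, f (Suc i)) \<in> R" "inj_on f {..n :: nat}"
proof -
  define n where "n = (LEAST n. (a, b) \<in> R ^^ n)"
  have ex: "\<exists>n. (a, b) \<in> R ^^ n" using assms rtrancl_imp_relpow by blast
  have n: "(a, b) \<in> R ^^ n" unfolding n_def using ex by (rule LeastI_ex)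
  then obtain f where f: "f 0 = a" "f n = b" "\<And>i. i < n \<Longrightarrow> (f i, f (Suc i)) \<in> R"
    unfolding relpow_fun_conv by blast
  have sub: "(f i, f j) \<in> R ^^ (j - i)" if "i \<le> j" "j \<le> n" for i j
    unfolding relpow_fun_conv using f(3) that by (intro exI[of _ "\<lambda>k. f (i + k)"]) auto
  have "inj_on f {..n}"
  proof (rule linorder_inj_onI)
    fix i j assume ij: "i < j" "i \<in> {..n}" "j \<in> {..n}"
    show "f i \<noteq> f j"
    proof
      assume "f i = f j"
      then have "(f 0, f n) \<in> R ^^ (i + (n - j))"
        using sub[of 0 i] sub[of j n] ij unfolding relpow_add by auto
      then have "(a, b) \<in> R ^^ (i + (n - j))" by (simp only: f(1,2))
      then have "n \<le> i + (n - j)" using Least_le[of "\<lambda>n. (a, b) \<in> R ^^ n"] by (simp only: n_def)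
      then show False using ij by simp
    qed
  qed auto
  then show thesis using that f by blast
qed

section \<open>Subgroups of the bijection group; lifts of circle diffeomorphisms\<close>

lemma BijGroup_mult: "bij f \<Longrightarrow> bij g \<Longrightarrow> f \<otimes>\<^bsub>BijGroup UNIV\<^esub> g = f \<circ> g"
  by (simp add: BijGroup_def Bij_def restrict_UNIV compose_def comp_def)

lemma subgroup_BijGroup_bij: "subgroup G (BijGroup UNIV) \<Longrightarrow> g \<in> G \<Longrightarrow> bij g"
  using subgroup.subset[of G "BijGroup UNIV"] by (auto simp: BijGroup_def Bij_def)

lemma subgroup_BijGroup_comp:
  assumes "subgroup G (BijGroup UNIV)" "f \<in> G" "g \<in> G" shows "f \<circ> g \<in> G"
  using subgroup.m_closed[OF assms] BijGroup_mult subgroup_BijGroup_bij assms by metis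

lemma subgroup_BijGroup_id: "subgroup G (BijGroup UNIV) \<Longrightarrow> id \<in> G"
  using subgroup.one_closed[of G "BijGroup UNIV"] by (simp add: BijGroup_def restrict_UNIV id_def)

lemma BijGroup_inv: "bij g \<Longrightarrow> inv\<^bsub>BijGroup UNIV\<^esub> g = inv_into UNIV g"
  using inv_BijGroup[of g UNIV] by (simp add: Bij_def restrict_UNIV)

lemma subgroup_BijGroup_inv:
  assumes "subgroup G (BijGroup UNIV)" "g \<in> G" shows "inv_into UNIV g \<in> G"
  using subgroup.m_inv_closed[OF assms] BijGroup_inv subgroup_BijGroup_bij assms by metis

lemma circle_of_shift [simp]: "circle_of (t + of_int k) = circle_of t"
  by (simp add: circle_of_eq_iff)

lemma lifts_differ:
  assumes "is_lift F g" "is_lift H g"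
  obtains k :: int where "H = (\<lambda>t. F t + of_int k)"
proof -
  have "H t - F t \<in> \<int>" for t using assms by (simp add: is_lift_def flip: circle_of_eq_iff)
  moreover have "continuous_on UNIV (\<lambda>t. H t - F t)"
    using assms by (intro continuous_on_diff) (auto simp: is_lift_def)
  ultimately have c: "H t - F t = H 0 - F 0" for t
    using continuous_Ints_constant[of "\<lambda>t. H t - F t" t 0] by blast
  obtain k where "H 0 - F 0 = of_int k" using \<open>\<And>t. H t - F t \<in> \<int>\<close>[of 0] by (auto elim: Ints_cases)
  then have "H = (\<lambda>t. F t + of_int k)" using c by (intro ext) (metis add.commute diff_add_cancel)
  then show thesis using that by blast
qed

lemma is_lift_shift: "is_lift F g \<Longrightarrow> is_lift (\<lambda>t. F t + of_int k) g"
  by (auto simp: is_lift_def intro!: continuous_intros)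

lemma is_lift_comp:
  assumes "is_lift F f" "is_lift H g" shows "is_lift (F \<circ> H) (f \<circ> g)"
proof -
  have "continuous_on UNIV (F \<circ> H)"
    using assms by (intro continuous_on_compose) (auto simp: is_lift_def intro: continuous_on_subset)
  then show ?thesis using assms by (auto simp: is_lift_def)
qed

lemma Diff_plus_lift_ex: "g \<in> Diff_plus r \<Longrightarrow> \<exists>F. is_lift F g"
  by (auto simp: Diff_plus_def Cr_circle_def)

context
  fixes F g assumes g: "g \<in> Diff_plus 3" and F: "is_lift F g"
begin

lemma lift_Cr: "Cr_real 3 F"
proof -
  obtain F0 where F0: "is_lift F0 g" "Cr_real 3 F0" using g by (auto simp: Diff_plus_def Cr_circle_def)
  then show ?thesis using lifts_differ[OF F0(1) F] Cr_real_add_const by metis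
qed

lemma lift_strict_mono: "strict_mono F"
proof -
  obtain F0 where F0: "is_lift F0 g" "strict_mono F0" using g by (auto simp: Diff_plus_def orientation_preserving_def)
  obtain k where "F = (\<lambda>t. F0 t + of_int k)" using lifts_differ[OF F0(1) F] .
  then show ?thesis using F0(2) by (auto simp: strict_mono_def)
qed

text \<open>The degree is positive by monotonicity. If it exceeded 1, the lift would take the value
  \<open>F t + 1\<close> strictly inside the period, contradicting injectivity on the
  circle.\<close>

lemma lift_commutes_one: "F (t + 1) = F t + 1"
proof -
  have "circle_of (F (t + 1)) = circle_of (F t)"
    using F circle_of_shift[of t 1] by (simp add: is_lift_def)
  then obtain k where k: "F (t + 1) - F t = of_int k" by (auto simp: circle_of_eq_iff elim: Ints_cases)
  have "F t < F (t + 1)" using lift_strict_mono by (simp add: strict_mono_def)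
  then have "1 \<le> k" using k by linarith
  moreover have "\<not> 1 < k"
  proof
    assume "1 < k"
    then have "(1::real) < of_int k" by simp
    then have "F t \<le> F t + 1" "F t + 1 \<le> F (t + 1)" using k by linarith+
    moreover have "continuous_on {t..t + 1} F" using F by (auto simp: is_lift_def intro: continuous_on_subset)
    ultimately obtain s where s: "t \<le> s" "s \<le> t + 1" "F s = F t + 1"
      using IVT'[of F t "F t + 1" "t + 1"] by auto
    have "s \<noteq> t" "s \<noteq> t + 1" using s(3) k \<open>(1::real) < of_int k\<close> by auto
    have "g (circle_of s) = circle_of (F t + of_int 1)" using F s(3) by (simp add: is_lift_def flip: s(3))
    also have "\<dots> = g (circle_of t)" using F unfolding circle_of_shift by (simp add: is_lift_def)
    finally have "circle_of s = circle_of t" using g by (auto simp: Diff_plus_def dest: bij_is_inj injD)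
    then obtain z where z: "s - t = of_int z" by (auto simp: circle_of_eq_iff elim: Ints_cases)
    then have "(0::real) < of_int z" "of_int z < (1::real)"
      using s(1,2) \<open>s \<noteq> t\<close> \<open>s \<noteq> t + 1\<close> by linarith+
    then show False by simp
  qed
  ultimately show ?thesis using k by simp
qed

lemma lift_has_deriv: "(F has_real_derivative deriv F t) (at t)"
  using Cr_real_has_deriv[OF lift_Cr, of 0 t] by simp

text \<open>An arbitrary lift of the inverse map is inverse to \<open>F\<close> up to an integer on
  either side. Subtracting the integer of one side corrects the other too, as evaluation at
  \<open>F 0\<close> shows.\<close>

lemma lift_inverse_ex:
  obtains H where "is_lift H (inv_into UNIV g)" "\<And>t. H (F t) = t" "\<And>t. F (H t) = t"
    "Cr_real 3 H"
proof -
  obtain H0 where H0: "is_lift H0 (inv_into UNIV g)" "Cr_real 3 H0" using g by (auto simp: Diff_plus_def Cr_circle_def)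
  have bij: "bij g" using g by (simp add: Diff_plus_def)
  have "inv_into UNIV g \<circ> g = id" using bij by (simp add: bij_is_inj)
  then have l1: "is_lift (H0 \<circ> F) id" using is_lift_comp[OF H0(1) F] by simp
  have "g \<circ> inv_into UNIV g = id" using surj_iff[of g] bij_is_surj[OF bij] by blast
  then have l2: "is_lift (F \<circ> H0) id" using is_lift_comp[OF F H0(1)] by simp
  have lid: "is_lift id id" by (simp add: is_lift_def)
  obtain k where k: "H0 \<circ> F = (\<lambda>t. id t + of_int k)" using lifts_differ[OF lid l1] .
  obtain j where j: "F \<circ> H0 = (\<lambda>t. id t + of_int j)" using lifts_differ[OF lid l2] .
  have shift: "F (t + of_int i) = F t + of_int i" for t i
  proof (induction i rule: int_induct[of _ 0])
    case (step1 i)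
    then show ?case using lift_commutes_one[of "t + of_int i"] by (simp add: algebra_simps)
  next
    case (step2 i)
    then show ?case using lift_commutes_one[of "t + of_int i - 1"] by (simp add: algebra_simps)
  qed simp
  define H where "H = (\<lambda>t. H0 t + of_int (- k))"
  have HF: "H (F t) = t" for t using fun_cong[OF k, of t] by (simp add: H_def)
  have FH: "F (H t) = t + of_int (j - k)" for t
    using fun_cong[OF j, of t] shift[of "H0 t" "- k"] by (simp add: H_def)
  have "F (H (F 0)) = F 0 + of_int (j - k)" by (rule FH)
  then have "j = k" unfolding HF by simp
  then have "F (H t) = t" for t using FH by simp
  moreover have "is_lift H (inv_into UNIV g)" unfolding H_def by (rule is_lift_shift[OF H0(1)])
  moreover have "Cr_real 3 H" unfolding H_def by (rule Cr_real_add_const[OF H0(2)])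
  ultimately show thesis using that HF by blast
qed

text \<open>The chain rule with the differentiable inverse excludes 0, and monotonicity excludes
  negative values.\<close>

lemma lift_deriv_pos: "0 < deriv F t"
proof -
  obtain H where H: "\<And>t. H (F t) = t" "Cr_real 3 H" using lift_inverse_ex by metis
  have "(H has_real_derivative deriv H (F t)) (at (F t))" using Cr_real_has_deriv[OF H(2), of 0] by simp
  then have "(H \<circ> F has_real_derivative deriv H (F t) * deriv F t) (at t)"
    using lift_has_deriv by (rule DERIV_chain)
  moreover have "H \<circ> F = (\<lambda>t. t)" using H(1) by auto
  ultimately have "deriv H (F t) * deriv F t = 1" using DERIV_unique DERIV_ident by metis
  then have "deriv F t \<noteq> 0" by auto
  moreover have "0 \<le> deriv F t"
    by (rule mono_on_imp_deriv_nonneg[of UNIV F])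
      (use lift_strict_mono lift_has_deriv in \<open>auto simp: strict_mono_mono\<close>)
  ultimately show ?thesis by simp
qed

end

lemma open_circle_arc: "open (circle_of ` {a<..<b})"
proof -
  have "circle_of -` circle_of ` {a<..<b} = (\<Union>k::int. {a + of_int k<..<b + of_int k})"
  proof (intro equalityI subsetI)
    fix t assume "t \<in> circle_of -` circle_of ` {a<..<b}"
    then obtain s where s: "s \<in> {a<..<b}" "circle_of t = circle_of s" by auto
    then obtain k where "t - s = of_int k" by (auto simp: circle_of_eq_iff elim: Ints_cases)
    then have "t \<in> {a + of_int k<..<b + of_int k}" using s by auto
    then show "t \<in> (\<Union>k::int. {a + of_int k<..<b + of_int k})" by blast
  next
    fix t assume "t \<in> (\<Union>k::int. {a + of_int k<..<b + of_int k})"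
    then obtain k :: int where "t \<in> {a + of_int k<..<b + of_int k}" by blast
    then have "t - of_int k \<in> {a<..<b}" by auto
    moreover have "circle_of t = circle_of (t - of_int k)" by (simp add: circle_of_eq_iff)
    ultimately show "t \<in> circle_of -` circle_of ` {a<..<b}" by blast
  qed
  moreover have "open (\<Union>k::int. {a + of_int k<..<b + of_int k})" by (intro open_UN ballI open_greaterThanLessThan)
  ultimately show ?thesis by (simp add: open_circle_def)
qed

lemma circle_lifts_of_group:
  assumes G: "subgroup G (BijGroup UNIV)" "G \<subseteq> Diff_plus 3" "minimal_action G" "property_star G"
    and t0: "circle_of t0 \<in> NE G"
  shows "circle_lifts {F. \<exists>g\<in>G. is_lift F g} t0"
proof
  let ?\<Gamma> = "{F. \<exists>g\<in>G. is_lift F g}"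
  have deriv_circle: "circle_deriv g (circle_of t) = deriv F t" if "g \<in> G" "is_lift F g" for F g t
    using circle_deriv_eq[OF that(2) lift_has_deriv] that G(2) by blast
  show "F \<circ> H \<in> ?\<Gamma>" if "F \<in> ?\<Gamma>" "H \<in> ?\<Gamma>" for F H
    using that is_lift_comp subgroup_BijGroup_comp[OF G(1)] by blast
  show "(\<lambda>t. t + of_int k) \<in> ?\<Gamma>" for k
    using subgroup_BijGroup_id[OF G(1)] by (auto simp: is_lift_def intro!: bexI[of _ id] continuous_intros)
  fix F assume "F \<in> ?\<Gamma>"
  then obtain g where g: "g \<in> G" "g \<in> Diff_plus 3" "is_lift F g" using G(2) by blast
  obtain H where "is_lift H (inv_into UNIV g)" "\<And>t. H (F t) = t" "\<And>t. F (H t) = t"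
    using lift_inverse_ex[OF g(2,3)] by metis
  then show "\<exists>H\<in>?\<Gamma>. (\<forall>t. H (F t) = t) \<and> (\<forall>t. F (H t) = t)"
    using subgroup_BijGroup_inv[OF G(1) g(1)] by blast
  show "F (t + 1) = F t + 1" for t by (rule lift_commutes_one[OF g(2,3)])
  show "(F has_real_derivative deriv F t) (at t)" for t by (rule lift_has_deriv[OF g(2,3)])
  show "0 < deriv F t" for t by (rule lift_deriv_pos[OF g(2,3)])
  show "\<exists>B\<ge>0. \<forall>s t. \<bar>ln (deriv F s) - ln (deriv F t)\<bar> \<le> B * \<bar>s - t\<bar>"
    by (rule Cr_ln_deriv_lipschitz[OF lift_Cr[OF g(2,3)] lift_commutes_one[OF g(2,3)] lift_deriv_pos[OF g(2,3)]])
  show "\<exists>C\<ge>0. \<forall>s t. s \<noteq> t \<longrightarrow> \<bar>s - t\<bar> \<le> 1 \<longrightarrow>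
         \<bar>ln (deriv F s * deriv F t * (s - t)^2 / (F s - F t)^2)\<bar> \<le> C * (s - t)^2"
    by (rule Cr_projective_distortion[OF lift_Cr[OF g(2,3)] lift_commutes_one[OF g(2,3)] lift_deriv_pos[OF g(2,3)]])
  show "deriv F t0 \<le> 1" using t0 g deriv_circle[OF g(1,3), of t0] by (auto simp: NE_def)
next
  let ?\<Gamma> = "{F. \<exists>g\<in>G. is_lift F g}"
  have deriv_circle: "circle_deriv g (circle_of t) = deriv F t" if "g \<in> G" "is_lift F g" for F g t
    using circle_deriv_eq[OF that(2) lift_has_deriv] that G(2) by blast
  \<comment> \<open>A fixed point on the circle is only moved by an integer by an arbitrary lift, so
    some lift fixes it on the line.\<close>
  have lift_fixing: "\<exists>F. is_lift F g \<and> F z = z" if gz: "g \<in> G" "g (circle_of z) = circle_of z" for g z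
  proof -
    obtain F where F: "is_lift F g" using Diff_plus_lift_ex gz(1) G(2) by blast
    have "circle_of z = circle_of (F z)" using F gz(2) by (simp add: is_lift_def)
    then obtain k where "z - F z = of_int k" by (auto simp: circle_of_eq_iff elim: Ints_cases)
    then show ?thesis using is_lift_shift[OF F, of k] by (intro exI[of _ "\<lambda>t. F t + of_int k"]) auto
  qed
  fix z assume nz: "\<And>F. F \<in> ?\<Gamma> \<Longrightarrow> deriv F z \<le> 1"
  have "circle_deriv g (circle_of z) \<le> 1" if gG: "g \<in> G" for g
  proof -
    obtain F where F: "is_lift F g" using Diff_plus_lift_ex gG G(2) by blast
    then have "deriv F z \<le> 1" using gG by (intro nz) blast
    then show ?thesis using deriv_circle[OF gG F] by simp
  qed
  then have "circle_of z \<in> NE G" by (simp add: NE_def)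
  then have star: "\<exists>g\<in>G. g (circle_of z) = circle_of z \<and> (\<exists>\<epsilon>>0. \<forall>y\<in>right_arc (circle_of z) \<epsilon>. g y \<noteq> y)"
      "\<exists>g\<in>G. g (circle_of z) = circle_of z \<and> (\<exists>\<epsilon>>0. \<forall>y\<in>left_arc (circle_of z) \<epsilon>. g y \<noteq> y)"
    using G(4) unfolding property_star_def minimal_set_minimal_action[OF G(3)] by auto
  from star(1) obtain g \<epsilon> where g: "g \<in> G" "g (circle_of z) = circle_of z" "\<epsilon> > 0"
      "\<And>y. y \<in> right_arc (circle_of z) \<epsilon> \<Longrightarrow> g y \<noteq> y" by blast
  obtain F where F: "is_lift F g" "F z = z" using lift_fixing[OF g(1,2)] by blast
  have ne: "F y \<noteq> y" if "z < y" "y < z + \<epsilon>" for y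
  proof -
    have "circle_of (z + (y - z)) \<in> right_arc (circle_of z) \<epsilon>"
      unfolding right_arc_def using that by (intro CollectI exI[of _ z] exI[of _ "y - z"]) auto
    then have "g (circle_of y) \<noteq> circle_of y" using g(4) by simp
    then show ?thesis using F(1) unfolding is_lift_def by metis
  qed
  show "\<exists>h\<in>?\<Gamma>. h z = z \<and> (\<exists>\<epsilon>>0. \<forall>y. z < y \<and> y < z + \<epsilon> \<longrightarrow> h y \<noteq> y)"
    by (intro bexI[of _ F] conjI exI[of _ \<epsilon>] allI impI) (use F g(1,3) ne in auto)
  from star(2) obtain g \<epsilon> where g: "g \<in> G" "g (circle_of z) = circle_of z" "\<epsilon> > 0"
      "\<And>y. y \<in> left_arc (circle_of z) \<epsilon> \<Longrightarrow> g y \<noteq> y" by blast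
  obtain F where F: "is_lift F g" "F z = z" using lift_fixing[OF g(1,2)] by blast
  have ne: "F y \<noteq> y" if "z - \<epsilon> < y" "y < z" for y
  proof -
    have "circle_of (z - (z - y)) \<in> left_arc (circle_of z) \<epsilon>"
      unfolding left_arc_def using that by (intro CollectI exI[of _ z] exI[of _ "z - y"]) auto
    then have "g (circle_of y) \<noteq> circle_of y" using g(4) by simp
    then show ?thesis using F(1) unfolding is_lift_def by metis
  qed
  show "\<exists>h\<in>?\<Gamma>. h z = z \<and> (\<exists>\<epsilon>>0. \<forall>y. z - \<epsilon> < y \<and> y < z \<longrightarrow> h y \<noteq> y)"
    by (intro bexI[of _ F] conjI exI[of _ \<epsilon>] allI impI) (use F g(1,3) ne in auto)
next
  fix a b :: real assume "a < b"
  then obtain m where m: "m \<in> {a<..<b}" using dense[of a b] by auto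
  have "circle_of m \<in> closure (orbit G (circle_of t0))" using G(3) by (simp add: minimal_action_def)
  then have "circle_of ` {a<..<b} \<inter> closure (orbit G (circle_of t0)) \<noteq> {}" using m by blast
  then have "circle_of ` {a<..<b} \<inter> orbit G (circle_of t0) \<noteq> {}"
    using open_Int_closure_eq_empty[OF open_circle_arc] by blast
  then obtain x where x: "x \<in> orbit G (circle_of t0)" "x \<in> circle_of ` {a<..<b}" by blast
  from x(1) obtain g where g: "g \<in> G" "x = g (circle_of t0)" by (auto simp: orbit_def)
  from x(2) obtain s where s: "a < s" "s < b" "g (circle_of t0) = circle_of s" unfolding g(2) by auto
  obtain F where F: "is_lift F g" using Diff_plus_lift_ex g(1) G(2) by blast
  have "circle_of s = circle_of (F t0)" using F s(3) by (simp add: is_lift_def)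
  then obtain k where "s - F t0 = of_int k" by (auto simp: circle_of_eq_iff elim: Ints_cases)
  then have "F t0 + of_int k = s" by simp
  then show "\<exists>F\<in>{F. \<exists>g\<in>G. is_lift F g}. a < F t0 \<and> F t0 < b"
    using is_lift_shift[OF F, of k] g(1) s by (intro bexI[of _ "\<lambda>t. F t + of_int k"]) auto
qed

text \<open>Induction over \<open>generate\<close> for all orbit points at once, since in a product
  the second word starts at a moved point; inverse generators traverse edges backwards.\<close>

lemma schreier_connected:
  assumes G: "subgroup G (BijGroup UNIV)" "S \<subseteq> G" "generate (BijGroup UNIV) S = G"
    and "v \<in> orbit G x" "w \<in> orbit G x"
  shows "(v, w) \<in> (schreier_edges S (orbit G x))\<^sup>*"
proof -
  let ?E = "schreier_edges S (orbit G x)"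
  have inV: "g v \<in> orbit G x" if "g \<in> G" "v \<in> orbit G x" for g v
    using that subgroup_BijGroup_comp[OF G(1)] unfolding orbit_def by (smt (verit) comp_apply mem_Collect_eq)
  have "\<forall>v\<in>orbit G x. (v, g v) \<in> ?E\<^sup>*" if "g \<in> generate (BijGroup UNIV) S" for g
    using that
  proof (induction rule: generate.induct)
    case one
    then show ?case by (simp add: BijGroup_def restrict_UNIV)
  next
    case (incl s)
    then show ?case using inV G(2) by (auto simp: schreier_edges_def)
  next
    case (inv s)
    then have s: "s \<in> G" "bij s" using G(2) subgroup_BijGroup_bij[OF G(1)] by auto
    have "(v, inv_into UNIV s v) \<in> ?E" if vV: "v \<in> orbit G x" for v
    proof -
      have "inv_into UNIV s v \<in> orbit G x" using inV[OF subgroup_BijGroup_inv[OF G(1) s(1)] vV] .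
      moreover have "s (inv_into UNIV s v) = v" using bij_is_surj[OF s(2)] by (rule surj_f_inv_f)
      ultimately show ?thesis using inv vV unfolding schreier_edges_def by blast
    qed
    then show ?case unfolding BijGroup_inv[OF s(2)] by (blast intro: r_into_rtrancl)
  next
    case (eng f g)
    then have fg: "f \<in> G" "g \<in> G" using G(3) by auto
    then have "f \<otimes>\<^bsub>BijGroup UNIV\<^esub> g = f \<circ> g" using BijGroup_mult subgroup_BijGroup_bij[OF G(1)] by blast
    then show ?case using eng.IH inV[OF fg(2)] by (auto intro: rtrancl_trans)
  qed
  then have to: "(x, g x) \<in> ?E\<^sup>*" if "g \<in> G" for g
    using that G(3) subgroup_BijGroup_id[OF G(1)] unfolding orbit_def by (metis (mono_tags, lifting) id_apply mem_Collect_eq)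
  have "sym (?E\<^sup>*)" by (rule sym_rtrancl) (auto simp: sym_def schreier_edges_def)
  then have "(v, x) \<in> ?E\<^sup>*" "(x, w) \<in> ?E\<^sup>*" using to assms(4,5) unfolding orbit_def by (auto dest: symD)
  then show ?thesis by (rule rtrancl_trans)
qed

section \<open>The Schreier graph of the orbit\<close>

context circle_lifts begin

lemma finite_deriv_ge: "0 < \<tau> \<Longrightarrow> finite {t \<in> X. t \<in> {a..b} \<and> \<tau> \<le> D t}"
proof -
  obtain c where c: "0 < c" "\<And>u v. u\<in>X \<Longrightarrow> v\<in>X \<Longrightarrow> u < v \<Longrightarrow> c * min (D u) (D v) \<le> v - u"
    using separation by blast
  assume "0 < \<tau>"
  then show ?thesis using card_deriv_ge(1)[OF c, of \<tau> a b] by (cases "a \<le> b") auto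
qed

end

text \<open>The path is lifted edge by edge. The generator for each edge is chosen at the point
  reached so far, and the whole composite is kept, as \<open>linked\<close> demands.\<close>

lemma chain_linked:
  assumes "circle_lifts \<Gamma> t0" and \<Sigma>: "\<Sigma> \<subseteq> \<Gamma>" and u: "u \<in> circle_lifts.X \<Gamma> t0"
    and f: "f 0 = circle_of u" "inj_on f {..n}"
    and step: "\<And>i t. i < n \<Longrightarrow> circle_of t = f i \<Longrightarrow> \<exists>\<sigma>\<in>\<Sigma>. circle_of (\<sigma> t) = f (Suc i)"
    and D: "\<And>i t. i \<le> n \<Longrightarrow> t \<in> circle_lifts.X \<Gamma> t0 \<Longrightarrow> circle_of t = f i \<Longrightarrow> circle_lifts.D \<Gamma> t0 t < \<epsilon>"
  obtains F where "F \<in> \<Gamma>" "circle_lifts.linked \<Gamma> t0 \<Sigma> \<epsilon> F u" "circle_of (F u) = f n"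
proof -
  interpret circle_lifts \<Gamma> t0 by fact
  define g :: "nat \<Rightarrow> real \<Rightarrow> real" where
    "g = rec_nat id (\<lambda>i F. (SOME \<sigma>. \<sigma> \<in> \<Sigma> \<and> circle_of (\<sigma> (F u)) = f (Suc i)) \<circ> F)"
  have g0: "g 0 = id" by (simp add: g_def)
  have gSuc: "\<exists>\<sigma>\<in>\<Sigma>. g (Suc i) = \<sigma> \<circ> g i \<and> circle_of (\<sigma> (g i u)) = f (Suc i)"
    if "i < n" "circle_of (g i u) = f i" for i
  proof -
    define \<sigma> where "\<sigma> = (SOME \<sigma>. \<sigma> \<in> \<Sigma> \<and> circle_of (\<sigma> (g i u)) = f (Suc i))"
    have "\<exists>\<sigma>. \<sigma> \<in> \<Sigma> \<and> circle_of (\<sigma> (g i u)) = f (Suc i)" using step[OF that] by blast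
    then have "\<sigma> \<in> \<Sigma> \<and> circle_of (\<sigma> (g i u)) = f (Suc i)" unfolding \<sigma>_def by (rule someI_ex)
    moreover have "g (Suc i) = \<sigma> \<circ> g i" by (simp add: g_def \<sigma>_def)
    ultimately show ?thesis by blast
  qed
  have gf: "circle_of (g i u) = f i" if "i \<le> n" for i
    using that
  proof (induction i)
    case (Suc i)
    then have "\<exists>\<sigma>\<in>\<Sigma>. g (Suc i) = \<sigma> \<circ> g i \<and> circle_of (\<sigma> (g i u)) = f (Suc i)" by (intro gSuc) auto
    then show ?case by auto
  qed (simp add: g0 f)
  have chain: "\<exists>\<sigma>\<in>\<Sigma>. g (Suc i) = \<sigma> \<circ> g i" if "i < n" for i
    using gSuc[OF that gf[OF less_imp_le[OF that]]] by blast
  have mem: "g i \<in> \<Gamma>" if "i \<le> n" for i by (rule chain_mem[OF g0 chain \<Sigma> that])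
  have "linked \<Sigma> \<epsilon> (g n) u"
    unfolding linked_def
  proof (intro exI[of _ n] exI[of _ g] conjI allI impI)
    fix i assume i: "i \<le> n"
    show "D (g i u) < \<epsilon>" by (rule D[OF i X_lift[OF u mem[OF i]] gf[OF i]])
    fix j assume j: "j < i"
    then have "f i \<noteq> f j" using f(2) i by (auto dest: inj_onD)
    then have "circle_of (g i u) \<noteq> circle_of (g j u)" using gf i j by simp
    then show "g i u - g j u \<notin> \<int>" by (simp add: circle_of_eq_iff)
  qed (use g0 chain in auto)
  then show thesis using that mem gf by blast
qed

theorem theorem3:
  fixes G S :: "(circle \<Rightarrow> circle) set" and x0 :: circle
  assumes "subgroup G (BijGroup UNIV)"
    and "G \<subseteq> Diff_plus 3"
    and "finite S" and "S \<subseteq> G" and "generate (BijGroup UNIV) S = G"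
    and "minimal_action G"
    and "property_star G"
    and "x0 \<in> NE G"
  shows "number_of_ends (orbit G x0) (schreier_edges S (orbit G x0)) = \<infinity>"
proof -
  obtain t0 where t0: "circle_of t0 = x0" using circle_of_surj by blast
  define \<Gamma> where "\<Gamma> = {F. \<exists>g\<in>G. is_lift F g}"
  interpret circle_lifts \<Gamma> t0
    unfolding \<Gamma>_def by (rule circle_lifts_of_group) (use assms t0 in auto)
  have \<Gamma>_iff: "F \<in> \<Gamma> \<longleftrightarrow> (\<exists>g\<in>G. is_lift F g)" for F by (simp add: \<Gamma>_def)
  let ?V = "orbit G x0" and ?E = "schreier_edges S (orbit G x0)"
  have bijG: "bij g" if "g \<in> G" for g using subgroup_BijGroup_bij[OF assms(1) that] .
  have X_circle: "t \<in> X \<longleftrightarrow> circle_of t \<in> ?V" for t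
  proof
    assume "t \<in> X"
    then obtain F g where "g \<in> G" "is_lift F g" "t = F t0" by (auto simp: X_def \<Gamma>_iff)
    then show "circle_of t \<in> ?V" using t0 by (auto simp: orbit_def is_lift_def)
  next
    assume "circle_of t \<in> ?V"
    then obtain g where g: "g \<in> G" "circle_of t = g x0" by (auto simp: orbit_def)
    then obtain F where F: "is_lift F g" using Diff_plus_lift_ex assms(2) by blast
    then have "circle_of t = circle_of (F t0)" using g t0 by (simp add: is_lift_def)
    then obtain k where "t - F t0 = of_int k" by (auto simp: circle_of_eq_iff elim: Ints_cases)
    then have "t = F t0 + of_int k" by simp
    moreover have "F t0 \<in> X" using F g by (auto simp: X_def \<Gamma>_iff)
    ultimately show "t \<in> X" using X_shift by simp
  qed
  have "\<forall>s\<in>S. \<exists>F. is_lift F s" using Diff_plus_lift_ex assms(2,4) by blast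
  then obtain L where L: "\<And>s. s \<in> S \<Longrightarrow> is_lift (L s) s" by metis
  have "\<forall>s\<in>S. \<exists>H. is_lift H (inv_into UNIV s) \<and> (\<forall>t. H (L s t) = t) \<and> (\<forall>t. L s (H t) = t)"
  proof
    fix s assume s: "s \<in> S"
    then have "s \<in> Diff_plus 3" using assms(2,4) by blast
    then show "\<exists>H. is_lift H (inv_into UNIV s) \<and> (\<forall>t. H (L s t) = t) \<and> (\<forall>t. L s (H t) = t)"
      using lift_inverse_ex[OF _ L[OF s]] by metis
  qed
  then obtain L' where L': "\<And>s. s \<in> S \<Longrightarrow> is_lift (L' s) (inv_into UNIV s)"
    "\<And>s t. s \<in> S \<Longrightarrow> L' s (L s t) = t" "\<And>s t. s \<in> S \<Longrightarrow> L s (L' s t) = t" by metis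
  \<comment> \<open>Inverses are included because edges have no direction and paths are later
    reversed.\<close>
  define \<Sigma> where "\<Sigma> = L ` S \<union> L' ` S"
  have fin\<Sigma>: "finite \<Sigma>" using assms(3) by (simp add: \<Sigma>_def)
  have "inv_into UNIV s \<in> G" if "s \<in> S" for s using subgroup_BijGroup_inv[OF assms(1)] that assms(4) by blast
  then have \<Sigma>\<Gamma>: "\<Sigma> \<subseteq> \<Gamma>" using L L'(1) assms(4) unfolding \<Sigma>_def \<Gamma>_def by blast
  have \<Sigma>inv: "\<exists>\<sigma>'\<in>\<Sigma>. \<forall>t. \<sigma>' (\<sigma> t) = t" if "\<sigma> \<in> \<Sigma>" for \<sigma>
    using that L'(2,3) unfolding \<Sigma>_def by blast
  have edge: "\<exists>\<sigma>\<in>\<Sigma>. circle_of (\<sigma> t) = w" if vw: "(v, w) \<in> ?E" "circle_of t = v" for v w t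
  proof -
    obtain s where s: "s \<in> S" "s v = w \<or> s w = v" using vw(1) by (auto simp: schreier_edges_def)
    show ?thesis
    proof (cases "s v = w")
      case True
      then have "circle_of (L s t) = w" using L[OF s(1)] vw(2) by (simp add: is_lift_def)
      then show ?thesis using s(1) by (auto simp: \<Sigma>_def)
    next
      case False
      then have "inv_into UNIV s v = w" using s bijG assms(4) by (auto simp: bij_is_inj)
      then have "circle_of (L' s t) = w" using L'(1)[OF s(1)] vw(2) by (simp add: is_lift_def)
      then show ?thesis using s(1) by (auto simp: \<Sigma>_def)
    qed
  qed
  have ends: "enat N \<le> number_of_ends ?V ?E" for N
  proof -
    obtain \<epsilon> and y :: "nat \<Rightarrow> nat \<Rightarrow> real" where \<epsilon>: "0 < \<epsilon>" and y: "\<And>i n. y i n \<in> X"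
      "\<And>i m n. m < n \<Longrightarrow> y i m - y i n \<notin> \<int>"
      "\<And>i j m n F k. i < N \<Longrightarrow> j < N \<Longrightarrow> i \<noteq> j \<Longrightarrow> F \<in> \<Gamma> \<Longrightarrow> linked \<Sigma> \<epsilon> F (y i m) \<Longrightarrow> F (y i m) \<noteq> y j n + of_int k"
      using unlinked_sequences[OF fin\<Sigma> \<Sigma>\<Gamma> \<Sigma>inv] by blast
    \<comment> \<open>A path off \<open>K\<close> stays in \<open>D < \<epsilon>\<close>. The orbit
      points with \<open>D \<ge> \<epsilon>\<close> are finitely many modulo integers, and
      \<open>x0\<close> is inserted so that \<open>K\<close> is nonempty for every
      \<epsilon>.\<close>
    define K where "K = insert x0 (circle_of ` {t \<in> X. t \<in> {0..1} \<and> \<epsilon> \<le> D t})"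
    have small: "D t < \<epsilon>" if "t \<in> X" "circle_of t \<notin> K" for t
    proof (rule ccontr)
      assume "\<not> D t < \<epsilon>"
      define s where "s = t + of_int (- \<lfloor>t\<rfloor>)"
      have "s \<in> X" "D s = D t" unfolding s_def using X_shift D_shift that(1) by blast+
      moreover have "s \<in> {0..1}" unfolding s_def by (auto, linarith)
      ultimately have "circle_of s \<in> K" unfolding K_def using \<open>\<not> D t < \<epsilon>\<close> by auto
      then show False using that(2) unfolding s_def circle_of_shift by simp
    qed
    have x0V: "x0 \<in> ?V" using X_circle[of t0] t0_mem t0 by simp
    show ?thesis
    proof (rule number_of_ends_ge[where K = K and y = "\<lambda>i n. circle_of (y i n)"])
      show "?E \<subseteq> ?V \<times> ?V" "sym ?E" by (auto simp: schreier_edges_def sym_def)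
      show "finite {w. (v, w) \<in> ?E}" for v
      proof -
        have "{w. (v, w) \<in> ?E} \<subseteq> (\<Union>s\<in>S. {s v} \<union> s -` {v})" by (auto simp: schreier_edges_def)
        moreover have "finite (s -` {v})" if "s \<in> S" for s
          using bijG assms(4) that by (intro finite_vimageI) (auto simp: bij_is_inj)
        then have "finite (\<Union>s\<in>S. {s v} \<union> s -` {v})" using assms(3) by blast
        ultimately show ?thesis by (rule finite_subset)
      qed
      show "(v, w) \<in> ?E\<^sup>*" if "v \<in> ?V" "w \<in> ?V" for v w
        using schreier_connected[OF assms(1,4,5) that] .
      show "finite K" "K \<noteq> {}" unfolding K_def using finite_deriv_ge[OF \<epsilon>] by simp_all
      show "K \<subseteq> ?V" unfolding K_def using X_circle x0V by auto
      show "circle_of (y i n) \<in> ?V" for i n using X_circle y(1) by blast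
      show "inj (\<lambda>n. circle_of (y i n))" for i
        by (rule linorder_injI) (use y(2) in \<open>simp add: circle_of_eq_iff\<close>)
      fix i j m n
      assume ij: "i < N" "j < N" "i \<noteq> j" and notK: "circle_of (y i m) \<notin> K" "circle_of (y j n) \<notin> K"
      show "(circle_of (y i m), circle_of (y j n)) \<notin> (?E \<inter> (- K) \<times> (- K))\<^sup>*"
      proof
        assume "(circle_of (y i m), circle_of (y j n)) \<in> (?E \<inter> (- K) \<times> (- K))\<^sup>*"
        then obtain f and l :: nat where f: "f 0 = circle_of (y i m)" "f l = circle_of (y j n)"
          "\<And>i. i < l \<Longrightarrow> (f i, f (Suc i)) \<in> ?E \<inter> (- K) \<times> (- K)" "inj_on f {..l}"
          by (rule distinct_chain) blast
        have fK: "f i \<notin> K" if "i \<le> l" for i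
          using f(3)[of i] that f(2) notK by (cases "i = l") auto
        obtain F where F: "F \<in> \<Gamma>" "linked \<Sigma> \<epsilon> F (y i m)" "circle_of (F (y i m)) = f l"
        proof (rule chain_linked[OF circle_lifts_axioms \<Sigma>\<Gamma> y(1) f(1,4)])
          show "\<exists>\<sigma>\<in>\<Sigma>. circle_of (\<sigma> t) = f (Suc i)" if "i < l" "circle_of t = f i" for i t
            using edge[OF _ that(2)] f(3)[OF that(1)] by blast
          show "D t < \<epsilon>" if "i \<le> l" "t \<in> X" "circle_of t = f i" for i t
            using small that fK by simp
        qed
        then obtain k where "F (y i m) - y j n = of_int k" using f(2) by (auto simp: circle_of_eq_iff elim: Ints_cases)
        then have "F (y i m) = y j n + of_int k" by simp
        then show False using y(3)[OF ij F(1,2)] by blast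
      qed
    qed
  qed
  show ?thesis
  proof (cases "number_of_ends ?V ?E")
    case (enat N)
    then show ?thesis using ends[of "Suc N"] by simp
  qed simp
qed

end
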